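(* Let $1\le m\le k\le n-1$ and let $\varphi$ be an integrable right $O(k)$-invariant function on $V_{n,k}$. Then for any $\omega\in C^\infty(V_{n,m})$ the function $$\zeta_*(\alpha)=\Big(\frac{1}{\Gamma_m(\alpha/2)}\,\mathcal C^{*,\alpha}_{m,k}\varphi,\ \omega\Big),$$ originally defined for $\mathrm{Re}\,\alpha>m-1$, extends to all $\alpha\in\mathbb C$ as an entire function.
   Context: $V_{n,m}=\{v\in M_{n,m}(\mathbb R): v'v=I_m\}$ is the Stiefel manifold, with $O(n)$-invariant probability measure $d_*v$; $(g,\omega)=\int_{V_{n,m}}g(v)\overline{\omega(v)}\,d_*v$. Right $O(k)$-invariant means $\varphi(u\gamma)=\varphi(u)$, $\gamma\in O(k)$. For a square matrix $a$, $|a|=|\det a|$. $\Gamma_m(\alpha)=\pi^{m(m-1)/4}\prod_{j=0}^{m-1}\Gamma(\alpha-j/2)$. Dual cosine transform: $(\mathcal C^{*,\alpha}_{m,k}\varphi)(v)=\int_{V_{n,k}}\varphi(u)|v'uu'v|^{(\alpha-k)/2}d_*u$, $v\in V_{n,m}$; it converges absolutely for almost all $v$ when $\mathrm{Re}\,\alpha>m-1$. *)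

theory Defs
  imports "HOL-Probability.Probability_Measure" "HOL-Complex_Analysis.Complex_Analysis"
begin

text \<open>
  An \<open>n \<times> m\<close> real matrix has type \<^typ>\<open>real^'m^'n\<close>, where \<open>n = CARD('n)\<close> and \<open>m = CARD('m)\<close>.
\<close>

definition stiefel :: "(real^'m^'n) set" where
  "stiefel = {v. transpose v ** v = mat 1}"

text \<open>
  The \<open>O(n)\<close>-invariant probability measure on the Stiefel manifold is characterised by the
  following predicate: a Borel probability measure on \<open>V\<^sub>n\<^sub>,\<^sub>m\<close> that equals its push-forward
  under \<open>v \<mapsto> q v\<close> for every \<open>q \<in> O(n)\<close>.  Such a measure exists (it is the push-forward of
  Haar measure under \<open>q \<mapsto> q v\<^sub>0\<close>), and it is unique because \<open>O(n)\<close> is compact and acts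
  transitively.
\<close>

definition stiefel_measure :: "(real^'m^'n) measure \<Rightarrow> bool" where
  "stiefel_measure M \<longleftrightarrow>
     prob_space M \<and> space M = stiefel \<and> sets M = sets (restrict_space borel stiefel) \<and>
     (\<forall>q :: real^'n^'n. orthogonal_matrix q \<longrightarrow> distr M M (\<lambda>v. q ** v) = M)"

definition right_invariant :: "(real^'k^'n \<Rightarrow> complex) \<Rightarrow> bool" where
  "right_invariant \<phi> \<longleftrightarrow>
     (\<forall>u\<in>stiefel. \<forall>\<gamma> :: real^'k^'k. orthogonal_matrix \<gamma> \<longrightarrow> \<phi> (u ** \<gamma>) = \<phi> u)"

text \<open>\<open>C\<^sup>r\<close> functions on an open subset of a normed space, by iterated directional derivatives.\<close>

primrec higher_differentiable_on ::
    "'a::real_normed_vector set \<Rightarrow> ('a \<Rightarrow> 'b::real_normed_vector) \<Rightarrow> nat \<Rightarrow> bool" where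
  "higher_differentiable_on U f 0 \<longleftrightarrow> continuous_on U f"
| "higher_differentiable_on U f (Suc r) \<longleftrightarrow>
     (\<forall>x\<in>U. f differentiable (at x)) \<and>
     (\<forall>h. higher_differentiable_on U (\<lambda>x. frechet_derivative f (at x) h) r)"

text \<open>
  The class \<open>C\<^sup>\<infinity>(S)\<close> of a submanifold \<open>S\<close> of Euclidean space: functions which near every point
  of \<open>S\<close> are restrictions of \<open>C\<^sup>\<infinity>\<close> functions on an open set of the ambient space.  Only the
  values on \<open>S\<close> matter.
\<close>

definition smooth_on_submanifold ::
    "'a::euclidean_space set \<Rightarrow> ('a \<Rightarrow> complex) \<Rightarrow> bool" where
  "smooth_on_submanifold S f \<longleftrightarrow>
     (\<forall>x\<in>S. \<exists>U F. open U \<and> x \<in> U \<and> (\<forall>r. higher_differentiable_on U F r) \<and>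
        (\<forall>y\<in>U \<inter> S. F y = f y))"

definition siegel_gamma :: "nat \<Rightarrow> complex \<Rightarrow> complex" where
  "siegel_gamma m \<alpha> =
     complex_of_real (pi powr (real (m * (m - 1)) / 4)) * (\<Prod>j<m. Gamma (\<alpha> - of_nat j / 2))"

text \<open>
  The integrand of the dual cosine transform.  Where the determinant vanishes, \<open>powr\<close> yields
  \<open>0\<close>; for \<open>m \<le> k\<close> this affects only a null set of pairs \<open>(u, v)\<close>.
\<close>

definition dual_cosine_integrand ::
    "(real^'k^'n \<Rightarrow> complex) \<Rightarrow> complex \<Rightarrow> real^'m^'n \<Rightarrow> real^'k^'n \<Rightarrow> complex" where
  "dual_cosine_integrand \<phi> \<alpha> v u =
     \<phi> u * complex_of_real \<bar>det (transpose v ** u ** transpose u ** v)\<bar>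
             powr ((\<alpha> - of_nat CARD('k)) / 2)"

definition dual_cosine_transform ::
    "(real^'k^'n) measure \<Rightarrow> (real^'k^'n \<Rightarrow> complex) \<Rightarrow> complex \<Rightarrow> real^'m^'n \<Rightarrow> complex" where
  "dual_cosine_transform M \<phi> \<alpha> v = (LINT u|M. dual_cosine_integrand \<phi> \<alpha> v u)"

definition stiefel_inner ::
    "(real^'m^'n) measure \<Rightarrow> (real^'m^'n \<Rightarrow> complex) \<Rightarrow> (real^'m^'n \<Rightarrow> complex) \<Rightarrow> complex" where
  "stiefel_inner M g \<omega> = (LINT v|M. g v * cnj (\<omega> v))"

definition zeta_dual ::
    "(real^'m^'n) measure \<Rightarrow> (real^'k^'n) measure \<Rightarrow>
     (real^'k^'n \<Rightarrow> complex) \<Rightarrow> (real^'m^'n \<Rightarrow> complex) \<Rightarrow> complex \<Rightarrow> complex" where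
  "zeta_dual \<mu> \<nu> \<phi> \<omega> \<alpha> =
     stiefel_inner \<mu>
       (\<lambda>v. 1 / siegel_gamma CARD('m) (\<alpha> / 2) * dual_cosine_transform \<nu> \<phi> \<alpha> v) \<omega>"

end

theory Submission
  imports Defs
begin

text \<open>Write \<open>gram x = det (x' x)\<close>. Integrating a bump around the Stiefel manifold against a power of
  \<open>gram x\<close> and a function of the Gram--Schmidt factor of \<open>x\<close> turns an integral over \<open>V\<^sub>n\<^sub>,\<^sub>m\<close> into one over all
  matrices, because the bump is invariant under the orthogonal group; so it suffices to continue
  \<open>\<integral> gram (u' x) powr ((\<alpha> - k) / 2) g(x) dx\<close> for smooth compactly supported \<open>g\<close>. The singularity on
  \<open>gram (u' x) = 0\<close> is resolved by averaging over the upper triangular group with right Haar measure, acting on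
  \<open>u' x\<close> from the right: it suffices to let \<open>u' x\<close> range over a slab on which \<open>gram\<close> is bounded away from \<open>0\<close>,
  and the kernel becomes a product of powers \<open>|b\<^sub>j\<^sub>j|\<^sup>\<alpha>\<^sup>-\<^sup>j\<close> of the diagonal entries. Each integration by parts
  in \<open>b\<^sub>j\<^sub>j\<close>, applied to the part even in \<open>b\<^sub>j\<^sub>j\<close>, raises an exponent by \<open>2\<close> and produces a factor that the
  matching Gamma function in \<open>\<Gamma>\<^sub>m(\<alpha>/2)\<close> absorbs. All bounds are uniform in \<open>u\<close>, so the continuation survives
  integration against \<open>\<phi>\<close>; the continuations to discs around \<open>0\<close> agree and glue to an entire function.\<close>

section \<open>Higher differentiability\<close>

text \<open>The function \<phi> is merely integrable, so all derivatives must fall on the test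
  function, with bounds uniform in u. For y = u' x, the right Haar integral over triangular b of
  |det b|^(-k) times the indicator of y b^(-1) in the slab is a constant times gram y powr (-k/2).
  Inserting it and substituting \<open>stretch u b x\<close> for x, with Jacobian |det b|^k, leaves
  gram (y b) powr (\<alpha>/2), that is |det b|^\<alpha> times a power of a number bounded above and
  below. With the Haar density, b_jj carries |b_jj|^(s - 1) for s = \<alpha> - j + 1, and s/2 is an
  argument of Gamma in the Siegel Gamma function. The even part matters: on half-lines one would
  divide by s (s + 1) (s + 2) ..., and only every second factor belongs to a pole of Gamma (s/2).
  The bump contributes a mass depending on \<alpha> that has to be divided out. It is kept free of
  zeros by shrinking the bump as the disc grows; hence bump, smoothness class and number of
  integrations by parts are chosen anew for each disc.\<close>

lemma higher_differentiable_on_cong_open: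
  assumes "open S" "\<And>x. x \<in> S \<Longrightarrow> f x = g x" "higher_differentiable_on S f r"
  shows "higher_differentiable_on S g r"
  using assms(2,3)
proof (induction r arbitrary: f g)
  case 0
  then show ?case using continuous_on_cong[of S S f g] by simp
next
  case (Suc r)
  have D: "(g has_derivative frechet_derivative f (at x)) (at x)" if "x \<in> S" for x
    using Suc.prems that assms(1)
    by (metis has_derivative_transform_within_open frechet_derivative_works higher_differentiable_on.simps(2))
  have E: "frechet_derivative g (at x) = frechet_derivative f (at x)" if "x \<in> S" for x
    using D[OF that] frechet_derivative_at by metis
  show ?case
    using Suc.prems Suc.IH[of "\<lambda>x. frechet_derivative f (at x) h" "\<lambda>x. frechet_derivative g (at x) h" for h] D E
    by (auto simp: differentiable_def)
qed

text \<open>The recursion speaks of the chosen \<open>frechet_derivative\<close>; by uniqueness of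
  derivatives an explicit one may stand in for it, so that later inductions can exhibit its
  form.\<close>

lemma higher_differentiable_on_SucI:
  assumes "open S" "\<And>x. x \<in> S \<Longrightarrow> (f has_derivative f' x) (at x)"
    "\<And>h. higher_differentiable_on S (\<lambda>x. f' x h) r"
  shows "higher_differentiable_on S f (Suc r)"
proof -
  have "frechet_derivative f (at x) = f' x" if "x \<in> S" for x
    using assms(2)[OF that] frechet_derivative_at by metis
  then show ?thesis
    using assms higher_differentiable_on_cong_open[OF assms(1) _ assms(3)]
    by (auto simp: differentiable_def)
qed

lemma higher_differentiable_on_SucD:
  "higher_differentiable_on S f (Suc r) \<Longrightarrow> higher_differentiable_on S f r"
proof (induction r arbitrary: f)
  case 0
  then show ?case
    by (auto intro!: continuous_at_imp_continuous_on differentiable_imp_continuous_within)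
qed simp

lemma higher_differentiable_on_le:
  "higher_differentiable_on S f r \<Longrightarrow> s \<le> r \<Longrightarrow> higher_differentiable_on S f s"
  by (induction r) (auto simp: le_Suc_eq simp del: higher_differentiable_on.simps dest: higher_differentiable_on_SucD)

lemma higher_differentiable_on_imp_continuous_on:
  "higher_differentiable_on S f r \<Longrightarrow> continuous_on S f"
  using higher_differentiable_on_le[of S f r 0] by simp

lemma higher_differentiable_on_subset:
  "higher_differentiable_on S f r \<Longrightarrow> T \<subseteq> S \<Longrightarrow> higher_differentiable_on T f r"
  by (induction r arbitrary: f) (auto intro: continuous_on_subset)

text \<open>Continuity and differentiability at a point are local. The lemma serves functions like
  \<omega>, whose smooth extensions exist only near each point of the manifold.\<close>

lemma higher_differentiable_on_local:
  assumes "\<And>x. x \<in> S \<Longrightarrow> \<exists>T. open T \<and> x \<in> T \<and> higher_differentiable_on T f r"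
  shows "higher_differentiable_on S f r"
  using assms
proof (induction r arbitrary: f)
  case 0
  then show ?case
    by (metis continuous_at_imp_continuous_on continuous_on_eq_continuous_at higher_differentiable_on.simps(1))
next
  case (Suc r)
  show ?case
    unfolding higher_differentiable_on.simps
  proof (intro conjI ballI allI)
    show "f differentiable at x" if "x \<in> S" for x
      using Suc.prems[OF that] higher_differentiable_on.simps(2) by blast
    show "higher_differentiable_on S (\<lambda>x. frechet_derivative f (at x) h) r" for h
    proof (rule Suc.IH)
      fix x assume "x \<in> S"
      from Suc.prems[OF this] show "\<exists>T. open T \<and> x \<in> T \<and>
          higher_differentiable_on T (\<lambda>x. frechet_derivative f (at x) h) r"
        unfolding higher_differentiable_on.simps by blast
    qed
  qed
qed

lemma higher_differentiable_on_const: "open S \<Longrightarrow> higher_differentiable_on S (\<lambda>x. c) r"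
proof (induction r arbitrary: c)
  case (Suc r)
  then show ?case
    by (intro higher_differentiable_on_SucI[where f'="\<lambda>x h. 0"] has_derivative_const)
qed simp

lemma higher_differentiable_on_linear:
  assumes "bounded_linear f" "open S" shows "higher_differentiable_on S f r"
proof (cases r)
  case 0
  then show ?thesis using assms linear_continuous_on by auto
next
  case (Suc n)
  show ?thesis unfolding Suc
    by (rule higher_differentiable_on_SucI[OF assms(2), where f'="\<lambda>x. f"])
      (auto intro: bounded_linear_imp_has_derivative assms higher_differentiable_on_const)
qed

lemma higher_differentiable_on_add:
  assumes "open S" "higher_differentiable_on S f r" "higher_differentiable_on S g r"
  shows "higher_differentiable_on S (\<lambda>x. f x + g x) r"
  using assms(2,3)
proof (induction r arbitrary: f g)
  case 0
  then show ?case by (auto intro: continuous_intros)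
next
  case (Suc r)
  show ?case
  proof (rule higher_differentiable_on_SucI[OF assms(1)])
    show "((\<lambda>x. f x + g x) has_derivative
        (\<lambda>h. frechet_derivative f (at x) h + frechet_derivative g (at x) h)) (at x)" if "x \<in> S" for x
      using Suc.prems that by (intro has_derivative_add) (auto simp flip: frechet_derivative_works)
  qed (use Suc in auto)
qed

lemma higher_differentiable_on_sum:
  assumes "open S" "\<And>i. i \<in> I \<Longrightarrow> higher_differentiable_on S (f i) r"
  shows "higher_differentiable_on S (\<lambda>x. \<Sum>i\<in>I. f i x) r"
  using assms(2)
  by (induction I rule: infinite_finite_induct)
    (simp_all add: higher_differentiable_on_const higher_differentiable_on_add assms(1))

lemma higher_differentiable_on_bilinear:
  assumes "bounded_bilinear B" "open S"
    "higher_differentiable_on S f r" "higher_differentiable_on S g r"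
  shows "higher_differentiable_on S (\<lambda>x. B (f x) (g x)) r"
  using assms(3,4)
proof (induction r arbitrary: f g)
  case 0
  then show ?case using bounded_bilinear.continuous_on[OF assms(1)] by auto
next
  case (Suc r)
  have f: "higher_differentiable_on S f r" "higher_differentiable_on S g r"
    using Suc.prems by (auto intro: higher_differentiable_on_SucD simp del: higher_differentiable_on.simps(2))
  show ?case
  proof (rule higher_differentiable_on_SucI[OF assms(2)])
    show "((\<lambda>x. B (f x) (g x)) has_derivative
        (\<lambda>h. B (f x) (frechet_derivative g (at x) h) + B (frechet_derivative f (at x) h) (g x))) (at x)"
      if "x \<in> S" for x
      using Suc.prems that
      by (intro bounded_bilinear.FDERIV[OF assms(1)]) (auto simp flip: frechet_derivative_works)
    show "higher_differentiable_on S
        (\<lambda>x. B (f x) (frechet_derivative g (at x) h) + B (frechet_derivative f (at x) h) (g x)) r" for h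
      using Suc.prems f by (intro higher_differentiable_on_add Suc.IH assms) auto
  qed
qed

lemmas higher_differentiable_on_scaleR = higher_differentiable_on_bilinear[OF bounded_bilinear_scaleR]
lemmas higher_differentiable_on_mult = higher_differentiable_on_bilinear[OF bounded_bilinear_mult]
lemmas higher_differentiable_on_inner = higher_differentiable_on_bilinear[OF bounded_bilinear_inner]

text \<open>The chain rule evaluates the derivative of g in a direction that varies with x, whereas
  the induction is about fixed directions. Expanding that direction in \<open>Basis\<close> repairs
  this, which is why the middle space is Euclidean.\<close>

lemma higher_differentiable_on_compose:
  fixes f :: "'a::real_normed_vector \<Rightarrow> 'b::euclidean_space"
  assumes "open S" "open T" "higher_differentiable_on T g r" "higher_differentiable_on S f r" "f ` S \<subseteq> T"
  shows "higher_differentiable_on S (\<lambda>x. g (f x)) r"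
  using assms(3-)
proof (induction r arbitrary: f g)
  case 0
  then show ?case by (auto intro: continuous_on_compose2)
next
  case (Suc r)
  have f: "higher_differentiable_on S f r"
    using Suc.prems by (auto intro: higher_differentiable_on_SucD simp del: higher_differentiable_on.simps(2))
  define f' where "f' = (\<lambda>x h. \<Sum>i\<in>Basis. (frechet_derivative f (at x) h \<bullet> i) *\<^sub>R frechet_derivative g (at (f x)) i)"
  show ?case
  proof (rule higher_differentiable_on_SucI[OF assms(1), where f'=f'])
    fix x assume x: "x \<in> S"
    have df: "(f has_derivative frechet_derivative f (at x)) (at x)"
      using Suc.prems x by (auto intro!: frechet_derivative_works[THEN iffD1])
    have dg: "(g has_derivative frechet_derivative g (at (f x))) (at (f x))"
      using Suc.prems x by (auto intro!: frechet_derivative_works[THEN iffD1])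
    have eq: "frechet_derivative g (at (f x)) (frechet_derivative f (at x) h) = f' x h" for h
      unfolding f'_def by (subst euclidean_representation[symmetric, of "frechet_derivative f (at x) h"])
        (simp only: linear_sum[OF has_derivative_linear[OF dg]] linear_cmul[OF has_derivative_linear[OF dg]])
    show "((\<lambda>x. g (f x)) has_derivative f' x) (at x)"
      using has_derivative_compose[OF df dg] by (simp add: eq[abs_def])
  next
    fix h
    show "higher_differentiable_on S (\<lambda>x. f' x h) r" unfolding f'_def
      by (intro higher_differentiable_on_sum higher_differentiable_on_scaleR assms higher_differentiable_on_inner
          higher_differentiable_on_const Suc.IH[OF _ f]) (use Suc.prems in auto)
  qed
qed

lemma higher_differentiable_on_powr:
  "higher_differentiable_on {0<..} (\<lambda>t::real. t powr a) r"
proof (induction r arbitrary: a)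
  case 0
  then show ?case by (auto intro!: continuous_intros)
next
  case (Suc r)
  have D: "((\<lambda>t::real. t powr a) has_derivative (\<lambda>h. h * (a * x powr (a - 1)))) (at x)" if "x > 0" for x
    using has_real_derivative_powr[OF that, of a] unfolding has_field_derivative_def
    by (rule has_derivative_eq_rhs) auto
  show ?case
  proof (rule higher_differentiable_on_SucI)
    show "higher_differentiable_on {0<..} (\<lambda>t. h * (a * t powr (a - 1))) r" for h
      by (intro higher_differentiable_on_mult higher_differentiable_on_const Suc open_greaterThan)
  qed (use D in auto)
qed

lemma has_derivative_max_power:
  "((\<lambda>t::real. max 0 t ^ Suc (Suc r)) has_real_derivative real (r + 2) * max 0 x ^ Suc r) (at x)"
proof -
  consider "x > 0" | "x < 0" | "x = 0" by linarith
  then show ?thesis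
  proof cases
    case 1
    have "((\<lambda>t::real. t ^ Suc (Suc r)) has_real_derivative real (r + 2) * x ^ Suc r) (at x)"
      using DERIV_pow[of "Suc (Suc r)" x] by simp
    then have "((\<lambda>t::real. max 0 t ^ Suc (Suc r)) has_real_derivative real (r + 2) * x ^ Suc r) (at x)"
      by (rule has_field_derivative_transform_within_open[where S="{0<..}"]) (use 1 in auto)
    then show ?thesis using 1 by simp
  next
    case 2
    have "((\<lambda>t::real. max 0 t ^ Suc (Suc r)) has_real_derivative 0) (at x)"
      by (rule has_field_derivative_transform_within_open[where S="{..<0}", OF DERIV_const[of 0]]) (use 2 in auto)
    then show ?thesis using 2 by simp
  next
    case 3
    have "((\<lambda>h::real. max 0 h ^ Suc (Suc r) / h) \<longlongrightarrow> 0) (at 0)"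
    proof (rule Lim_null_comparison)
      show "\<forall>\<^sub>F h::real in at 0. norm (max 0 h ^ Suc (Suc r) / h) \<le> \<bar>h\<bar> ^ Suc r"
        by (intro always_eventually allI) (auto simp: max_def abs_mult intro!: mult_nonpos_nonneg)
      show "((\<lambda>h::real. \<bar>h\<bar> ^ Suc r) \<longlongrightarrow> 0) (at 0)"
        by (auto intro!: tendsto_eq_intros)
    qed
    then show ?thesis using 3 by (simp add: DERIV_def del: power_Suc)
  qed
qed

text \<open>The profile of the cut-off function. Each derivative lowers the exponent by one, and
  exponent 1 is still continuous; hence exponent r + 1 for class r.\<close>

lemma higher_differentiable_on_max_power:
  "higher_differentiable_on UNIV (\<lambda>t::real. max 0 t ^ Suc r) r"
proof (induction r)
  case 0
  then show ?case by (auto intro!: continuous_intros)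
next
  case (Suc r)
  have D: "((\<lambda>t::real. max 0 t ^ Suc (Suc r)) has_derivative (\<lambda>h. h * (real (r + 2) * max 0 x ^ Suc r))) (at x)" for x
    using has_derivative_max_power[of r x] unfolding has_field_derivative_def
    by (rule has_derivative_eq_rhs) auto
  show ?case
  proof (rule higher_differentiable_on_SucI)
    show "higher_differentiable_on UNIV (\<lambda>t. h * (real (r + 2) * max 0 t ^ Suc r)) r" for h
      by (intro higher_differentiable_on_mult higher_differentiable_on_const Suc open_UNIV)
  qed (use D in auto)
qed

section \<open>Gram--Schmidt orthonormalisation\<close>

text \<open>In the Leibniz expansion a permutation with nonzero product never lowers f and raises it
  wherever it moves an index. Unless it is the identity, the sum of f would grow, but permuting
  leaves that sum unchanged.\<close>

lemma det_rank_triangular: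
  fixes A :: "'a::comm_ring_1^'n^'n" and f :: "'n \<Rightarrow> nat"
  assumes "\<And>i j. A $ i $ j \<noteq> 0 \<Longrightarrow> i = j \<or> f i < f j"
  shows "det A = (\<Prod>i\<in>UNIV. A $ i $ i)"
proof -
  have Z: "(\<Prod>i\<in>UNIV. A $ i $ p i) = 0" if p: "p permutes UNIV" "p \<noteq> id" for p :: "'n \<Rightarrow> 'n"
  proof (rule ccontr)
    assume "(\<Prod>i\<in>UNIV. A $ i $ p i) \<noteq> 0"
    then have *: "i = p i \<or> f i < f (p i)" for i
      using assms by (metis UNIV_I finite_class.finite_UNIV prod_zero)
    obtain i where "i \<noteq> p i" using p(2) by (metis eq_id_iff)
    then have "(\<Sum>i\<in>UNIV. f i) < (\<Sum>i\<in>UNIV. f (p i))"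
      by (intro sum_strict_mono_ex1) (use * in \<open>auto intro: less_imp_le, metis le_refl less_imp_le\<close>)
    then show False using sum.permute[OF p(1), of f] by (simp add: o_def)
  qed
  have "det A = (\<Sum>p\<in>{id}. of_int (sign p) * (\<Prod>i\<in>UNIV. A $ i $ p i))"
    unfolding det_def
    by (rule sum.mono_neutral_right) (use Z in \<open>auto simp: finite_permutations permutes_id\<close>)
  then show ?thesis by simp
qed

text \<open>Gram--Schmidt and triangularity need an order on the index type; any one will do.\<close>

definition rk :: "'a::finite \<Rightarrow> nat" where
  "rk = (SOME f. bij_betw f UNIV {..<CARD('a)})"

lemma bij_betw_rk: "bij_betw (rk :: 'a::finite \<Rightarrow> nat) UNIV {..<CARD('a)}"
proof -
  have "\<exists>f. bij_betw f (UNIV :: 'a set) {..<CARD('a)}"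
    using ex_bij_betw_finite_nat[of "UNIV :: 'a set"] by (simp add: atLeast0LessThan)
  then show ?thesis unfolding rk_def by (rule someI_ex)
qed

lemma rk_eq_iff [simp]: "rk i = rk j \<longleftrightarrow> i = j"
  using bij_betw_rk by (auto simp: bij_betw_def dest: injD)

lemma rk_less: "rk (i :: 'a::finite) < CARD('a)"
  using bij_betw_rk bij_betwE by blast

definition nth_index :: "nat \<Rightarrow> 'a::finite" where
  "nth_index = inv_into UNIV rk"

lemma nth_index_rk [simp]: "nth_index (rk i) = i"
  unfolding nth_index_def by (rule inv_into_f_f) (auto simp: inj_def)

lemma sum_rk_less: "(\<Sum>i<rk (j::'a::finite). f i) = (\<Sum>l\<in>{l. rk (l::'a) < rk j}. f (rk l))"
proof -
  have rk_nth: "rk (nth_index a :: 'a) = a" if "a < rk j" for a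
  proof -
    have "a \<in> {..<CARD('a)}" using that rk_less[of j] by simp
    then obtain l :: 'a where "a = rk l" using bij_betw_rk by (metis bij_betw_def imageE)
    then show ?thesis by simp
  qed
  then show ?thesis
    by (intro sum.reindex_bij_witness[where i=rk and j=nth_index]) auto
qed

text \<open>Since \<open>inverse 0 = 0\<close>, a vector depending on its predecessors yields the
  zero vector. The expansion of a in terms of \<open>gs_vec a\<close> therefore holds without any
  independence condition.\<close>

fun gs_vec :: "(nat \<Rightarrow> 'a::real_inner) \<Rightarrow> nat \<Rightarrow> 'a" where
  "gs_vec a j = (a j - (\<Sum>i<j. (a j \<bullet> gs_vec a i) *\<^sub>R gs_vec a i)) /\<^sub>R
     norm (a j - (\<Sum>i<j. (a j \<bullet> gs_vec a i) *\<^sub>R gs_vec a i))"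

declare gs_vec.simps [simp del]

definition gs_res :: "(nat \<Rightarrow> 'a::real_inner) \<Rightarrow> nat \<Rightarrow> 'a" where
  "gs_res a j = a j - (\<Sum>i<j. (a j \<bullet> gs_vec a i) *\<^sub>R gs_vec a i)"

lemma gs_vec_eq: "gs_vec a j = gs_res a j /\<^sub>R norm (gs_res a j)"
  by (subst gs_vec.simps) (simp add: gs_res_def)

lemma gs_vec_inner_self: "gs_vec a i \<bullet> gs_vec a i = (if gs_res a i = 0 then 0 else 1)"
  by (simp add: gs_vec_eq dot_square_norm power2_eq_square)

text \<open>Strong induction on the larger index: in the inner product of the residual with
  \<open>gs_vec a i\<close>, the terms with l different from i vanish by the hypothesis, applied in
  whichever order l and i come, and the term l = i cancels the leading one.\<close>

lemma gs_vec_orthogonal_less: "i < j \<Longrightarrow> gs_vec a j \<bullet> gs_vec a i = 0"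
proof (induction j arbitrary: i rule: less_induct)
  case (less j)
  have "gs_vec a l \<bullet> gs_vec a i = (if l = i then gs_vec a i \<bullet> gs_vec a i else 0)" if "l < j" for l
    using less.IH[of l i] less.IH[of i l] less.prems that
    by (cases l i rule: linorder_cases) (auto simp: inner_commute)
  then have "(\<Sum>l<j. (a j \<bullet> gs_vec a l) * (gs_vec a l \<bullet> gs_vec a i)) =
      (\<Sum>l<j. if l = i then (a j \<bullet> gs_vec a i) * (gs_vec a i \<bullet> gs_vec a i) else 0)"
    by (intro sum.cong refl) (metis lessThan_iff mult_zero_right)
  also have "\<dots> = (a j \<bullet> gs_vec a i) * (gs_vec a i \<bullet> gs_vec a i)"
    using less.prems by (subst sum.delta) auto
  finally have "gs_res a j \<bullet> gs_vec a i = a j \<bullet> gs_vec a i - (a j \<bullet> gs_vec a i) * (gs_vec a i \<bullet> gs_vec a i)"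
    by (simp only: gs_res_def inner_diff_left inner_sum_left inner_scaleR_left)
  also have "\<dots> = 0"
    by (cases "gs_res a i = 0") (simp_all add: gs_vec_inner_self, simp add: gs_vec_eq)
  finally show ?case by (subst gs_vec_eq) simp
qed

lemma gs_vec_inner:
  "gs_vec a i \<bullet> gs_vec a j = (if i = j then if gs_res a i = 0 then 0 else 1 else 0)"
  using gs_vec_orthogonal_less[of i j a] gs_vec_orthogonal_less[of j i a]
  by (cases i j rule: linorder_cases) (auto simp: gs_vec_inner_self inner_commute)

lemma gs_vec_expand:
  "a j = norm (gs_res a j) *\<^sub>R gs_vec a j + (\<Sum>i<j. (a j \<bullet> gs_vec a i) *\<^sub>R gs_vec a i)"
  by (subst gs_vec_eq) (cases "gs_res a j = 0"; simp add: gs_res_def)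

text \<open>Gram--Schmidt is built from inner products and linear combinations only, so it commutes
  with linear isometries.\<close>

lemma gs_vec_isometry:
  assumes "linear L" "\<And>x y. L x \<bullet> L y = x \<bullet> y"
  shows "gs_vec (\<lambda>i. L (a i)) j = L (gs_vec a j)"
proof (induction j rule: less_induct)
  case (less j)
  have "(\<Sum>i<j. (L (a j) \<bullet> gs_vec (\<lambda>i. L (a i)) i) *\<^sub>R gs_vec (\<lambda>i. L (a i)) i) =
      L (\<Sum>i<j. (a j \<bullet> gs_vec a i) *\<^sub>R gs_vec a i)"
    using less by (simp add: linear_sum[OF assms(1)] linear_cmul[OF assms(1)] assms(2))
  moreover have "norm (L x) = norm x" for x using assms(2)[of x x] by (simp add: norm_eq_sqrt_inner)
  ultimately show ?case
    by (subst (1 2) gs_vec.simps)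
      (simp add: linear_diff[OF assms(1), symmetric] linear_cmul[OF assms(1), symmetric])
qed

lemma higher_differentiable_on_gs_vec:
  fixes a :: "'e::real_normed_vector \<Rightarrow> nat \<Rightarrow> 'a::euclidean_space"
  assumes "open S" "\<And>j. j < d \<Longrightarrow> higher_differentiable_on S (\<lambda>x. a x j) r"
    "\<And>x j. x \<in> S \<Longrightarrow> j < d \<Longrightarrow> gs_res (a x) j \<noteq> 0"
  shows "j < d \<Longrightarrow> higher_differentiable_on S (\<lambda>x. gs_vec (a x) j) r"
proof (induction j rule: less_induct)
  case (less j)
  have R: "higher_differentiable_on S (\<lambda>x. gs_res (a x) j) r"
    unfolding gs_res_def diff_conv_add_uminus sum_negf[symmetric] scaleR_minus_left[symmetric] inner_minus_right[symmetric]
    by (intro higher_differentiable_on_add higher_differentiable_on_sum higher_differentiable_on_scaleR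
        higher_differentiable_on_inner assms less higher_differentiable_on_compose[OF \<open>open S\<close> open_UNIV
          higher_differentiable_on_linear[OF bounded_linear_minus[OF bounded_linear_ident] open_UNIV]])
      (use less in auto)
  \<comment> \<open>In this form the normalising factor is a power function on the positive reals
    composed with a bilinear expression, both covered by the rules above.\<close>
  have N: "inverse (norm x) = (x \<bullet> x) powr (-1/2)" if "x \<noteq> 0" for x :: 'a
    using that by (simp add: norm_eq_sqrt_inner powr_half_sqrt powr_minus)
  have "higher_differentiable_on S (\<lambda>x. ((gs_res (a x) j \<bullet> gs_res (a x) j) powr (-1/2)) *\<^sub>R gs_res (a x) j) r"
    using assms(3) less.prems
    by (intro higher_differentiable_on_scaleR R assms
        higher_differentiable_on_compose[OF \<open>open S\<close> open_greaterThan higher_differentiable_on_powr]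
        higher_differentiable_on_inner) auto
  then show ?case
    by (rule higher_differentiable_on_cong_open[OF \<open>open S\<close>, rotated])
      (use assms(3) less.prems N in \<open>auto simp: gs_vec_eq\<close>)
qed

section \<open>QR factorisation and the Gram determinant\<close>

definition gram :: "real^'m^'n \<Rightarrow> real" where
  "gram x = det (transpose x ** x)"

definition cols :: "real^'m^'n \<Rightarrow> nat \<Rightarrow> real^'n" where
  "cols x j = column (nth_index j) x"

definition orth :: "real^'m^'n \<Rightarrow> real^'m^'n" where
  "orth x = (\<chi> i j. gs_vec (cols x) (rk j) $ i)"

text \<open>With \<open>orth\<close> this is the QR factorisation. A column depending on the earlier
  ones gives a zero column of \<open>orth x\<close> and a zero diagonal entry here, so the
  factorisation needs no rank condition.\<close>

definition tri :: "real^'m^'n \<Rightarrow> real^'m^'m" where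
  "tri x = (\<chi> i j. if i = j then norm (gs_res (cols x) (rk j))
     else if rk i < rk j then column j x \<bullet> column i (orth x) else 0)"

definition upper :: "real^'m^'m \<Rightarrow> bool" where
  "upper t \<longleftrightarrow> (\<forall>i j. rk j < rk i \<longrightarrow> t $ i $ j = 0)"

lemma det_upper: "upper t \<Longrightarrow> det t = (\<Prod>i\<in>UNIV. t $ i $ i)"
  by (rule det_rank_triangular[where f=rk]) (metis upper_def linorder_neqE_nat rk_eq_iff)

lemma upper_tri: "upper (tri x)"
  by (auto simp: upper_def tri_def)

lemma column_orth: "column j (orth x) = gs_vec (cols x) (rk j)"
  by (simp add: orth_def column_def vec_eq_iff)

lemma orth_tri: "orth x ** tri x = x" for x :: "real^'m^'n"
proof -
  have "(orth x ** tri x) $ i $ j = x $ i $ j" for i j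
  proof -
    have "x $ i $ j = cols x (rk j) $ i" by (simp add: cols_def column_def)
    also have "\<dots> = norm (gs_res (cols x) (rk j)) * gs_vec (cols x) (rk j) $ i +
       (\<Sum>l\<in>{l. rk (l::'m) < rk j}. (column j x \<bullet> gs_vec (cols x) (rk l)) * gs_vec (cols x) (rk l) $ i)"
      by (subst gs_vec_expand) (simp add: sum_rk_less cols_def)
    also have "\<dots> = (\<Sum>l\<in>UNIV. gs_vec (cols x) (rk l) $ i * tri x $ l $ j)"
    proof -
      have "(\<Sum>l\<in>UNIV. gs_vec (cols x) (rk l) $ i * tri x $ l $ j) =
          (\<Sum>l\<in>insert j {l. rk l < rk j}. gs_vec (cols x) (rk l) $ i * tri x $ l $ j)"
        by (intro sum.mono_neutral_right) (auto simp: tri_def)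
      also have "\<dots> = norm (gs_res (cols x) (rk j)) * gs_vec (cols x) (rk j) $ i +
          (\<Sum>l\<in>{l. rk l < rk j}. gs_vec (cols x) (rk l) $ i * tri x $ l $ j)"
        by (subst sum.insert) (auto simp: tri_def)
      also have "(\<Sum>l\<in>{l. rk l < rk j}. gs_vec (cols x) (rk l) $ i * tri x $ l $ j) =
          (\<Sum>l\<in>{l. rk (l::'m) < rk j}. (column j x \<bullet> gs_vec (cols x) (rk l)) * gs_vec (cols x) (rk l) $ i)"
        by (intro sum.cong) (auto simp: tri_def column_orth)
      finally show ?thesis by simp
    qed
    finally show ?thesis by (simp add: matrix_matrix_mult_def orth_def)
  qed
  then show ?thesis by (simp add: vec_eq_iff)
qed

lemma transpose_mult_nth: "(transpose x ** y) $ i $ j = column i x \<bullet> column j y"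
  for x :: "real^'m^'n" and y :: "real^'k^'n"
  by (simp add: matrix_matrix_mult_def transpose_def column_def inner_vec_def)

lemma gram_orth: "gram (orth x) = (if \<exists>j. tri x $ j $ j = 0 then 0 else 1)"
proof -
  have D: "(transpose (orth x) ** orth x) $ i $ j = (if i = j then if tri x $ j $ j = 0 then 0 else 1 else 0)" for i j
    by (simp add: transpose_mult_nth column_orth gs_vec_inner tri_def)
  have "gram (orth x) = (\<Prod>j\<in>UNIV. if tri x $ j $ j = 0 then 0 else 1)"
    unfolding gram_def by (subst det_diagonal) (simp_all add: D)
  then show ?thesis by auto
qed

lemma gram_mult: "gram (x ** t) = (det t)\<^sup>2 * gram x"
proof -
  have "transpose (x ** t) ** (x ** t) = transpose t ** (transpose x ** x) ** t"
    by (simp add: matrix_transpose_mul matrix_mul_assoc)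
  then show ?thesis
    by (simp add: gram_def det_mul power2_eq_square det_transpose)
qed

text \<open>\<open>gram (orth x)\<close> is 1 unless a diagonal entry of \<open>tri x\<close>
  vanishes, and in that case \<open>det (tri x)\<close> vanishes too.\<close>

lemma gram_tri: "gram x = (det (tri x))\<^sup>2"
proof -
  have "gram x = (det (tri x))\<^sup>2 * gram (orth x)"
    by (metis gram_mult orth_tri)
  then show ?thesis
    by (auto simp: gram_orth det_upper upper_tri)
qed

lemma gram_nonneg: "gram x \<ge> 0"
  by (simp add: gram_tri)

lemma tri_pos: "gram x \<noteq> 0 \<Longrightarrow> tri x $ j $ j > 0"
  by (auto simp: gram_tri det_upper upper_tri) (simp add: tri_def)

lemma orth_stiefel:
  fixes x :: "real^'m^'n"
  assumes "gram x \<noteq> 0" shows "orth x \<in> stiefel"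
proof -
  have "gs_res (cols x) (rk j) \<noteq> 0" for j :: 'm using tri_pos[OF assms, of j] by (auto simp: tri_def)
  then show ?thesis
    by (auto simp: stiefel_def vec_eq_iff transpose_mult_nth column_orth gs_vec_inner mat_def)
qed

lemma orth_orthogonal_mult:
  fixes q :: "real^'n^'n" and x :: "real^'m^'n"
  assumes "orthogonal_matrix q" shows "orth (q ** x) = q ** orth x"
proof -
  have c: "column j (q ** x) = q *v column j x" for j and x :: "real^'m^'n"
    by (simp add: column_def vec_eq_iff matrix_matrix_mult_def matrix_vector_mult_def)
  have "orthogonal_transformation ((*v) q)"
    using assms by (simp add: orthogonal_transformation_matrix)
  then have q: "(q *v x) \<bullet> (q *v y) = x \<bullet> y" for x y
    by (simp add: orthogonal_transformation_def)
  have "column j (orth (q ** x)) = column j (q ** orth x)" for j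
    unfolding column_orth c
    using gs_vec_isometry[OF matrix_vector_mul_linear q, of "cols x" "rk j"] by (simp add: cols_def[abs_def] c)
  then show ?thesis by (metis (no_types, lifting) column_def vec_lambda_beta vec_eq_iff)
qed

lemma gram_isometry_mult: "u \<in> stiefel \<Longrightarrow> gram (u ** x) = gram x"
proof -
  assume "u \<in> stiefel"
  moreover have "transpose (u ** x) ** (u ** x) = transpose x ** (transpose u ** u) ** x"
    by (simp add: matrix_transpose_mul matrix_mul_assoc)
  ultimately show ?thesis
    by (simp add: gram_def stiefel_def)
qed

section \<open>Lebesgue measure under matrix multiplication\<close>

lemma nn_integral_lborel_shift:
  fixes f :: "'a::euclidean_space \<Rightarrow> ennreal"
  assumes [measurable]: "f \<in> borel_measurable borel"
  shows "(\<integral>\<^sup>+x. f (x + a) \<partial>lborel) = (\<integral>\<^sup>+x. f x \<partial>lborel)"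
    and "(\<integral>\<^sup>+x. f (a - x) \<partial>lborel) = (\<integral>\<^sup>+x. f x \<partial>lborel)"
proof -
  have 1: "(\<integral>\<^sup>+x. g (x + a) \<partial>lborel) = (\<integral>\<^sup>+x. g x \<partial>lborel)"
    if [measurable]: "g \<in> borel_measurable borel" for g :: "'a \<Rightarrow> ennreal" and a
    by (subst (2) lborel_distr_plus[symmetric, of a]) (simp add: nn_integral_distr add.commute)
  show "(\<integral>\<^sup>+x. f (x + a) \<partial>lborel) = (\<integral>\<^sup>+x. f x \<partial>lborel)" by (rule 1) measurable
  have "density (distr lborel borel uminus) (\<lambda>x. 1) = (lborel :: 'a measure)"
    using lborel_affine[of "-1" "0::'a"] by simp
  then have U: "(lborel :: 'a measure) = distr lborel borel uminus"
    by (simp add: density_1)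
  have "(\<integral>\<^sup>+x. f (a - x) \<partial>lborel) = (\<integral>\<^sup>+x. f (a - (- x)) \<partial>lborel)"
    by (subst U, subst nn_integral_distr) simp_all
  also have "\<dots> = (\<integral>\<^sup>+x. f x \<partial>lborel)"
    using 1[of f a] by (simp add: add.commute)
  finally show "(\<integral>\<^sup>+x. f (a - x) \<partial>lborel) = (\<integral>\<^sup>+x. f x \<partial>lborel)" .
qed

lemma unit_ball_vol_nonzero: "unit_ball_vol (real n) \<noteq> 0"
  using unit_ball_vol_pos[of "real n"] by linarith

text \<open>The uniqueness argument for Haar measure, here free of determinants: with h the
  indicator of the unit ball, integrate f (L x) * h (L x - y) over x and y in both orders.
  Translation invariance evaluates one order as (integral of f o L) * V and the other as H *
  (integral of f), where V and H are the integrals of h and h o L.\<close>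

lemma linear_bij_scaling:
  fixes L :: "'a::euclidean_space \<Rightarrow> 'a"
  assumes L: "linear L" "bij L"
  obtains c where "0 < c" "\<And>f. f \<in> borel_measurable borel \<Longrightarrow>
    (\<integral>\<^sup>+x. f (L x) \<partial>lborel) = ennreal c * (\<integral>\<^sup>+x. f x \<partial>lborel)"
proof -
  define h :: "'a \<Rightarrow> ennreal" where "h = indicator (ball 0 1)"
  have [measurable]: "h \<in> borel_measurable borel" unfolding h_def by (intro borel_measurable_indicator) simp
  have [measurable]: "L \<in> borel_measurable borel"
    using L(1) by (intro borel_measurable_continuous_onI linear_continuous_on) (simp add: linear_conv_bounded_linear)
  obtain K where K: "linear K" "K \<circ> L = id"
    using linear_injective_left_inverse[OF L(1) bij_is_inj[OF L(2)]] by blast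
  have LK: "L (K y) = y" for y
  proof -
    obtain z where "y = L z" using bij_is_surj[OF L(2)] by blast
    then show ?thesis using K(2) by (simp add: fun_eq_iff)
  qed
  define H where "H = (\<integral>\<^sup>+x. h (L x) \<partial>lborel)"
  define V where "V = (\<integral>\<^sup>+x. h x \<partial>lborel)"
  have V: "V = ennreal (unit_ball_vol (real DIM('a)))"
    unfolding V_def h_def by (simp add: emeasure_ball)
  have key: "(\<integral>\<^sup>+x. f (L x) \<partial>lborel) * V = H * (\<integral>\<^sup>+x. f x \<partial>lborel)"
    if [measurable]: "f \<in> borel_measurable borel" for f
  proof -
    have LK: "L (x + K y) = L x + y" for x y
      by (simp add: linear_add[OF L(1)] LK)
    have "(\<integral>\<^sup>+x. f (L x) \<partial>lborel) * V = (\<integral>\<^sup>+x. (\<integral>\<^sup>+y. f (L x) * h y \<partial>lborel) \<partial>lborel)"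
      unfolding V_def by (simp add: nn_integral_cmult nn_integral_multc)
    also have "\<dots> = (\<integral>\<^sup>+x. (\<integral>\<^sup>+y. f (L x) * h (L x - y) \<partial>lborel) \<partial>lborel)"
      by (simp add: nn_integral_cmult nn_integral_lborel_shift(2))
    also have "\<dots> = (\<integral>\<^sup>+y. (\<integral>\<^sup>+x. f (L x) * h (L x - y) \<partial>lborel) \<partial>lborel)"
      by (rule lborel_pair.Fubini'[symmetric]) measurable
    also have "\<dots> = (\<integral>\<^sup>+y. (\<integral>\<^sup>+x. f (L x + y) * h (L x) \<partial>lborel) \<partial>lborel)"
    proof (rule nn_integral_cong)
      fix y
      show "(\<integral>\<^sup>+x. f (L x) * h (L x - y) \<partial>lborel) = (\<integral>\<^sup>+x. f (L x + y) * h (L x) \<partial>lborel)"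
        by (subst nn_integral_lborel_shift(1)[symmetric, where a="K y"]) (simp_all add: LK)
    qed
    also have "\<dots> = (\<integral>\<^sup>+x. (\<integral>\<^sup>+y. f (L x + y) * h (L x) \<partial>lborel) \<partial>lborel)"
      by (rule lborel_pair.Fubini') measurable
    also have "\<dots> = (\<integral>\<^sup>+x. (\<integral>\<^sup>+y. f y \<partial>lborel) * h (L x) \<partial>lborel)"
      using nn_integral_lborel_shift(1)[of f "L x" for x] by (simp add: nn_integral_multc add.commute)
    also have "\<dots> = H * (\<integral>\<^sup>+x. f x \<partial>lborel)"
      unfolding H_def by (simp add: nn_integral_cmult mult.commute)
    finally show ?thesis .
  qed
  obtain B where B: "B > 0" "\<And>x. norm (K x) \<le> B * norm x"
    using K(1) linear_bounded_pos by metis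
  obtain B' where B': "B' > 0" "\<And>x. norm (L x) \<le> B' * norm x"
    using L(1) linear_bounded_pos by metis
  have LS: "L -` ball 0 1 \<in> sets borel"
    using measurable_sets[of L borel borel "ball 0 1"] by simp
  have HS: "H = emeasure lborel (L -` ball 0 1)"
  proof -
    have "H = (\<integral>\<^sup>+x. indicator (L -` ball 0 1) x \<partial>lborel)"
      unfolding H_def h_def by (auto intro!: nn_integral_cong split: split_indicator)
    then show ?thesis using LS by simp
  qed
  \<comment> \<open>H is the volume of the preimage of the unit ball. It lies between two balls
    because L and its inverse are bounded, so H is finite and positive.\<close>
  have "H \<le> emeasure lborel (ball (0::'a) B)"
    unfolding HS
  proof (rule emeasure_mono)
    show "L -` ball 0 1 \<subseteq> ball 0 B"
    proof safe
      fix x assume "L x \<in> ball 0 1"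
      then have "norm (K (L x)) < B" using B(2)[of "L x"] B(1)
        by (metis dist_0_norm le_less_trans mem_ball mult.right_neutral mult_strict_left_mono)
      then show "x \<in> ball 0 B" using K(2) by (simp add: fun_eq_iff)
    qed
  qed simp
  also have "\<dots> < \<infinity>" using B(1) by (simp add: emeasure_ball)
  finally have Hf: "H < \<infinity>" .
  have "emeasure lborel (ball (0::'a) (1/B')) \<le> H"
    unfolding HS
  proof (rule emeasure_mono)
    show "ball 0 (1/B') \<subseteq> L -` ball 0 1"
    proof (intro subsetI vimageI2)
      fix x :: 'a assume "x \<in> ball 0 (1/B')"
      then have "B' * norm x < 1" using B'(1) by (simp add: field_simps)
      then show "L x \<in> ball 0 1" using B'(2)[of x] by simp
    qed
  qed (use LS in simp)
  moreover have "0 < emeasure lborel (ball (0::'a) (1/B'))" using B'(1) by (simp add: emeasure_ball)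
  ultimately have Hp: "H > 0" by (rule order.strict_trans2[rotated])
  define c where "c = enn2real H / unit_ball_vol (real DIM('a))"
  have v: "unit_ball_vol (real DIM('a)) > 0" by simp
  have "c > 0" using Hf Hp v unfolding c_def by (simp add: enn2real_positive_iff)
  have cV: "ennreal c * V = H"
    using v Hf \<open>c > 0\<close> unfolding V by (simp add: ennreal_mult[symmetric] c_def unit_ball_vol_nonzero)
  show ?thesis
  proof (rule that[OF \<open>c > 0\<close>])
    fix f :: "'a \<Rightarrow> ennreal" assume "f \<in> borel_measurable borel"
    from key[OF this] have "V * (\<integral>\<^sup>+x. f (L x) \<partial>lborel) = V * (ennreal c * (\<integral>\<^sup>+x. f x \<partial>lborel))"
      by (metis cV mult.assoc mult.commute)
    then show "(\<integral>\<^sup>+x. f (L x) \<partial>lborel) = ennreal c * (\<integral>\<^sup>+x. f x \<partial>lborel)"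
      by (subst (asm) ennreal_mult_cancel_left) (auto simp: V unit_ball_vol_nonzero)
  qed
qed

text \<open>The scaling constant is found by testing on the unit ball, which L maps to
  itself.\<close>

lemma linear_isometry_scaling:
  fixes L :: "'a::euclidean_space \<Rightarrow> 'a"
  assumes L: "linear L" "\<And>x. norm (L x) = norm x" and [measurable]: "f \<in> borel_measurable borel"
  shows "(\<integral>\<^sup>+x. f (L x) \<partial>lborel) = (\<integral>\<^sup>+x. f x \<partial>lborel)"
proof -
  have "inj L" using L linear_injective_0 by (metis norm_eq_zero)
  then have "bij L" using L(1) linear_injective_imp_surjective by (auto simp: bij_def)
  then obtain c where c: "0 < c" "\<And>f. f \<in> borel_measurable borel \<Longrightarrow>
    (\<integral>\<^sup>+x. f (L x) \<partial>lborel) = ennreal c * (\<integral>\<^sup>+x. f x \<partial>lborel)"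
    using linear_bij_scaling[OF L(1)] by blast
  have "emeasure lborel (ball (0::'a) 1) = (\<integral>\<^sup>+x. indicator (ball 0 1) (L x) \<partial>lborel)"
  proof -
    have "(\<integral>\<^sup>+x. indicator (ball 0 1) (L x) \<partial>lborel) = (\<integral>\<^sup>+x. indicator (ball 0 1) (x::'a) \<partial>lborel)"
      by (intro nn_integral_cong) (simp add: indicator_def L)
    then show ?thesis by simp
  qed
  also have "\<dots> = ennreal c * emeasure lborel (ball (0::'a) 1)"
    by (subst c(2)) (auto intro!: borel_measurable_indicator)
  finally have "ennreal c = 1"
    using c(1)
    by (auto simp: unit_ball_vol_nonzero emeasure_ball ennreal_mult[symmetric])
  then show ?thesis using c(2)[of f] by simp
qed

text \<open>Conjugating L by the diagonal map \<open>D t\<close> with entries t^rank multiplies the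
  entry from b' to b by t^(rank b - rank b'). As t tends to 0 the conjugates tend to the identity,
  while their scaling constant remains that of L; so this constant is 1.\<close>

lemma linear_triangular_scaling:
  fixes L :: "'a::euclidean_space \<Rightarrow> 'a" and rank :: "'a \<Rightarrow> nat"
  assumes L: "linear L"
    and tri: "\<And>b b'. b \<in> Basis \<Longrightarrow> b' \<in> Basis \<Longrightarrow> L b' \<bullet> b \<noteq> 0 \<Longrightarrow> b' = b \<or> rank b' < rank b"
    and one: "\<And>b. b \<in> Basis \<Longrightarrow> L b \<bullet> b = 1"
    and f [measurable]: "f \<in> borel_measurable borel"
  shows "(\<integral>\<^sup>+x. f (L x) \<partial>lborel) = (\<integral>\<^sup>+x. f x \<partial>lborel)"
proof -
  have Lx: "L x \<bullet> b = (\<Sum>b'\<in>Basis. (x \<bullet> b') * (L b' \<bullet> b))" for x b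
    by (subst euclidean_representation[symmetric, of x])
       (simp add: linear_sum[OF L] linear_cmul[OF L] inner_sum_left del: euclidean_representation)
  have "inj L"
  proof (subst linear_injective_0[OF L], intro allI impI)
    fix x assume x: "L x = 0"
    have *: "\<forall>b\<in>Basis. rank b = r \<longrightarrow> x \<bullet> b = 0" for r
    proof (induction r rule: less_induct)
      case (less r)
      show ?case
      proof (intro ballI impI)
        fix b :: 'a assume b: "b \<in> Basis" "rank b = r"
        have "(\<Sum>b'\<in>Basis. (x \<bullet> b') * (L b' \<bullet> b)) = (\<Sum>b'\<in>{b}. (x \<bullet> b') * (L b' \<bullet> b))"
          using b less.IH tri by (intro sum.mono_neutral_right) fastforce+
        then show "x \<bullet> b = 0" using Lx[of x b] x one[OF b(1)] by simp
      qed
    qed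
    show "x = 0"
    proof (rule euclidean_eqI)
      show "x \<bullet> b = 0 \<bullet> b" if "b \<in> Basis" for b
        using *[of "rank b"] that by simp
    qed
  qed
  then have "bij L" using L linear_injective_imp_surjective by (auto simp: bij_def)
  then obtain c where c: "0 < c" "\<And>f. f \<in> borel_measurable borel \<Longrightarrow>
    (\<integral>\<^sup>+x. f (L x) \<partial>lborel) = ennreal c * (\<integral>\<^sup>+x. f x \<partial>lborel)"
    using linear_bij_scaling[OF L] by blast
  define D where "D = (\<lambda>(t::real) x::'a. \<Sum>b\<in>Basis. (t ^ rank b * (x \<bullet> b)) *\<^sub>R b)"
  have Db: "D t x \<bullet> b = t ^ rank b * (x \<bullet> b)" if "b \<in> Basis" for t x b
    using that by (simp add: D_def inner_sum_left_Basis)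
  have linD: "linear (D t)" for t
    by (rule linearI; rule euclidean_eqI) (simp_all add: Db inner_add_left distrib_left mult.left_commute)
  have DD1: "D t (D (inverse t) x) = x" if "t \<noteq> 0" for t x
    by (rule euclidean_eqI) (use that in \<open>simp add: Db power_inverse flip: mult.assoc\<close>)
  have DD2: "D (inverse t) (D t x) = x" if "t \<noteq> 0" for t x
    using DD1[of "inverse t" x] that by simp
  define K where "K = (\<Sum>b\<in>Basis. \<Sum>b'\<in>Basis. \<bar>L b' \<bullet> b\<bar>)"
  have near: "norm (D t (L (D (inverse t) x)) - x) \<le> t * K * norm x" if t: "0 < t" "t \<le> 1" for t x
  proof -
    have "\<bar>(D t (L (D (inverse t) x)) - x) \<bullet> b\<bar> \<le> t * (\<Sum>b'\<in>Basis. \<bar>L b' \<bullet> b\<bar>) * norm x" if b: "b \<in> Basis" for b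
    proof -
      have "(D t (L (D (inverse t) x)) - x) \<bullet> b =
         (\<Sum>b'\<in>Basis. (x \<bullet> b') * (t ^ rank b * inverse t ^ rank b' * (L b' \<bullet> b))) - x \<bullet> b"
        using b by (simp add: Db inner_diff_left Lx[of "D (inverse t) x"] sum_distrib_left mult_ac)
      also have "\<dots> = (\<Sum>b'\<in>Basis - {b}. (x \<bullet> b') * (t ^ rank b * inverse t ^ rank b' * (L b' \<bullet> b)))"
        using b t one[OF b] by (subst sum.remove[OF _ b]) (auto simp: field_simps)
      also have "\<bar>\<dots>\<bar> \<le> (\<Sum>b'\<in>Basis - {b}. norm x * (t * \<bar>L b' \<bullet> b\<bar>))"
      proof (rule order.trans[OF sum_abs], rule sum_mono)
        fix b' assume b': "b' \<in> Basis - {b}"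
        have "\<bar>x \<bullet> b'\<bar> \<le> norm x" using b' by (simp add: Basis_le_norm)
        moreover have "\<bar>t ^ rank b * inverse t ^ rank b' * (L b' \<bullet> b)\<bar> \<le> t * \<bar>L b' \<bullet> b\<bar>"
        proof (cases "L b' \<bullet> b = 0")
          case False
          then have r: "rank b' < rank b" using tri[of b b'] b b' by auto
          have "t ^ rank b * inverse t ^ rank b' = t ^ (rank b - rank b')"
            using r t by (simp add: power_diff field_simps)
          also have "\<dots> \<le> t ^ 1" using r t by (intro power_decreasing) auto
          finally show ?thesis using t
            by (simp add: abs_mult mult_right_mono)
        qed simp
        ultimately show "\<bar>(x \<bullet> b') * (t ^ rank b * inverse t ^ rank b' * (L b' \<bullet> b))\<bar> \<le> norm x * (t * \<bar>L b' \<bullet> b\<bar>)"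
          unfolding abs_mult[of "x \<bullet> b'"] by (intro mult_mono) auto
      qed
      also have "\<dots> \<le> (\<Sum>b'\<in>Basis. norm x * (t * \<bar>L b' \<bullet> b\<bar>))"
        using t by (intro sum_mono2) auto
      finally show ?thesis by (simp add: sum_distrib_left sum_distrib_right mult_ac)
    qed
    then have "norm (D t (L (D (inverse t) x)) - x) \<le> (\<Sum>b\<in>Basis. t * (\<Sum>b'\<in>Basis. \<bar>L b' \<bullet> b\<bar>) * norm x)"
      by (intro order.trans[OF norm_le_l1] sum_mono) auto
    then show ?thesis by (simp add: K_def sum_distrib_left sum_distrib_right)
  qed
  have K0: "K \<ge> 0" by (simp add: K_def sum_nonneg)
  let ?d = "DIM('a)"
  let ?v = "unit_ball_vol (real ?d)"
  \<comment> \<open>The constants of \<open>D t\<close> and its inverse cancel, hence c is also the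
    constant of the conjugate \<open>?M\<close>. By \<open>near\<close>, the preimage of the unit
    ball under \<open>?M\<close> lies between the balls of radii 1 / (1 + t K) and 1 / (1 - t
    K).\<close>
  have conj: "c * ?v \<le> ?v * (1 / (1 - t * K)) ^ ?d \<and> ?v * (1 / (1 + t * K)) ^ ?d \<le> c * ?v"
    if t: "0 < t" "t \<le> 1" "t * K < 1" for t
  proof -
    let ?M = "\<lambda>x. D t (L (D (inverse t) x))"
    have bD: "bij (D s)" if "s \<noteq> 0" for s
      using DD1[of s] DD2[of s] that by (intro o_bij[where g="D (inverse s)"]) (auto simp: fun_eq_iff)
    obtain e where e: "0 < e" "\<And>f. f \<in> borel_measurable borel \<Longrightarrow>
      (\<integral>\<^sup>+x. f (D t x) \<partial>lborel) = ennreal e * (\<integral>\<^sup>+x. f x \<partial>lborel)"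
      using linear_bij_scaling[OF linD bD[of t]] t by auto
    obtain e' where e': "0 < e'" "\<And>f. f \<in> borel_measurable borel \<Longrightarrow>
      (\<integral>\<^sup>+x. f (D (inverse t) x) \<partial>lborel) = ennreal e' * (\<integral>\<^sup>+x. f x \<partial>lborel)"
      using linear_bij_scaling[OF linD bD[of "inverse t"]] t by auto
    have [measurable]: "D s \<in> borel_measurable borel" "L \<in> borel_measurable borel" for s
      using linD L by (auto intro!: borel_measurable_continuous_onI linear_continuous_on simp: linear_conv_bounded_linear)
    let ?h = "indicator (ball 0 1) :: 'a \<Rightarrow> ennreal"
    have hm [measurable]: "?h \<in> borel_measurable borel" by (intro borel_measurable_indicator) simp
    have I: "(\<integral>\<^sup>+x. ?h x \<partial>lborel) = ennreal ?v" by (simp add: emeasure_ball)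
    have "ennreal ?v = (\<integral>\<^sup>+x. ?h (D t (D (inverse t) x)) \<partial>lborel)"
      using t I by (simp add: DD1)
    also have "\<dots> = ennreal e' * (ennreal e * ennreal ?v)"
      using e'(2)[of "\<lambda>x. ?h (D t x)"] e(2)[OF hm] I by simp
    finally have "ennreal ?v = ennreal (e' * e * ?v)"
      using e e' by (simp add: ennreal_mult[symmetric] mult.assoc)
    then have ee: "e' * e = 1"
      using e e' by (subst (asm) ennreal_inj) (auto simp: unit_ball_vol_nonzero)
    have "(\<integral>\<^sup>+x. ?h (?M x) \<partial>lborel) = ennreal e' * (ennreal c * (ennreal e * ennreal ?v))"
      using e'(2)[of "\<lambda>x. ?h (D t (L x))"] c(2)[of "\<lambda>x. ?h (D t x)"] e(2)[OF hm] I by simp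
    also have "\<dots> = ennreal (e' * e * c * ?v)"
      using e e' c by (simp add: ennreal_mult[symmetric] mult_ac)
    finally have I2: "(\<integral>\<^sup>+x. ?h (?M x) \<partial>lborel) = ennreal (c * ?v)"
      using ee by simp
    have MS: "?M -` ball 0 1 \<in> sets borel"
    proof -
      have "?M \<in> borel_measurable borel" by measurable
      from measurable_sets[OF this, of "ball 0 1"] show ?thesis by simp
    qed
    have "emeasure lborel (?M -` ball 0 1) = (\<integral>\<^sup>+x. indicator (?M -` ball 0 1) x \<partial>lborel)"
      using MS by simp
    also have "\<dots> = (\<integral>\<^sup>+x. ?h (?M x) \<partial>lborel)"
      by (simp only: indicator_vimage o_def)
    finally have cv: "emeasure lborel (?M -` ball 0 1) = ennreal (c * ?v)"
      unfolding I2 .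
    have sub1: "ball 0 (1 / (1 + t * K)) \<subseteq> ?M -` ball 0 1"
    proof (intro subsetI vimageI2)
      fix x :: 'a assume x: "x \<in> ball 0 (1 / (1 + t * K))"
      have "norm (?M x) \<le> (1 + t * K) * norm x"
        using near[OF t(1,2), of x] norm_triangle_ineq[of "?M x - x" x] by (simp add: algebra_simps)
      also have "\<dots> < 1" using x K0 t by (simp add: field_simps add_pos_nonneg)
      finally show "?M x \<in> ball 0 1" by simp
    qed
    have sub2: "?M -` ball 0 1 \<subseteq> ball 0 (1 / (1 - t * K))"
    proof safe
      fix x :: 'a assume x: "?M x \<in> ball 0 1"
      have "(1 - t * K) * norm x \<le> norm (?M x)"
        using near[OF t(1,2), of x] norm_triangle_ineq[of "x - ?M x" "?M x"] by (simp add: algebra_simps norm_minus_commute)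
      also have "\<dots> < 1" using x by simp
      finally show "x \<in> ball 0 (1 / (1 - t * K))" using t by (simp add: field_simps)
    qed
    have "emeasure lborel (ball (0::'a) (1 / (1 + t * K))) \<le> ennreal (c * ?v)"
      unfolding cv[symmetric] by (rule emeasure_mono[OF sub1]) (use MS in simp)
    moreover have "ennreal (c * ?v) \<le> emeasure lborel (ball (0::'a) (1 / (1 - t * K)))"
      unfolding cv[symmetric] by (rule emeasure_mono[OF sub2]) simp
    ultimately show ?thesis
      using t K0 c(1) by (simp add: emeasure_ball)
  qed
  have "((\<lambda>t. ?v * (1 / (1 - t * K)) ^ ?d) \<longlongrightarrow> ?v * (1 / (1 - 0 * K)) ^ ?d) (at_right 0)"
    "((\<lambda>t. ?v * (1 / (1 + t * K)) ^ ?d) \<longlongrightarrow> ?v * (1 / (1 + 0 * K)) ^ ?d) (at_right 0)"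
    by (intro tendsto_intros; simp)+
  note lims = this
  have ev: "\<forall>\<^sub>F t in at_right 0. 0 < t \<and> t \<le> 1 \<and> t * K < 1"
  proof -
    have "\<forall>\<^sub>F t in at_right 0. t < 1 / (1 + K)"
      using K0 by (intro eventually_at_right_real[THEN eventually_mono] order_tendstoD tendsto_intros) auto
    moreover have "\<forall>\<^sub>F t::real in at_right 0. 0 < t" by (rule eventually_at_right_less)
    ultimately show ?thesis
    proof eventually_elim
      case (elim t)
      then have "t * (1 + K) < 1" using K0 by (simp add: field_simps)
      moreover have "0 \<le> t * K" using elim K0 by simp
      ultimately show ?case using elim by (auto simp: algebra_simps)
    qed
  qed
  have "c * ?v \<le> ?v * (1 / (1 - 0 * K)) ^ ?d"
    by (rule tendsto_lowerbound[OF lims(1)]) (rule eventually_mono[OF ev], use conj in auto)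
  moreover have "?v * (1 / (1 + 0 * K)) ^ ?d \<le> c * ?v"
    by (rule tendsto_upperbound[OF lims(2)]) (rule eventually_mono[OF ev], use conj in auto)
  ultimately have "c * ?v \<le> ?v" "?v \<le> c * ?v" by simp_all
  then have "c * ?v = 1 * ?v" by simp
  then have "c = 1" by (simp add: unit_ball_vol_nonzero)
  then show ?thesis using c(2)[OF f] by simp
qed

text \<open>L = G o N with G the diagonal part and N unipotent: the diagonal map gives the product,
  and N preserves Lebesgue measure.\<close>

lemma linear_triangular_scaling_diag:
  fixes L :: "'a::euclidean_space \<Rightarrow> 'a" and rank :: "'a \<Rightarrow> nat"
  assumes L: "linear L"
    and tri: "\<And>b b'. b \<in> Basis \<Longrightarrow> b' \<in> Basis \<Longrightarrow> L b' \<bullet> b \<noteq> 0 \<Longrightarrow> b' = b \<or> rank b' < rank b"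
    and nz: "\<And>b. b \<in> Basis \<Longrightarrow> L b \<bullet> b \<noteq> 0"
    and f [measurable]: "f \<in> borel_measurable borel"
  shows "(\<integral>\<^sup>+x. f x \<partial>lborel) = ennreal (\<Prod>b\<in>Basis. \<bar>L b \<bullet> b\<bar>) * (\<integral>\<^sup>+x. f (L x) \<partial>lborel)"
proof -
  define G where "G x = 0 + (\<Sum>b\<in>Basis. ((L b \<bullet> b) * (x \<bullet> b)) *\<^sub>R b)" for x :: 'a
  define N where "N x = (\<Sum>b\<in>Basis. ((L x \<bullet> b) / (L b \<bullet> b)) *\<^sub>R b)" for x
  have Nb: "N x \<bullet> b = (L x \<bullet> b) / (L b \<bullet> b)" if "b \<in> Basis" for x b
    using that by (simp add: N_def inner_sum_left_Basis)
  have GN: "G (N x) = L x" for x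
    unfolding G_def by (rule euclidean_eqI) (use nz in \<open>simp add: inner_sum_left_Basis Nb\<close>)
  have [measurable]: "G \<in> borel_measurable borel"
    unfolding G_def by measurable
  have "(\<integral>\<^sup>+x. f x \<partial>lborel) = (\<integral>\<^sup>+x. f x \<partial>density (distr lborel borel G) (\<lambda>_. ennreal (\<Prod>b\<in>Basis. \<bar>L b \<bullet> b\<bar>)))"
    using lborel_affine_euclidean[of "\<lambda>b. L b \<bullet> b" 0] nz by (simp add: G_def[abs_def])
  also have "\<dots> = ennreal (\<Prod>b\<in>Basis. \<bar>L b \<bullet> b\<bar>) * (\<integral>\<^sup>+x. f (G x) \<partial>lborel)"
    by (simp add: nn_integral_density nn_integral_distr nn_integral_cmult)
  also have "(\<integral>\<^sup>+x. f (G x) \<partial>lborel) = (\<integral>\<^sup>+x. f (G (N x)) \<partial>lborel)"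
  proof (rule linear_triangular_scaling[symmetric, where L=N and rank=rank])
    show "linear N"
      by (rule linearI; rule euclidean_eqI)
        (simp_all add: Nb inner_add_left linear_add[OF L] linear_cmul[OF L] add_divide_distrib)
  qed (use nz tri in \<open>auto simp: Nb\<close>)
  finally show ?thesis by (simp add: GN)
qed

lemma Basis_matrix: "(Basis :: (real^'m^'n) set) = (\<lambda>(i, j). axis i (axis j 1)) ` UNIV"
  by (auto simp: Basis_vec_def image_iff)

lemma prod_Basis_matrix: "(\<Prod>b\<in>Basis. f b) = (\<Prod>i\<in>UNIV. \<Prod>j\<in>UNIV. f (axis i (axis j 1)))"
  for f :: "real^'m^'n \<Rightarrow> 'a::comm_monoid_mult"
proof -
  have "inj (\<lambda>(i::'n, j::'m). axis i (axis j (1::real)))"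
    by (auto simp: inj_def axis_eq_axis)
  then show ?thesis
    unfolding Basis_matrix by (subst prod.reindex) (auto simp: prod.cartesian_product case_prod_unfold)
qed

lemma inner_axis_axis: "(x :: real^'m^'n) \<bullet> axis i (axis j 1) = x $ i $ j"
  by (simp add: inner_axis)

text \<open>Each row is transformed by its own triangular map in the column index, so a basis matrix
  with its entry in column j is given the rank of j.\<close>

lemma nn_integral_matrix_triangular:
  fixes L :: "real^'m^'n \<Rightarrow> real^'m^'n"
  assumes L: "\<And>x i j. L x $ i $ j = \<delta> i j * x $ i $ j + (\<Sum>l | rk l < rk j. c i j l * x $ i $ l)"
    and nz: "\<And>i j. \<delta> i j \<noteq> 0"
    and f: "f \<in> borel_measurable borel"
  shows "(\<integral>\<^sup>+x. f x \<partial>lborel) = ennreal (\<Prod>i\<in>UNIV. \<Prod>j\<in>UNIV. \<bar>\<delta> i j\<bar>) * (\<integral>\<^sup>+x. f (L x) \<partial>lborel)"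
proof -
  define rank where "rank b = rk (SOME j. \<exists>i. b = axis i (axis j 1))" for b :: "real^'m^'n"
  have rank: "rank (axis i (axis j 1)) = rk j" for i j
    unfolding rank_def by (rule arg_cong[where f=rk], rule some_equality) (auto simp: axis_eq_axis)
  have ent: "L (axis i' (axis j' 1)) $ i $ j =
      (if i' = i \<and> j' = j then \<delta> i j else if i' = i \<and> rk j' < rk j then c i j j' else 0)" for i j i' j'
  proof -
    have axm: "axis i' (axis j' 1) $ i $ l = (if i' = i \<and> l = j' then 1 else (0::real))" for l
      by (auto simp: axis_def)
    have "(\<Sum>l | rk l < rk j. c i j l * axis i' (axis j' 1) $ i $ l) =
        (\<Sum>l | rk l < rk j. if l = j' then (if i' = i then c i j j' else 0) else 0)"
      by (intro sum.cong) (auto simp: axm)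
    also have "\<dots> = (if i' = i \<and> rk j' < rk j then c i j j' else 0)"
      by (subst sum.delta) auto
    finally show ?thesis by (auto simp: L axm)
  qed
  have "linear L"
    by (rule linearI) (simp_all add: vec_eq_iff L sum.distrib sum_distrib_left distrib_left mult.left_commute)
  then have "(\<integral>\<^sup>+x. f x \<partial>lborel) = ennreal (\<Prod>b\<in>Basis. \<bar>L b \<bullet> b\<bar>) * (\<integral>\<^sup>+x. f (L x) \<partial>lborel)"
  proof (rule linear_triangular_scaling_diag[where rank=rank])
    show "b' = b \<or> rank b' < rank b" if "b \<in> Basis" "b' \<in> Basis" "L b' \<bullet> b \<noteq> 0" for b b'
      using that by (auto simp: Basis_matrix rank inner_axis_axis ent split: if_splits)
    show "L b \<bullet> b \<noteq> 0" if "b \<in> Basis" for b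
      using that nz by (auto simp: Basis_matrix inner_axis_axis ent)
  qed fact
  also have "(\<Prod>b\<in>Basis. \<bar>L b \<bullet> b\<bar>) = (\<Prod>i\<in>UNIV. \<Prod>j\<in>UNIV. \<bar>\<delta> i j\<bar>)"
    by (simp add: prod_Basis_matrix inner_axis_axis ent)
  finally show ?thesis .
qed

section \<open>Orthonormal frames and transitivity of the orthogonal group\<close>

lemma orthonormal_columns_complete:
  fixes v :: "real^'m^'n" and \<iota> :: "'m \<Rightarrow> 'n"
  assumes v: "v \<in> stiefel" and \<iota>: "inj \<iota>"
  obtains q :: "real^'n^'n" where "orthogonal_matrix q" "\<And>j. column (\<iota> j) q = column j v"
proof -
  have vv: "column i v \<bullet> column j v = (if i = j then 1 else 0)" for i j
  proof -
    have "(transpose v ** v) $ i $ j = (mat 1 :: real^'m^'m) $ i $ j" using v by (simp add: stiefel_def)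
    then show ?thesis by (simp add: transpose_mult_nth mat_def)
  qed
  define S where "S = (\<lambda>j. column j v) ` UNIV"
  have injc: "inj (\<lambda>j. column j v)"
    by (rule injI) (metis vv zero_neq_one)
  have cS: "card S = CARD('m)" unfolding S_def by (rule card_image[OF injc])
  have "pairwise orthogonal S"
    by (auto simp: pairwise_def S_def orthogonal_def vv)
  then obtain U where U: "U \<inter> insert 0 S = {}" "pairwise orthogonal (S \<union> U)"
      "span (S \<union> U) = span (S \<union> UNIV)"
    using orthogonal_extension_strong[of S UNIV] by blast
  have "column j v \<noteq> 0" for j using vv[of j j] by auto
  then have "0 \<notin> S" by (auto simp: S_def)
  then have "0 \<notin> S \<union> U" using U(1) by auto
  then have ind: "independent (S \<union> U)" using U(2) pairwise_orthogonal_independent by blast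
  then have fin: "finite (S \<union> U)" using independent_bound by blast
  have "card (S \<union> U) = CARD('n)"
    using ind U(3) by (metis DIM_cart DIM_real Un_UNIV_right dim_eq_card dim_span mult.right_neutral dim_UNIV)
  then have "card U = CARD('n) - CARD('m)"
    using fin U(1) cS card_Un_disjoint[of S U] by (auto simp: Int_commute)
  also have "\<dots> = card (- range \<iota>)"
    using card_image[OF \<iota>] by (simp add: Compl_eq_Diff_UNIV card_Diff_subset)
  finally obtain h where h: "bij_betw h (- range \<iota>) U"
    using fin finite_same_card_bij[of "- range \<iota>" U] by auto
  define w where "w i = (if i \<in> range \<iota> then column (inv \<iota> i) v else h i /\<^sub>R norm (h i))" for i
  have hU: "h i \<in> U" if "i \<notin> range \<iota>" for i using h that by (auto simp: bij_betw_def)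
  have w\<iota>: "w (\<iota> j) = column j v" for j using \<iota> by (simp add: w_def)
  have ww: "w i \<bullet> w j = (if i = j then 1 else 0)" for i j
  proof (cases "i = j")
    case True
    have "h i \<noteq> 0" if "i \<notin> range \<iota>" using hU[OF that] U(1) by auto
    then have "(h i /\<^sub>R norm (h i)) \<bullet> (h i /\<^sub>R norm (h i)) = 1" if "i \<notin> range \<iota>"
      using that by (simp add: dot_square_norm power2_eq_square)
    then show ?thesis using True
      by (cases "i \<in> range \<iota>") (auto simp: w\<iota> vv w_def[of j])
  next
    case False
    have o: "x \<bullet> y = 0" if "x \<in> S \<union> U" "y \<in> S \<union> U" "x \<noteq> y" for x y
      using U(2) that by (auto simp: pairwise_def orthogonal_def)
    consider "i \<in> range \<iota>" "j \<in> range \<iota>" | "i \<in> range \<iota>" "j \<notin> range \<iota>" | "i \<notin> range \<iota>" "j \<in> range \<iota>"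
      | "i \<notin> range \<iota>" "j \<notin> range \<iota>" by blast
    then show ?thesis
    proof cases
      case 1
      then show ?thesis using False by (auto simp: w\<iota> vv)
    next
      case 2
      then obtain a where a: "i = \<iota> a" by blast
      have "column a v \<in> S" "h j \<in> U" using hU 2 by (auto simp: S_def)
      moreover have "column a v \<noteq> h j" using calculation U(1) by (metis IntI empty_iff insertCI)
      ultimately have "column a v \<bullet> h j = 0" by (intro o) auto
      then show ?thesis using 2 False by (auto simp: a w\<iota> w_def[of j])
    next
      case 3
      then obtain a where a: "j = \<iota> a" by blast
      have "column a v \<in> S" "h i \<in> U" using hU 3 by (auto simp: S_def)
      moreover have "h i \<noteq> column a v" using calculation U(1) by (metis IntI empty_iff insertCI)
      ultimately have "h i \<bullet> column a v = 0" by (intro o) auto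
      then show ?thesis using 3 False by (auto simp: a w\<iota> w_def[of i])
    next
      case 4
      then have "h i \<noteq> h j" using False h by (auto simp: bij_betw_def inj_on_def)
      then show ?thesis using 4 hU o[of "h i" "h j"] False by (auto simp: w_def)
    qed
  qed
  define q :: "real^'n^'n" where "q = (\<chi> i j. w j $ i)"
  have cq: "column j q = w j" for j by (simp add: q_def column_def vec_eq_iff)
  show ?thesis
  proof (rule that)
    show "orthogonal_matrix q"
      unfolding orthogonal_matrix by (simp add: vec_eq_iff transpose_mult_nth cq ww mat_def)
  qed (simp add: cq w\<iota>)
qed

text \<open>The frame of standard unit vectors indexed by \<iota>. An injection between the index
  types replaces the inclusion of the first m indices among n.\<close>

definition frame :: "('m \<Rightarrow> 'n) \<Rightarrow> real^'m^'n" where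
  "frame \<iota> = (\<chi> i j. if i = \<iota> j then 1 else 0)"

lemma column_matrix_mult: "column j (q ** x) = q *v column j x"
  by (simp add: column_def vec_eq_iff matrix_matrix_mult_def matrix_vector_mult_def)

lemma matrix_mult_frame: "q ** frame \<iota> = (\<chi> i j. q $ i $ \<iota> j)"
  by (simp add: frame_def matrix_matrix_mult_def if_distrib cong: if_cong)

lemma stiefel_frame:
  fixes v :: "real^'m^'n" and \<iota> :: "'m \<Rightarrow> 'n"
  assumes "v \<in> stiefel" "inj \<iota>"
  obtains q :: "real^'n^'n" where "orthogonal_matrix q" "v = q ** frame \<iota>"
proof -
  obtain q :: "real^'n^'n" where q: "orthogonal_matrix q" "\<And>j. column (\<iota> j) q = column j v"
    using orthonormal_columns_complete[OF assms] by blast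
  then have "v = q ** frame \<iota>"
    by (simp add: matrix_mult_frame vec_eq_iff column_def)
  then show ?thesis using q(1) that by blast
qed

lemma frame_stiefel: "inj \<iota> \<Longrightarrow> frame \<iota> \<in> stiefel"
proof -
  assume \<iota>: "inj \<iota>"
  have "(\<Sum>k\<in>UNIV. (if k = \<iota> i then 1 else 0) * (if k = \<iota> j then 1 else 0)) = (if i = j then 1 else (0::real))" for i j
  proof -
    have "(\<Sum>k\<in>UNIV. (if k = \<iota> i then 1 else 0) * (if k = \<iota> j then 1 else 0)) =
       (\<Sum>k\<in>UNIV. if k = \<iota> i then (if i = j then 1 else 0) else (0::real))"
      using \<iota> by (intro sum.cong) (auto simp: inj_eq)
    then show ?thesis by simp
  qed
  then show ?thesis
    by (simp add: stiefel_def frame_def matrix_matrix_mult_def transpose_def mat_def vec_eq_iff)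
qed

lemma exists_inj_index: "CARD('m) \<le> CARD('n) \<Longrightarrow> \<exists>\<iota> :: 'm::finite \<Rightarrow> 'n::finite. inj \<iota>"
  by (metis card_le_inj finite_class.finite_UNIV)

lemma stiefel_transitive:
  fixes v w :: "real^'m^'n"
  assumes "v \<in> stiefel" "w \<in> stiefel" "CARD('m) \<le> CARD('n)"
  obtains q :: "real^'n^'n" where "orthogonal_matrix q" "w = q ** v"
proof -
  obtain \<iota> :: "'m \<Rightarrow> 'n" where \<iota>: "inj \<iota>" using exists_inj_index[OF assms(3)] by blast
  obtain p :: "real^'n^'n" where p: "orthogonal_matrix p" "v = p ** frame \<iota>"
    using stiefel_frame[OF assms(1) \<iota>] .
  obtain q :: "real^'n^'n" where q: "orthogonal_matrix q" "w = q ** frame \<iota>"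
    using stiefel_frame[OF assms(2) \<iota>] .
  have "w = (q ** transpose p) ** v"
    using p q by (metis matrix_mul_assoc matrix_mul_lid orthogonal_matrix_def)
  moreover have "orthogonal_matrix (q ** transpose p)"
    using p q by (simp add: orthogonal_matrix_mul orthogonal_matrix_transpose)
  ultimately show ?thesis using that by blast
qed

lemma orthogonal_mult_stiefel:
  assumes "orthogonal_matrix q" "v \<in> stiefel" shows "q ** v \<in> stiefel"
proof -
  have "transpose (q ** v) ** (q ** v) = transpose v ** (transpose q ** q) ** v"
    by (simp add: matrix_transpose_mul matrix_mul_assoc)
  then show ?thesis using assms by (simp add: stiefel_def orthogonal_matrix)
qed

lemma norm_stiefel_mult:
  fixes u :: "real^'k^'n" and x :: "real^'m^'k"
  assumes "u \<in> stiefel" shows "norm (u ** x) = norm x"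
proof -
  have S: "x \<bullet> x = (\<Sum>j\<in>UNIV. (transpose x ** x) $ j $ j)" for x :: "real^'b^'a"
    by (simp add: inner_vec_def transpose_mult_nth column_def) (rule sum.swap)
  have "transpose (u ** x) ** (u ** x) = transpose x ** (transpose u ** u) ** x"
    by (simp add: matrix_transpose_mul matrix_mul_assoc)
  then have "(u ** x) \<bullet> (u ** x) = x \<bullet> x"
    using assms by (simp add: S stiefel_def)
  then show ?thesis by (simp add: norm_eq_sqrt_inner)
qed

section \<open>Matrix operations and the action of triangular matrices\<close>

lemma bilinear_matrix_mult: "bounded_bilinear (\<lambda>(x::real^'k^'n) (y::real^'m^'k). x ** y)"
  unfolding bilinear_conv_bounded_bilinear[symmetric] bilinear_def
  by (auto intro!: linearI simp: vec_eq_iff matrix_matrix_mult_def sum.distrib sum_distrib_left algebra_simps)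

lemmas continuous_on_matrix_mult [continuous_intros] = bounded_bilinear.continuous_on[OF bilinear_matrix_mult]

lemma continuous_on_transpose [continuous_intros]:
  fixes f :: "'a::topological_space \<Rightarrow> real^'m^'n"
  assumes "continuous_on S f" shows "continuous_on S (\<lambda>x. transpose (f x))"
  unfolding transpose_def by (intro continuous_intros assms)

lemma continuous_on_det [continuous_intros]:
  fixes f :: "'a::topological_space \<Rightarrow> real^'n^'n"
  assumes "continuous_on S f" shows "continuous_on S (\<lambda>x. det (f x))"
  unfolding det_def by (intro continuous_intros assms)

lemma continuous_on_gram [continuous_intros]:
  "continuous_on S f \<Longrightarrow> continuous_on S (\<lambda>x. gram (f x))"
  unfolding gram_def by (intro continuous_intros)

text \<open>Triangular matrices form no type of their own. They are parametrised by all square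
  matrices, whose strictly lower entries are ignored, so that the Lebesgue measure of the matrix
  type is available.\<close>

definition up :: "real^'m^'m \<Rightarrow> real^'m^'m" where
  "up b = (\<chi> i j. if rk i \<le> rk j then b $ i $ j else 0)"

lemma up_nth: "up b $ i $ j = (if rk i \<le> rk j then b $ i $ j else 0)"
  by (simp add: up_def)

lemma upper_up [simp]: "upper (up b)"
  by (simp add: upper_def up_def)

lemma up_diag [simp]: "up b $ j $ j = b $ j $ j"
  by (simp add: up_def)

lemma det_up: "det (up b) = (\<Prod>j\<in>UNIV. b $ j $ j)"
  by (simp add: det_upper)

lemma continuous_on_up [continuous_intros]:
  fixes f :: "'a::topological_space \<Rightarrow> real^'m^'m"
  assumes "continuous_on S f" shows "continuous_on S (\<lambda>x. up (f x))"
proof -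
  have "continuous_on S (\<lambda>x. if P then f x $ i $ j else 0)" for P i j
    by (cases P) (auto intro!: continuous_intros assms)
  then show ?thesis unfolding up_def by (intro continuous_intros)
qed

text \<open>Acts by right multiplication with \<open>up b\<close> on the component of \<open>x\<close> in the range of \<open>u\<close> and fixes
  the orthogonal component.\<close>

definition stretch :: "real^'k^'n \<Rightarrow> real^'m^'m \<Rightarrow> real^'m^'n \<Rightarrow> real^'m^'n" where
  "stretch u b x = x + u ** (transpose u ** x) ** (up b - mat 1)"

lemma transpose_stretch:
  assumes "u \<in> stiefel"
  shows "transpose u ** stretch u b x = transpose u ** x ** up b"
proof -
  have "transpose u ** (u ** (transpose u ** x) ** (up b - mat 1)) =
      (transpose u ** u) ** (transpose u ** x) ** (up b - mat 1)"
    by (simp only: matrix_mul_assoc)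
  also have "\<dots> = transpose u ** x ** up b - transpose u ** x"
    using assms by (simp add: stiefel_def bounded_bilinear.diff_right[OF bilinear_matrix_mult])
  finally show ?thesis by (simp add: stretch_def matrix_add_ldistrib)
qed

lemma continuous_on_stretch [continuous_intros]:
  "continuous_on S f \<Longrightarrow> continuous_on S g \<Longrightarrow> continuous_on S h \<Longrightarrow>
    continuous_on S (\<lambda>x. stretch (f x) (g x) (h x))"
  unfolding stretch_def by (intro continuous_intros)

text \<open>For a standard frame, \<open>stretch\<close> multiplies the rows in the range of \<iota>
  by \<open>up b\<close> and leaves the others alone; this is the triangular form that
  \<open>nn_integral_matrix_triangular\<close> expects.\<close>

lemma stretch_frame_nth:
  fixes x :: "real^'m^'n" and b :: "real^'m^'m"
  assumes "inj \<iota>"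
  shows "stretch (frame \<iota>) b x $ i $ j = (if i \<in> range \<iota> then b $ j $ j else 1) * x $ i $ j +
    (\<Sum>l | rk l < rk j. (if i \<in> range \<iota> then b $ l $ j else 0) * x $ i $ l)"
proof -
  have F: "(frame \<iota> ** (transpose (frame \<iota>) ** x)) $ i $ l = (if i \<in> range \<iota> then x $ i $ l else 0)" for l
  proof -
    have T: "(transpose (frame \<iota>) ** x) $ a $ l = x $ \<iota> a $ l" for a
      by (simp add: frame_def transpose_def matrix_matrix_mult_def if_distrib[where f="\<lambda>c. c * _"] cong: if_cong)
    have "(frame \<iota> ** (transpose (frame \<iota>) ** x)) $ i $ l = (\<Sum>a\<in>UNIV. if i = \<iota> a then x $ i $ l else 0)"
      unfolding matrix_matrix_mult_def[of "frame \<iota>"] vec_lambda_beta T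
      by (intro sum.cong) (auto simp: frame_def)
    also have "\<dots> = (if i \<in> range \<iota> then x $ i $ l else 0)"
    proof (cases "i \<in> range \<iota>")
      case True
      then obtain a where a: "i = \<iota> a" by blast
      have "(\<Sum>a'\<in>UNIV. if i = \<iota> a' then x $ i $ l else 0) = (\<Sum>a'\<in>UNIV. if a' = a then x $ i $ l else 0)"
        using assms a by (intro sum.cong) (auto simp: inj_eq)
      then show ?thesis using True by simp
    next
      case False
      then show ?thesis by (auto intro!: sum.neutral)
    qed
    finally show ?thesis .
  qed
  have U: "(\<Sum>l\<in>UNIV. x $ i $ l * up b $ l $ j) = b $ j $ j * x $ i $ j + (\<Sum>l | rk l < rk j. b $ l $ j * x $ i $ l)"
  proof -
    have "(\<Sum>l\<in>UNIV. x $ i $ l * up b $ l $ j) = (\<Sum>l\<in>insert j {l. rk l < rk j}. x $ i $ l * up b $ l $ j)"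
      by (intro sum.mono_neutral_right) (auto simp: up_def le_less)
    also have "\<dots> = x $ i $ j * b $ j $ j + (\<Sum>l | rk l < rk j. x $ i $ l * up b $ l $ j)"
      by (subst sum.insert) auto
    also have "(\<Sum>l | rk l < rk j. x $ i $ l * up b $ l $ j) = (\<Sum>l | rk l < rk j. b $ l $ j * x $ i $ l)"
      by (intro sum.cong) (auto simp: up_def)
    finally show ?thesis by simp
  qed
  have "stretch (frame \<iota>) b x $ i $ j = x $ i $ j + (\<Sum>l\<in>UNIV. (if i \<in> range \<iota> then x $ i $ l else 0) * (up b $ l $ j - mat 1 $ l $ j))"
    unfolding stretch_def by (subst matrix_matrix_mult_def) (simp add: F)
  also have "\<dots> = x $ i $ j + (if i \<in> range \<iota> then (\<Sum>l\<in>UNIV. x $ i $ l * up b $ l $ j) - x $ i $ j else 0)"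
    by (auto simp: right_diff_distrib sum_subtractf mat_def if_distrib[where f="\<lambda>c. _ * c"] cong: if_cong)
  finally show ?thesis by (auto simp: U)
qed

lemma orthogonal_mult_nn_integral:
  fixes q :: "real^'n^'n" and f :: "real^'m^'n \<Rightarrow> ennreal"
  assumes q: "orthogonal_matrix q" and f: "f \<in> borel_measurable borel"
  shows "(\<integral>\<^sup>+x. f (q ** x) \<partial>lborel) = (\<integral>\<^sup>+x. f x \<partial>lborel)"
proof (rule linear_isometry_scaling[OF _ _ f])
  show "linear (\<lambda>x::real^'m^'n. q ** x)"
    using bounded_bilinear.bounded_linear_right[OF bilinear_matrix_mult] bounded_linear.linear by blast
  show "norm (q ** x) = norm x" for x :: "real^'m^'n"
    using q by (intro norm_stiefel_mult) (simp add: stiefel_def orthogonal_matrix)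
qed

text \<open>An orthogonal matrix takes the standard frame to u and preserves Lebesgue measure, so
  the frame case suffices. There k rows are multiplied by \<open>up b\<close>, each contributing the
  product of its diagonal entries.\<close>

lemma nn_integral_stretch:
  fixes u :: "real^'k^'n" and f :: "real^'m^'n \<Rightarrow> ennreal" and b :: "real^'m^'m"
  assumes u: "u \<in> stiefel" and kn: "CARD('k) \<le> CARD('n)"
    and b: "\<And>j. b $ j $ j \<noteq> 0" and f [measurable]: "f \<in> borel_measurable borel"
  shows "(\<integral>\<^sup>+x. f x \<partial>lborel) =
    ennreal ((\<Prod>j\<in>UNIV. \<bar>b $ j $ j\<bar>) ^ CARD('k)) * (\<integral>\<^sup>+x. f (stretch u b x) \<partial>lborel)"
proof -
  obtain \<iota> :: "'k \<Rightarrow> 'n" where \<iota>: "inj \<iota>" using exists_inj_index[OF kn] by blast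
  obtain q :: "real^'n^'n" where q: "orthogonal_matrix q" "u = q ** frame \<iota>"
    using stiefel_frame[OF u \<iota>] .
  have S: "stretch u b x = q ** stretch (frame \<iota>) b (transpose q ** x)" for x :: "real^'m^'n"
  proof -
    have "q ** (transpose q ** x) = x" using q(1) by (simp add: matrix_mul_assoc orthogonal_matrix_def)
    then show ?thesis
      by (simp add: stretch_def q(2) matrix_add_ldistrib matrix_transpose_mul matrix_mul_assoc)
  qed
  have [measurable]: "(\<lambda>x. q ** x) \<in> borel_measurable borel" "stretch (frame \<iota>) b \<in> borel_measurable borel"
    for q :: "real^'n^'n"
    by (auto intro!: borel_measurable_continuous_onI continuous_intros)
  have "(\<integral>\<^sup>+x. f x \<partial>lborel) = (\<integral>\<^sup>+x. f (q ** x) \<partial>lborel)"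
    by (rule orthogonal_mult_nn_integral[symmetric, OF q(1) f])
  also have "\<dots> = ennreal (\<Prod>i\<in>UNIV. \<Prod>j\<in>UNIV. \<bar>if i \<in> range \<iota> then b $ j $ j else 1\<bar>) *
      (\<integral>\<^sup>+x. f (q ** stretch (frame \<iota>) b x) \<partial>lborel)"
    by (rule nn_integral_matrix_triangular[OF stretch_frame_nth[OF \<iota>]]) (use b in auto)
  also have "(\<integral>\<^sup>+x. f (q ** stretch (frame \<iota>) b x) \<partial>lborel) =
      (\<integral>\<^sup>+x. f (q ** stretch (frame \<iota>) b (transpose q ** x)) \<partial>lborel)"
    using q(1) by (intro orthogonal_mult_nn_integral[symmetric]) (auto simp: orthogonal_matrix_transpose)
  also have "(\<Prod>i\<in>UNIV. \<Prod>j\<in>UNIV. \<bar>if i \<in> range \<iota> then b $ j $ j else 1\<bar>) =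
      (\<Prod>i\<in>range \<iota>. \<Prod>j\<in>UNIV. \<bar>b $ j $ j\<bar>)"
    by (rule prod.mono_neutral_cong_right) auto
  also have "\<dots> = (\<Prod>j\<in>UNIV. \<bar>b $ j $ j\<bar>) ^ CARD('k)"
    using card_image[OF \<iota>] by simp
  finally show ?thesis by (simp add: S)
qed

text \<open>Right translation on the triangular group, extended by the identity on the ignored
  entries, so that it is a linear bijection of the full matrix space for invertible t.\<close>

definition rmul :: "real^'m^'m \<Rightarrow> real^'m^'m \<Rightarrow> real^'m^'m" where
  "rmul t b = (\<chi> i j. if rk i \<le> rk j then (up b ** t) $ i $ j else b $ i $ j)"

lemma upper_mult:
  assumes "upper s" "upper t" shows "upper (s ** t)"
  unfolding upper_def matrix_matrix_mult_def vec_lambda_beta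
proof (intro allI impI sum.neutral ballI)
  fix i j l :: 'a assume "rk j < rk i"
  then have "rk l < rk i \<or> rk j < rk l" by linarith
  then show "s $ i $ l * t $ l $ j = 0" using assms by (auto simp: upper_def)
qed

lemma up_rmul: "upper t \<Longrightarrow> up (rmul t b) = up b ** t"
  using upper_mult[OF upper_up, of t b]
  by (simp add: vec_eq_iff up_nth rmul_def upper_def not_le)

lemma rmul_nth:
  fixes t b :: "real^'m^'m"
  assumes "upper t"
  shows "rmul t b $ i $ j = (if rk i \<le> rk j then t $ j $ j else 1) * b $ i $ j +
    (\<Sum>l | rk l < rk j. (if rk i \<le> rk l then t $ l $ j else 0) * b $ i $ l)"
proof (cases "rk i \<le> rk j")
  case True
  have "(\<Sum>l\<in>UNIV. up b $ i $ l * t $ l $ j) = (\<Sum>l\<in>insert j {l. rk l < rk j}. up b $ i $ l * t $ l $ j)"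
  proof (intro sum.mono_neutral_right ballI)
    fix l assume "l \<in> UNIV - insert j {l. rk l < rk j}"
    then have "rk j < rk l" using rk_eq_iff[of l j] by (metis DiffD2 insertCI linorder_neqE_nat mem_Collect_eq)
    then show "up b $ i $ l * t $ l $ j = 0" using assms by (simp add: upper_def)
  qed auto
  also have "\<dots> = b $ i $ j * t $ j $ j + (\<Sum>l | rk l < rk j. up b $ i $ l * t $ l $ j)"
    using True by (subst sum.insert) (auto simp: up_def)
  also have "(\<Sum>l | rk l < rk j. up b $ i $ l * t $ l $ j) =
      (\<Sum>l | rk l < rk j. (if rk i \<le> rk l then t $ l $ j else 0) * b $ i $ l)"
    by (intro sum.cong) (auto simp: up_def)
  finally show ?thesis using True by (simp add: rmul_def matrix_matrix_mult_def)
next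
  case False
  then show ?thesis by (auto simp: rmul_def intro!: sum.neutral)
qed

lemma card_rk_le: "card {i::'a::finite. rk i \<le> rk (j::'a)} = Suc (rk j)"
proof -
  have "rk ` {i::'a. rk i \<le> rk j} = {..rk j}"
  proof (rule antisym)
    show "{..rk j} \<subseteq> rk ` {i::'a. rk i \<le> rk j}"
    proof
      fix a assume a: "a \<in> {..rk j}"
      then have "a \<in> {..<CARD('a)}" using rk_less[of j] by simp
      then obtain i :: 'a where "a = rk i" using bij_betw_rk by (metis bij_betw_def imageE)
      then show "a \<in> rk ` {i::'a. rk i \<le> rk j}" using a by blast
    qed
  qed blast
  then have "card (rk ` {i::'a. rk i \<le> rk j}) = Suc (rk j)" by simp
  then show ?thesis by (subst (asm) card_image) (auto simp: inj_on_def)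
qed

text \<open>Column j has \<open>Suc (rk j)\<close> entries on or above the diagonal, each scaled by
  t_jj. These powers are what the density \<open>haar_weight\<close> has to compensate.\<close>

lemma nn_integral_rmul:
  fixes t :: "real^'m^'m"
  assumes t: "upper t" "\<And>j. t $ j $ j \<noteq> 0" and f: "f \<in> borel_measurable borel"
  shows "(\<integral>\<^sup>+b. f b \<partial>lborel) = ennreal (\<Prod>j\<in>UNIV. \<bar>t $ j $ j\<bar> ^ Suc (rk j)) * (\<integral>\<^sup>+b. f (rmul t b) \<partial>lborel)"
proof -
  have "(\<integral>\<^sup>+b. f b \<partial>lborel) = ennreal (\<Prod>i\<in>UNIV. \<Prod>j\<in>UNIV. \<bar>if rk (i::'m) \<le> rk j then t $ j $ j else 1\<bar>) *
      (\<integral>\<^sup>+b. f (rmul t b) \<partial>lborel)"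
    by (rule nn_integral_matrix_triangular[where L="rmul t" and
          c="\<lambda>i j l. if rk i \<le> rk l then t $ l $ j else 0"])
      (use t f rmul_nth[OF t(1)] in auto)
  also have "(\<Prod>i\<in>UNIV. \<Prod>j\<in>UNIV. \<bar>if rk (i::'m) \<le> rk j then t $ j $ j else 1\<bar>) =
      (\<Prod>j\<in>UNIV. \<Prod>i\<in>UNIV. \<bar>if rk (i::'m) \<le> rk j then t $ j $ j else 1\<bar>)"
    by (rule prod.swap)
  also have "\<dots> = (\<Prod>j\<in>UNIV. \<Prod>i\<in>{i::'m. rk i \<le> rk j}. \<bar>t $ j $ j\<bar>)"
    by (intro prod.cong refl prod.mono_neutral_cong_right) auto
  finally show ?thesis by (simp add: card_rk_le)
qed

section \<open>The invariant measure on the Stiefel manifold\<close>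

lemma borel_measurable_gram [measurable]: "gram \<in> borel_measurable borel"
  by (intro borel_measurable_continuous_onI continuous_intros)

lemma borel_measurable_matrix_mult [measurable (raw)]:
  fixes f :: "'a \<Rightarrow> real^'k^'n" and g :: "'a \<Rightarrow> real^'m^'k"
  assumes "f \<in> borel_measurable M" "g \<in> borel_measurable M"
  shows "(\<lambda>x. f x ** g x) \<in> borel_measurable M"
  using borel_measurable_continuous_Pair[OF assms, of "\<lambda>a b. a ** b"]
  by (simp add: continuous_on_matrix_mult continuous_on_fst continuous_on_snd)

lemma borel_measurable_transpose [measurable]:
  "(transpose :: real^'m^'n \<Rightarrow> real^'n^'m) \<in> borel_measurable borel"
  by (intro borel_measurable_continuous_onI continuous_intros)

lemma borel_measurable_gs_vec:
  fixes a :: "'a \<Rightarrow> nat \<Rightarrow> 'b::euclidean_space"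
  assumes [measurable]: "\<And>j. (\<lambda>x. a x j) \<in> borel_measurable M"
  shows "(\<lambda>x. gs_vec (a x) j) \<in> borel_measurable M"
proof (induction j rule: less_induct)
  case (less j)
  then have [measurable]: "(\<lambda>x. gs_vec (a x) i) \<in> borel_measurable M" if "i \<in> {..<j}" for i
    using that by simp
  show ?case by (subst gs_vec.simps) measurable
qed

lemma borel_measurable_orth [measurable]: "(orth :: real^'m^'n \<Rightarrow> real^'m^'n) \<in> borel_measurable borel"
proof (subst borel_measurable_euclidean_space, intro ballI)
  fix b :: "real^'m^'n" assume "b \<in> Basis"
  then obtain i j where b: "b = axis i (axis j 1)" by (auto simp: Basis_matrix)
  have C: "(\<lambda>x. cols x k) \<in> borel_measurable borel" for k
    unfolding cols_def column_def by (intro borel_measurable_continuous_onI continuous_intros)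
  have "(\<lambda>x::real^'m^'n. gs_vec (cols x) (rk j) \<bullet> axis i 1) \<in> borel_measurable borel"
    using borel_measurable_gs_vec[OF C] by measurable
  then show "(\<lambda>x::real^'m^'n. orth x \<bullet> b) \<in> borel_measurable borel"
    by (simp add: b inner_axis_axis orth_def inner_axis)
qed

section \<open>A compact set of matrices of full column rank\<close>

text \<open>The norm bound leaves room for the matrices \<open>2 v\<close>, \<open>v\<close> orthonormal, in the interior, so that the
  slab has positive measure.\<close>

definition slab :: "(real^'m^'n) set" where
  "slab = {x. norm x \<le> 3 * real CARD('m) \<and> 1 \<le> gram x}"

lemma compact_slab: "compact (slab :: (real^'m^'n) set)"
proof -
  have "closed {x :: real^'m^'n. 1 \<le> gram x}"
    by (intro closed_Collect_le continuous_intros)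
  then have "compact (cball 0 (3 * real CARD('m)) \<inter> {x :: real^'m^'n. 1 \<le> gram x})"
    by (intro compact_Int_closed) auto
  also have "cball 0 (3 * real CARD('m)) \<inter> {x :: real^'m^'n. 1 \<le> gram x} = slab"
    by (auto simp: slab_def)
  finally show ?thesis .
qed

lemma slab_borel [measurable]: "slab \<in> sets borel"
  by (intro borel_closed compact_imp_closed compact_slab)

lemma closed_stiefel: "closed (stiefel :: (real^'m^'n) set)"
  unfolding stiefel_def by (intro closed_Collect_eq continuous_intros)

lemma stiefel_borel [measurable]: "stiefel \<in> sets borel"
  by (intro borel_closed closed_stiefel)

lemma norm_stiefel:
  assumes "v \<in> stiefel" shows "(norm (v :: real^'m^'n))\<^sup>2 = real CARD('m)"
proof -
  have "v \<bullet> v = (\<Sum>j\<in>UNIV. (transpose v ** v) $ j $ j)"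
    by (simp add: inner_vec_def transpose_mult_nth column_def) (rule sum.swap)
  then show ?thesis using assms by (simp add: stiefel_def mat_def power2_norm_eq_inner)
qed

lemma compact_stiefel: "compact (stiefel :: (real^'m^'n) set)"
proof -
  have "norm v \<le> sqrt (real CARD('m))" if "v \<in> stiefel" for v :: "real^'m^'n"
    using norm_stiefel[OF that] by (metis norm_ge_zero real_sqrt_unique order_refl)
  then show ?thesis
    by (auto simp: compact_eq_bounded_closed closed_stiefel bounded_iff)
qed

lemma gram_stiefel: "v \<in> stiefel \<Longrightarrow> gram v = 1"
  by (simp add: gram_def stiefel_def)

lemma slab_gram_nz: "x \<in> slab \<Longrightarrow> gram x \<noteq> 0"
  by (auto simp: slab_def)

lemma slab_isometry_mult: "u \<in> stiefel \<Longrightarrow> u ** x \<in> slab \<longleftrightarrow> x \<in> slab"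
  by (simp add: slab_def gram_isometry_mult norm_stiefel_mult)

lemma double_stiefel_interior_slab:
  assumes "v \<in> stiefel"
  shows "norm (2 *\<^sub>R v) < 3 * real CARD('m)" "1 < gram (2 *\<^sub>R v :: real^'m^'n)"
proof -
  have c: "1 \<le> real CARD('m)" by (simp add: Suc_le_eq)
  have "(norm v)\<^sup>2 \<le> (real CARD('m))\<^sup>2"
    unfolding norm_stiefel[OF assms] using c by (simp add: power2_eq_square)
  then have "norm v \<le> real CARD('m)" by (rule power2_le_imp_le) simp
  then show "norm (2 *\<^sub>R v) < 3 * real CARD('m)" using c
    by (simp add: le_less_trans[of _ "2 * real CARD('m)"])
  have "2 *\<^sub>R v = v ** (2 *\<^sub>R mat 1)"
    by (simp add: bounded_bilinear.scaleR_right[OF bilinear_matrix_mult])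
  then have "gram (2 *\<^sub>R v) = (det (2 *\<^sub>R mat 1 :: real^'m^'m))\<^sup>2"
    using assms by (simp add: gram_mult gram_stiefel)
  also have "det (2 *\<^sub>R mat 1 :: real^'m^'m) = 2 ^ CARD('m)"
    by (subst det_diagonal) (auto simp: mat_def)
  also have "(2 ^ CARD('m) :: real)\<^sup>2 > 1" by (simp add: one_less_power)
  finally show "1 < gram (2 *\<^sub>R v)" .
qed

lemma emeasure_slab:
  assumes "CARD('m) \<le> CARD('n)"
  shows "emeasure lborel (slab :: (real^'m^'n) set) \<noteq> 0" "emeasure lborel (slab :: (real^'m^'n) set) < \<infinity>"
proof -
  obtain \<iota> :: "'m \<Rightarrow> 'n" where "inj \<iota>" using exists_inj_index[OF assms] by blast
  then have f: "frame \<iota> \<in> stiefel" by (rule frame_stiefel)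
  let ?U = "{x :: real^'m^'n. norm x < 3 * real CARD('m)} \<inter> {x. 1 < gram x}"
  have "open ?U" by (intro open_Int open_Collect_less continuous_intros)
  moreover have "2 *\<^sub>R frame \<iota> \<in> ?U" using double_stiefel_interior_slab[OF f] by simp
  ultimately obtain e where e: "e > 0" "ball (2 *\<^sub>R frame \<iota>) e \<subseteq> ?U" by (meson openE)
  have "emeasure lborel (ball (2 *\<^sub>R frame \<iota> :: real^'m^'n) e) \<le> emeasure lborel (slab :: (real^'m^'n) set)"
    using e by (intro emeasure_mono) (auto simp: slab_def)
  moreover have "emeasure lborel (ball (2 *\<^sub>R frame \<iota> :: real^'m^'n) e) > 0"
    using e(1) unit_ball_vol_pos by (simp add: emeasure_ball)
  ultimately show "emeasure lborel (slab :: (real^'m^'n) set) \<noteq> 0" by auto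
  show "emeasure lborel (slab :: (real^'m^'n) set) < \<infinity>"
    by (intro emeasure_bounded_finite compact_imp_bounded compact_slab)
qed

lemma measurable_orthogonal_mult:
  assumes "sets M = sets (restrict_space borel stiefel)" "orthogonal_matrix q"
  shows "(\<lambda>v. q ** v) \<in> measurable M M"
  unfolding measurable_cong_sets[OF assms(1) assms(1)]
  by (rule measurable_restrict_space3) (use assms(2) in \<open>auto intro: orthogonal_mult_stiefel\<close>)

lemma stiefel_measureD:
  assumes "stiefel_measure M"
  shows "prob_space M" "space M = stiefel" "sets M = sets (restrict_space borel stiefel)"
    "orthogonal_matrix q \<Longrightarrow> distr M M (\<lambda>v. q ** v) = M"
  using assms by (auto simp: stiefel_measure_def)

lemma stiefel_measure_borel:
  assumes "stiefel_measure M" "f \<in> borel_measurable borel"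
  shows "f \<in> borel_measurable M"
  using measurable_restrict_space1[OF assms(2)] by (simp cong: measurable_cong_sets add: stiefel_measureD(3)[OF assms(1)])

lemma stiefel_measure_invariant:
  assumes M: "stiefel_measure M" and "orthogonal_matrix q" "f \<in> borel_measurable M"
  shows "(\<integral>\<^sup>+v. f (q ** v) \<partial>M) = (\<integral>\<^sup>+v. f v \<partial>M)"
proof -
  have "(\<integral>\<^sup>+v. f v \<partial>M) = (\<integral>\<^sup>+v. f v \<partial>distr M M (\<lambda>v. q ** v))"
    unfolding stiefel_measureD(4)[OF M assms(2)] ..
  also have "\<dots> = (\<integral>\<^sup>+v. f (q ** v) \<partial>M)"
    by (intro nn_integral_distr measurable_orthogonal_mult assms stiefel_measureD[OF M])
      (use assms(3) in simp)
  finally show ?thesis ..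
qed

text \<open>For square matrices the Stiefel manifold is O(n), and this supplies the measure over
  which the next lemmas average. It is the image of the uniform distribution on the slab under
  Gram--Schmidt; it is invariant because the slab and Lebesgue measure are invariant and
  Gram--Schmidt is equivariant.\<close>

lemma stiefel_measure_exists: "\<exists>M :: (real^'n^'n) measure. stiefel_measure M"
proof -
  let ?S = "slab :: (real^'n^'n) set"
  let ?R = "restrict_space borel stiefel :: (real^'n^'n) measure"
  let ?U = "uniform_measure lborel ?S"
  \<comment> \<open>The value \<open>mat 1\<close> off full rank only keeps p inside the manifold
    everywhere; no matrix of the slab is affected.\<close>
  define p where "p = (\<lambda>x::real^'n^'n. if gram x = 0 then mat 1 else orth x)"
  have pS: "p x \<in> stiefel" for x
  proof -
    have "(mat 1 :: real^'n^'n) \<in> stiefel" by (simp add: stiefel_def)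
    then show ?thesis by (simp add: p_def orth_stiefel)
  qed
  have pm: "p \<in> measurable ?U ?R"
  proof (rule measurable_restrict_space2)
    show "p \<in> borel_measurable ?U" by (simp add: p_def[abs_def])
  qed (simp add: pS)
  define M where "M = distr ?U ?R p"
  have U: "prob_space ?U" using emeasure_slab[where 'm='n and 'n='n] by (intro prob_space_uniform_measure) auto
  have "stiefel_measure M"
    unfolding stiefel_measure_def
  proof (intro conjI allI impI)
    show "prob_space M" unfolding M_def by (rule prob_space.prob_space_distr[OF U pm])
    show "space M = stiefel" by (simp add: M_def)
    show s: "sets M = sets ?R" by (simp add: M_def)
    fix q :: "real^'n^'n" assume q: "orthogonal_matrix q"
    then have qs: "q \<in> stiefel" by (simp add: stiefel_def orthogonal_matrix)
    have qm: "(\<lambda>v. q ** v) \<in> measurable M M" by (rule measurable_orthogonal_mult[OF s q])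
    show "distr M M (\<lambda>v. q ** v) = M"
    proof (rule measure_eqI)
      fix A assume "A \<in> sets (distr M M (\<lambda>v. q ** v))"
      then have A: "A \<in> sets M" by simp
      then have A': "A \<in> sets ?R" using s by simp
      have Ab [measurable]: "A \<in> sets borel" using A' by (simp add: sets_restrict_space_iff)
      have nn: "emeasure M B = (\<integral>\<^sup>+x. indicator B (p x) * indicator ?S x \<partial>lborel) / emeasure lborel ?S" if "B \<in> sets ?R" for B
      proof -
        have [measurable]: "B \<in> sets borel" using that by (simp add: sets_restrict_space_iff)
        have "emeasure M B = (\<integral>\<^sup>+x. indicator B x \<partial>M)" using that s by simp
        also have "\<dots> = (\<integral>\<^sup>+x. indicator B (p x) \<partial>?U)"
          unfolding M_def using that by (intro nn_integral_distr pm) auto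
        also have "\<dots> = (\<integral>\<^sup>+x. indicator B (p x) * indicator ?S x \<partial>lborel) / emeasure lborel ?S"
          by (intro nn_integral_uniform_measure) (simp_all add: p_def[abs_def])
        finally show ?thesis .
      qed
      define B where "B = (\<lambda>v. q ** v) -` A \<inter> space M"
      have B: "B \<in> sets M" unfolding B_def by (rule measurable_sets[OF qm A])
      have "emeasure (distr M M (\<lambda>v. q ** v)) A = emeasure M B"
        unfolding B_def by (rule emeasure_distr[OF qm A])
      also have "\<dots> = (\<integral>\<^sup>+x. indicator B (p x) * indicator ?S x \<partial>lborel) / emeasure lborel ?S"
        using B s by (intro nn) simp
      also have "(\<integral>\<^sup>+x. indicator B (p x) * indicator ?S x \<partial>lborel) =
          (\<integral>\<^sup>+x. indicator A (p (q ** x)) * indicator ?S (q ** x) \<partial>lborel)"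
      proof (rule nn_integral_cong)
        fix x :: "real^'n^'n"
        show "indicator B (p x) * indicator ?S x = (indicator A (p (q ** x)) * indicator ?S (q ** x) :: ennreal)"
          using slab_gram_nz[of x] slab_gram_nz[of "q ** x"] pS[of x]
          by (auto simp: B_def M_def slab_isometry_mult[OF qs] p_def orth_orthogonal_mult[OF q] split: split_indicator)
      qed
      also have "\<dots> = (\<integral>\<^sup>+x. indicator A (p x) * indicator ?S x \<partial>lborel)"
        by (rule orthogonal_mult_nn_integral[OF q]) (simp add: p_def[abs_def])
      finally show "emeasure (distr M M (\<lambda>v. q ** v)) A = emeasure M A"
        using nn[OF A'] by simp
    qed simp
  qed
  then show ?thesis by blast
qed

text \<open>By transitivity and invariance of \<sigma> the left side does not depend on v;
  integrating it over v against \<mu> and exchanging the integrals gives the right side. The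
  transpose turns left translation of q by p' into multiplication of v by p. In particular \<mu> is
  determined by its invariance.\<close>

lemma stiefel_measure_average:
  fixes \<mu> :: "(real^'m^'n) measure" and \<sigma> :: "(real^'n^'n) measure"
  assumes \<mu>: "stiefel_measure \<mu>" and \<sigma>: "stiefel_measure \<sigma>" and mn: "CARD('m) \<le> CARD('n)"
    and v: "v \<in> stiefel" and f: "f \<in> borel_measurable borel"
  shows "(\<integral>\<^sup>+q. f (transpose q ** v) \<partial>\<sigma>) = (\<integral>\<^sup>+v. f v \<partial>\<mu>)"
proof -
  note [measurable] = f
  interpret \<mu>: prob_space \<mu> by (rule stiefel_measureD[OF \<mu>])
  interpret \<sigma>: prob_space \<sigma> by (rule stiefel_measureD[OF \<sigma>])
  interpret P: pair_sigma_finite \<sigma> \<mu> ..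
  define g where "g w = (\<integral>\<^sup>+q. f (transpose q ** w) \<partial>\<sigma>)" for w
  have g: "g w = g v" if w: "w \<in> stiefel" for w
  proof -
    obtain p :: "real^'n^'n" where p: "orthogonal_matrix p" "w = p ** v"
      using stiefel_transitive[OF v w mn] .
    have "g v = (\<integral>\<^sup>+q. f (transpose (transpose p ** q) ** v) \<partial>\<sigma>)"
      unfolding g_def using p
      by (intro stiefel_measure_invariant[OF \<sigma>, symmetric, of "transpose p" "\<lambda>q. f (transpose q ** v)"] stiefel_measure_borel[OF \<sigma>])
        (auto simp: orthogonal_matrix_transpose)
    also have "\<dots> = g w" by (simp add: g_def p(2) matrix_transpose_mul matrix_mul_assoc)
    finally show ?thesis by simp
  qed
  have id\<sigma> [measurable]: "(\<lambda>q. q) \<in> borel_measurable \<sigma>" and id\<mu> [measurable]: "(\<lambda>v. v) \<in> borel_measurable \<mu>"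
    by (rule stiefel_measure_borel[OF \<sigma>] stiefel_measure_borel[OF \<mu>], simp)+
  have "(\<integral>\<^sup>+v. f v \<partial>\<mu>) = (\<integral>\<^sup>+q. (\<integral>\<^sup>+v. f v \<partial>\<mu>) \<partial>\<sigma>)"
    by (simp add: \<sigma>.emeasure_space_1)
  also have "\<dots> = (\<integral>\<^sup>+q. (\<integral>\<^sup>+w. f (transpose q ** w) \<partial>\<mu>) \<partial>\<sigma>)"
  proof (rule nn_integral_cong)
    fix q assume "q \<in> space \<sigma>"
    then have "orthogonal_matrix (transpose q)"
      by (simp add: stiefel_measureD[OF \<sigma>] stiefel_def orthogonal_matrix_transpose flip: orthogonal_matrix)
    then show "(\<integral>\<^sup>+v. f v \<partial>\<mu>) = (\<integral>\<^sup>+w. f (transpose q ** w) \<partial>\<mu>)"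
      using stiefel_measure_invariant[OF \<mu> _ stiefel_measure_borel[OF \<mu> f]] by simp
  qed
  also have "\<dots> = (\<integral>\<^sup>+w. g w \<partial>\<mu>)"
    unfolding g_def by (rule P.Fubini'[symmetric]) measurable
  also have "\<dots> = (\<integral>\<^sup>+w. g v \<partial>\<mu>)"
    by (rule nn_integral_cong) (simp add: g stiefel_measureD[OF \<mu>])
  also have "\<dots> = g v" by (simp add: \<mu>.emeasure_space_1)
  finally show ?thesis by (simp add: g_def)
qed

text \<open>Replacing x by q' x changes neither Lebesgue measure nor w and turns
  \<open>orth x\<close> into q' \<open>orth x\<close>. Averaging over q then replaces f by its mean.
  Where \<open>gram x = 0\<close> the factor \<open>orth x\<close> is no frame, and w has to
  vanish.\<close>

lemma stiefel_measure_lift_nn: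
  fixes \<mu> :: "(real^'m^'n) measure" and w f :: "real^'m^'n \<Rightarrow> ennreal"
  assumes \<mu>: "stiefel_measure \<mu>" and mn: "CARD('m) \<le> CARD('n)"
    and w [measurable]: "w \<in> borel_measurable borel"
    and inv: "\<And>q x. orthogonal_matrix q \<Longrightarrow> w (q ** x) = w x" and w0: "\<And>x. gram x = 0 \<Longrightarrow> w x = 0"
    and f [measurable]: "f \<in> borel_measurable borel"
  shows "(\<integral>\<^sup>+x. w x * f (orth x) \<partial>lborel) = (\<integral>\<^sup>+x. w x \<partial>lborel) * (\<integral>\<^sup>+v. f v \<partial>\<mu>)"
proof -
  obtain \<sigma> :: "(real^'n^'n) measure" where \<sigma>: "stiefel_measure \<sigma>" using stiefel_measure_exists by blast
  interpret \<sigma>: prob_space \<sigma> by (rule stiefel_measureD[OF \<sigma>])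
  interpret P: pair_sigma_finite \<sigma> "lborel :: (real^'m^'n) measure" ..
  have [measurable]: "(\<lambda>q. q) \<in> borel_measurable \<sigma>"
    by (rule stiefel_measure_borel[OF \<sigma>]) simp
  have "(\<integral>\<^sup>+x. w x * f (orth x) \<partial>lborel) = (\<integral>\<^sup>+q. (\<integral>\<^sup>+x. w x * f (orth x) \<partial>lborel) \<partial>\<sigma>)"
    by (simp add: \<sigma>.emeasure_space_1)
  also have "\<dots> = (\<integral>\<^sup>+q. (\<integral>\<^sup>+x. w x * f (transpose q ** orth x) \<partial>lborel) \<partial>\<sigma>)"
  proof (rule nn_integral_cong)
    fix q assume "q \<in> space \<sigma>"
    then have q: "orthogonal_matrix (transpose q)"
      by (simp add: stiefel_measureD[OF \<sigma>] stiefel_def orthogonal_matrix_transpose flip: orthogonal_matrix)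
    have "(\<integral>\<^sup>+x. w x * f (orth x) \<partial>lborel) = (\<integral>\<^sup>+x. w (transpose q ** x) * f (orth (transpose q ** x)) \<partial>lborel)"
      by (rule orthogonal_mult_nn_integral[OF q, symmetric]) measurable
    then show "(\<integral>\<^sup>+x. w x * f (orth x) \<partial>lborel) = (\<integral>\<^sup>+x. w x * f (transpose q ** orth x) \<partial>lborel)"
      by (simp add: inv[OF q] orth_orthogonal_mult[OF q])
  qed
  also have "\<dots> = (\<integral>\<^sup>+x. (\<integral>\<^sup>+q. w x * f (transpose q ** orth x) \<partial>\<sigma>) \<partial>lborel)"
    by (rule P.Fubini'[symmetric]) measurable
  also have "\<dots> = (\<integral>\<^sup>+x. w x * (\<integral>\<^sup>+v. f v \<partial>\<mu>) \<partial>lborel)"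
  proof (rule nn_integral_cong)
    fix x
    show "(\<integral>\<^sup>+q. w x * f (transpose q ** orth x) \<partial>\<sigma>) = w x * (\<integral>\<^sup>+v. f v \<partial>\<mu>)"
    proof (cases "gram x = 0")
      case False
      have "(\<integral>\<^sup>+q. w x * f (transpose q ** orth x) \<partial>\<sigma>) = w x * (\<integral>\<^sup>+q. f (transpose q ** orth x) \<partial>\<sigma>)"
        by (rule nn_integral_cmult) measurable
      then show ?thesis
        using stiefel_measure_average[OF \<mu> \<sigma> mn orth_stiefel[OF False] f] by simp
    qed (simp add: w0)
  qed
  also have "\<dots> = (\<integral>\<^sup>+x. w x \<partial>lborel) * (\<integral>\<^sup>+v. f v \<partial>\<mu>)"
    by (rule nn_integral_multc) measurable
  finally show ?thesis .
qed

text \<open>Under an invariant density, \<open>gram x\<close> and \<open>orth x\<close> are independent; this transfers the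
  nonnegative formula to complex weights that depend on \<open>gram x\<close>.\<close>

lemma stiefel_measure_lift:
  fixes \<mu> :: "(real^'m^'n) measure" and \<rho> :: "real^'m^'n \<Rightarrow> real" and f :: "real^'m^'n \<Rightarrow> complex"
    and h :: "real \<Rightarrow> complex"
  assumes \<mu>: "stiefel_measure \<mu>" and mn: "CARD('m) \<le> CARD('n)"
    and \<rho> [measurable]: "\<rho> \<in> borel_measurable borel" and \<rho>0: "\<And>x. \<rho> x \<ge> 0"
    and fin: "integrable lborel \<rho>"
    and inv: "\<And>q x. orthogonal_matrix q \<Longrightarrow> \<rho> (q ** x) = \<rho> x" and w0: "\<And>x. gram x = 0 \<Longrightarrow> \<rho> x = 0"
    and f [measurable]: "f \<in> borel_measurable borel" and h [measurable]: "h \<in> borel_measurable borel"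
    and intf: "integrable \<mu> f" and inth: "integrable lborel (\<lambda>x. \<rho> x *\<^sub>R h (gram x))"
  shows "integrable lborel (\<lambda>x. \<rho> x *\<^sub>R (h (gram x) * f (orth x)))"
    and "(\<integral>x. \<rho> x *\<^sub>R (h (gram x) * f (orth x)) \<partial>lborel) =
     (\<integral>x. \<rho> x *\<^sub>R h (gram x) \<partial>lborel) * (\<integral>v. f v \<partial>\<mu>)"
proof -
  interpret \<mu>: prob_space \<mu> by (rule stiefel_measureD[OF \<mu>])
  define D where "D = density lborel (\<lambda>x. ennreal (\<rho> x))"
  have [simp]: "space D = UNIV" "sets D = sets borel" by (simp_all add: D_def)
  have "emeasure D (space D) = (\<integral>\<^sup>+x. ennreal (\<rho> x) \<partial>lborel)"
    by (simp add: D_def emeasure_density)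
  also have "\<dots> < \<infinity>" using fin \<rho>0 by (simp add: integrable_iff_bounded)
  finally interpret D: finite_measure D by (intro finite_measureI) auto
  let ?G = "distr D borel gram"
  let ?M = "distr \<mu> borel (\<lambda>v. v)"
  have [measurable]: "gram \<in> borel_measurable D" "orth \<in> borel_measurable D" "(\<lambda>v. v) \<in> borel_measurable \<mu>"
    using stiefel_measure_borel[OF \<mu>, of "\<lambda>v. v"] by (simp_all add: D_def)
  interpret G: finite_measure ?G by (rule D.finite_measure_distr) simp
  interpret M: finite_measure ?M by (rule \<mu>.finite_measure_distr) measurable
  interpret GM: pair_sigma_finite ?G ?M ..
  \<comment> \<open>The joint law of \<open>gram\<close> and \<open>orth\<close> is a product. It
    suffices to check rectangles, where the nonnegative formula applies with the invariant weight
    \<rho> times an indicator of \<open>gram\<close>.\<close>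
  have eq: "?G \<Otimes>\<^sub>M ?M = distr D (borel \<Otimes>\<^sub>M borel) (\<lambda>x. (gram x, orth x))"
  proof (rule pair_measure_eqI)
    show "sigma_finite_measure ?G" "sigma_finite_measure ?M" by unfold_locales
    fix A B assume AB: "A \<in> sets ?G" "B \<in> sets ?M"
    then have [measurable]: "A \<in> sets borel" "B \<in> sets borel" by auto
    have "emeasure (distr D (borel \<Otimes>\<^sub>M borel) (\<lambda>x. (gram x, orth x))) (A \<times> B) =
        (\<integral>\<^sup>+z. indicator A (fst z) * indicator B (snd z) \<partial>distr D (borel \<Otimes>\<^sub>M borel) (\<lambda>x. (gram x, orth x)))"
    proof -
      have "emeasure (distr D (borel \<Otimes>\<^sub>M borel) (\<lambda>x. (gram x, orth x))) (A \<times> B) =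
          (\<integral>\<^sup>+z. indicator (A \<times> B) z \<partial>distr D (borel \<Otimes>\<^sub>M borel) (\<lambda>x. (gram x, orth x)))"
        by (rule nn_integral_indicator[symmetric]) simp
      then show ?thesis by (simp add: indicator_times)
    qed
    also have "\<dots> = (\<integral>\<^sup>+x. indicator A (gram x) * indicator B (orth x) \<partial>D)"
      by (subst nn_integral_distr) simp_all
    also have "\<dots> = (\<integral>\<^sup>+x. (ennreal (\<rho> x) * indicator A (gram x)) * indicator B (orth x) \<partial>lborel)"
      by (simp add: D_def nn_integral_density mult.assoc)
    also have "\<dots> = (\<integral>\<^sup>+x. ennreal (\<rho> x) * indicator A (gram x) \<partial>lborel) * (\<integral>\<^sup>+v. indicator B v \<partial>\<mu>)"
    proof (rule stiefel_measure_lift_nn[OF \<mu> mn])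
      fix q :: "real^'n^'n" and x :: "real^'m^'n" assume q: "orthogonal_matrix q"
      then have "q \<in> stiefel" by (simp add: stiefel_def orthogonal_matrix)
      then show "ennreal (\<rho> (q ** x)) * indicator A (gram (q ** x)) = ennreal (\<rho> x) * indicator A (gram x)"
        by (simp add: inv[OF q] gram_isometry_mult)
    qed (simp_all add: w0)
    also have "(\<integral>\<^sup>+x. ennreal (\<rho> x) * indicator A (gram x) \<partial>lborel) = (\<integral>\<^sup>+x. indicator A (gram x) \<partial>D)"
      by (simp add: D_def nn_integral_density)
    also have "\<dots> = (\<integral>\<^sup>+x. indicator A x \<partial>?G)"
      by (subst nn_integral_distr) simp_all
    also have "\<dots> = emeasure ?G A" by simp
    also have "(\<integral>\<^sup>+v. indicator B v \<partial>\<mu>) = (\<integral>\<^sup>+v. indicator B v \<partial>?M)"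
      by (subst nn_integral_distr) simp_all
    also have "\<dots> = emeasure ?M B" by simp
    finally show "emeasure ?G A * emeasure ?M B =
        emeasure (distr D (borel \<Otimes>\<^sub>M borel) (\<lambda>x. (gram x, orth x))) (A \<times> B)" ..
  qed (simp cong: sets_pair_measure_cong)
  have G: "integrable ?G h"
    using inth by (simp add: integrable_distr_eq D_def integrable_density \<rho>0)
  have M: "integrable ?M f"
    using intf by (simp add: integrable_distr_eq)
  have GM: "integrable (?G \<Otimes>\<^sub>M ?M) (\<lambda>z. h (fst z) * f (snd z))"
  proof (rule GM.Fubini_integrable)
    show "integrable ?G (\<lambda>x. \<integral>y. norm (h (fst (x, y)) * f (snd (x, y))) \<partial>?M)"
      using G by (simp add: norm_mult)
  qed (use M in auto)
  then have "integrable (distr D (borel \<Otimes>\<^sub>M borel) (\<lambda>x. (gram x, orth x))) (\<lambda>z. h (fst z) * f (snd z))"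
    by (simp add: eq)
  then have "integrable D (\<lambda>x. h (gram x) * f (orth x))"
    by (subst (asm) integrable_distr_eq) simp_all
  then show "integrable lborel (\<lambda>x. \<rho> x *\<^sub>R (h (gram x) * f (orth x)))"
    by (simp add: D_def integrable_density \<rho>0)
  have "(\<integral>x. \<rho> x *\<^sub>R (h (gram x) * f (orth x)) \<partial>lborel) = (\<integral>x. h (gram x) * f (orth x) \<partial>D)"
    unfolding D_def by (rule integral_density[symmetric]) (simp_all add: \<rho>0)
  also have "\<dots> = (\<integral>z. h (fst z) * f (snd z) \<partial>distr D (borel \<Otimes>\<^sub>M borel) (\<lambda>x. (gram x, orth x)))"
    by (subst integral_distr) simp_all
  also have "\<dots> = (\<integral>z. h (fst z) * f (snd z) \<partial>(?G \<Otimes>\<^sub>M ?M))" by (simp add: eq)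
  also have "\<dots> = (\<integral>t. h t \<partial>?G) * (\<integral>v. f v \<partial>?M)"
    using GM.integral_fst'[OF GM] by simp
  also have "(\<integral>v. f v \<partial>?M) = (\<integral>v. f v \<partial>\<mu>)" by (subst integral_distr) simp_all
  also have "(\<integral>t. h t \<partial>?G) = (\<integral>x. h (gram x) \<partial>D)" by (subst integral_distr) simp_all
  also have "\<dots> = (\<integral>x. \<rho> x *\<^sub>R h (gram x) \<partial>lborel)"
    unfolding D_def by (rule integral_density) (simp_all add: \<rho>0)
  finally show "(\<integral>x. \<rho> x *\<^sub>R (h (gram x) * f (orth x)) \<partial>lborel) =
     (\<integral>x. \<rho> x *\<^sub>R h (gram x) \<partial>lborel) * (\<integral>v. f v \<partial>\<mu>)" .
qed

section \<open>Averaging over the upper triangular group\<close>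

text \<open>Cramer's formula, because the measurability of \<open>matrix_inv\<close> is not immediate.\<close>

definition cinv :: "real^'m^'m \<Rightarrow> real^'m^'m" where
  "cinv A = (\<chi> i j. det (\<chi> k l. if l = i then (if k = j then 1 else 0) else A $ k $ l) / det A)"

lemma mult_cinv:
  fixes A :: "real^'m^'m"
  assumes "det A \<noteq> 0" shows "A ** cinv A = mat 1"
proof -
  have "A *v column j (cinv A) = axis j 1" for j
  proof -
    have "axis j (1::real) $ i = (if i = j then 1 else 0)" for i
      by (simp add: axis_def)
    then have "column j (cinv A) = (\<chi> k. det (\<chi> i l. if l = k then axis j 1 $ i else A $ i $ l) / det A)"
      by (simp add: column_def cinv_def cong: if_cong)
    then show ?thesis using cramer[OF assms, of "column j (cinv A)" "axis j 1"] by simp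
  qed
  then have "column j (A ** cinv A) = column j (mat 1)" for j
    by (simp add: column_matrix_mult) (simp add: column_def mat_def axis_def vec_eq_iff)
  then show ?thesis by (simp add: column_def vec_eq_iff)
qed

lemma cinv_mult: "det A \<noteq> 0 \<Longrightarrow> cinv A ** A = mat 1"
  using mult_cinv matrix_left_right_inverse by blast

lemma continuous_on_cinv [continuous_intros]:
  fixes f :: "'a::topological_space \<Rightarrow> real^'m^'m"
  assumes "continuous_on S f" "\<And>x. x \<in> S \<Longrightarrow> det (f x) \<noteq> 0"
  shows "continuous_on S (\<lambda>x. cinv (f x))"
proof -
  have "continuous_on S (\<lambda>x. if P then c else f x $ k $ l)" for P c k l
    by (cases P) (auto intro!: continuous_intros assms)
  then show ?thesis unfolding cinv_def by (intro continuous_intros assms ballI)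
qed

lemma borel_measurable_det [measurable]: "(det :: real^'m^'m \<Rightarrow> real) \<in> borel_measurable borel"
  by (intro borel_measurable_continuous_onI continuous_intros)

lemma borel_measurable_up [measurable]: "up \<in> borel_measurable borel"
  by (intro borel_measurable_continuous_onI continuous_intros)

lemma borel_measurable_nth_nth [measurable]: "(\<lambda>b::real^'m^'n. b $ i $ j) \<in> borel_measurable borel"
  by (intro borel_measurable_continuous_onI continuous_intros)

lemma borel_measurable_cinv [measurable]: "(cinv :: real^'m^'m \<Rightarrow> real^'m^'m) \<in> borel_measurable borel"
proof (subst borel_measurable_euclidean_space, intro ballI)
  fix b :: "real^'m^'m" assume "b \<in> Basis"
  then obtain i j where b: "b = axis i (axis j 1)" by (auto simp: Basis_matrix)
  have c: "continuous_on UNIV (\<lambda>A::real^'m^'m. if P then c else A $ k $ l)" for P c k l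
    by (cases P) (auto intro!: continuous_intros)
  have "(\<lambda>A::real^'m^'m. det (\<chi> k l. if l = i then (if k = j then 1 else 0) else A $ k $ l)) \<in> borel_measurable borel"
    by (intro borel_measurable_continuous_onI continuous_intros c)
  then show "(\<lambda>A. cinv A \<bullet> b) \<in> borel_measurable borel"
    by (simp add: b inner_axis_axis cinv_def)
qed

lemma borel_measurable_stretch [measurable (raw)]:
  fixes u :: "'a \<Rightarrow> real^'k^'n" and b :: "'a \<Rightarrow> real^'m^'m" and x :: "'a \<Rightarrow> real^'m^'n"
  assumes [measurable]: "u \<in> borel_measurable M" "b \<in> borel_measurable M" "x \<in> borel_measurable M"
  shows "(\<lambda>z. stretch (u z) (b z) (x z)) \<in> borel_measurable M"
  unfolding stretch_def by measurable

section \<open>Haar measure of the triangular group and the mass of the slab\<close>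

definition lowbox :: "(real^'m^'m) set" where
  "lowbox = {b. \<forall>i j. rk j < rk i \<longrightarrow> \<bar>b $ i $ j\<bar> \<le> 1}"

lemma lowbox_borel [measurable]: "lowbox \<in> sets borel"
proof -
  have "lowbox = (\<Inter>i. \<Inter>j\<in>{j. rk j < rk i}. {b::real^'a^'a. \<bar>b $ i $ j\<bar> \<le> 1})"
    by (auto simp: lowbox_def)
  moreover have "closed (\<Inter>i. \<Inter>j\<in>{j. rk j < rk i}. {b::real^'a^'a. \<bar>b $ i $ j\<bar> \<le> 1})"
    by (intro closed_INT ballI closed_Collect_le continuous_intros)
  ultimately show ?thesis by (metis borel_closed)
qed

text \<open>The density \<open>\<Prod>\<^sub>j |b\<^sub>j\<^sub>j|\<^sup>-\<^sup>j\<close> of the right Haar measure of the upper triangular group, indices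
  starting at 1; the entries below the diagonal are dummies confined to \<open>[-1, 1]\<close>, so that
  Lebesgue measure on square matrices can be used.\<close>

definition haar_weight :: "real^'m^'m \<Rightarrow> real" where
  "haar_weight b = (\<Prod>j\<in>UNIV. \<bar>b $ j $ j\<bar> powr (- real (Suc (rk j)))) * indicator lowbox b"

lemma haar_weight_nonneg: "haar_weight b \<ge> 0"
  by (simp add: haar_weight_def prod_nonneg)

lemma borel_measurable_haar_weight [measurable]: "haar_weight \<in> borel_measurable borel"
  unfolding haar_weight_def by measurable

lemma haar_weight_nz: "haar_weight b \<noteq> 0 \<Longrightarrow> b $ j $ j \<noteq> 0"
  by (auto simp: haar_weight_def)

lemma rmul_diag: "upper t \<Longrightarrow> rmul t b $ j $ j = b $ j $ j * t $ j $ j"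
  by (subst rmul_nth) (auto intro!: sum.neutral)

lemma rmul_lowbox: "rmul t b \<in> lowbox \<longleftrightarrow> b \<in> lowbox"
  by (auto simp: lowbox_def rmul_def)

text \<open>The Haar measure of the b for which y b^(-1) lies in the slab, twisted by |det b|^(-k).
  The twist cancels the Jacobian of \<open>stretch\<close> and fixes the exponent of
  \<open>gram y\<close>. Where \<open>up b\<close> is singular, \<open>haar_weight\<close> is 0,
  whatever \<open>cinv\<close> returns.\<close>

definition slab_mass :: "real^'m^'k \<Rightarrow> ennreal" where
  "slab_mass y = (\<integral>\<^sup>+b. ennreal (haar_weight b * (\<bar>det (up b)\<bar> powr (- real CARD('k)))) *
     indicator slab (y ** cinv (up b)) \<partial>lborel)"

text \<open>What \<open>slab_mass y\<close> becomes once an isometry y is dropped, the slab being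
  unable to see it. The slab is then one of square matrices, and 'k survives only in the exponent;
  hence the \<open>itself\<close> arguments.\<close>

definition slab_const :: "'m::finite itself \<Rightarrow> 'k::finite itself \<Rightarrow> ennreal" where
  "slab_const _ _ = (\<integral>\<^sup>+b. ennreal (haar_weight b * (\<bar>det (up b)\<bar> powr (- real CARD('k)))) *
     indicator slab (cinv (up (b :: real^'m^'m))) \<partial>lborel)"

text \<open>Right invariance of the Haar measure removes the factor \<open>tri y\<close> of \<open>y = orth y ** tri y\<close>, and \<open>slab\<close> does
  not see the isometry \<open>orth y\<close>.\<close>

lemma slab_mass_eq:
  "slab_mass (y :: real^'m^'k) = slab_const TYPE('m) TYPE('k) * ennreal (gram y powr (- real CARD('k) / 2))"
proof (cases "gram y = 0")
  case True
  have "gram (y ** a) = 0" for a :: "real^'m^'m" using True by (simp add: gram_mult)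
  then have "y ** a \<notin> slab" for a :: "real^'m^'m" using slab_gram_nz by blast
  then have "slab_mass y = 0" unfolding slab_mass_def by simp
  then show ?thesis using True by simp
next
  case False
  let ?k = "real CARD('k)"
  let ?t = "tri y"
  have t: "upper ?t" "\<And>j. ?t $ j $ j > 0" using upper_tri tri_pos[OF False] by auto
  let ?P = "\<lambda>b. det (up b)"
  let ?T = "\<Prod>j\<in>UNIV. ?t $ j $ j"
  let ?F = "\<lambda>b. ennreal (haar_weight b * (\<bar>?P b\<bar> powr (- ?k))) * indicator slab (y ** cinv (up b))"
  let ?G = "\<lambda>b :: real^'m^'m. ennreal (haar_weight b * (\<bar>?P b\<bar> powr (- ?k))) * indicator slab (cinv (up b))"
  define c where "c = (\<Prod>j\<in>UNIV. ?t $ j $ j powr (- real (Suc (rk j)))) * ?T powr (- ?k)"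
  have c0: "c \<ge> 0" by (simp add: c_def prod_nonneg)
  have Pt: "?T > 0" using t by (simp add: prod_pos)
  have "slab_mass y = (\<integral>\<^sup>+b. ?F b \<partial>lborel)" by (simp add: slab_mass_def)
  also have "\<dots> = ennreal (\<Prod>j\<in>UNIV. \<bar>?t $ j $ j\<bar> ^ Suc (rk j)) * (\<integral>\<^sup>+b. ?F (rmul ?t b) \<partial>lborel)"
  proof (rule nn_integral_rmul)
    show "?t $ j $ j \<noteq> 0" for j using t(2)[of j] by simp
  qed (use t in measurable)
  also have "(\<integral>\<^sup>+b. ?F (rmul ?t b) \<partial>lborel) = (\<integral>\<^sup>+b. ennreal c * ?G b \<partial>lborel)"
  proof (rule nn_integral_cong)
    fix b :: "real^'m^'m"
    have hw: "haar_weight (rmul ?t b) = haar_weight b * (\<Prod>j\<in>UNIV. ?t $ j $ j powr (- real (Suc (rk j))))"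
      using t by (simp add: haar_weight_def rmul_diag rmul_lowbox abs_mult powr_mult prod.distrib abs_of_pos indicator_def)
    show "?F (rmul ?t b) = ennreal c * ?G b"
    proof (cases "haar_weight b = 0")
      case False
      then have "b $ j $ j \<noteq> 0" for j by (rule haar_weight_nz)
      then have db: "det (up b) \<noteq> 0" by (simp add: det_up)
      have dt: "det ?t \<noteq> 0" using Pt det_upper[OF t(1)] by linarith
      have "y ** cinv (up (rmul ?t b)) = orth y ** (?t ** cinv (up b ** ?t))"
        using t by (simp add: up_rmul matrix_mul_assoc orth_tri)
      also have "?t ** cinv (up b ** ?t) = cinv (up b) ** (up b ** (?t ** cinv (up b ** ?t)))"
        by (simp add: matrix_mul_assoc cinv_mult[OF db])
      also have "\<dots> = cinv (up b)"
        using mult_cinv[of "up b ** ?t"] db dt by (simp add: matrix_mul_assoc det_mul)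
      finally have "y ** cinv (up (rmul ?t b)) \<in> slab \<longleftrightarrow> cinv (up b) \<in> slab"
        using slab_isometry_mult[OF orth_stiefel[OF \<open>gram y \<noteq> 0\<close>]] by simp
      moreover have "\<bar>?P (rmul ?t b)\<bar> powr (- ?k) = \<bar>?P b\<bar> powr (- ?k) * ?T powr (- ?k)"
        using t Pt by (simp add: up_rmul det_mul det_upper[OF t(1)] abs_mult powr_mult)
      ultimately show ?thesis
        by (simp add: hw c_def ennreal_mult[symmetric] haar_weight_nonneg prod_nonneg mult_ac split: split_indicator)
    qed (simp add: hw)
  qed
  also have "\<dots> = ennreal c * slab_const TYPE('m) TYPE('k)"
    unfolding slab_const_def by (rule nn_integral_cmult) measurable
  also have "ennreal (\<Prod>j\<in>UNIV. \<bar>?t $ j $ j\<bar> ^ Suc (rk j)) * (ennreal c * slab_const TYPE('m) TYPE('k)) =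
      ennreal ((\<Prod>j\<in>UNIV. \<bar>?t $ j $ j\<bar> ^ Suc (rk j)) * c) * slab_const TYPE('m) TYPE('k)"
    using c0 by (simp add: ennreal_mult prod_nonneg mult.assoc)
  \<comment> \<open>The Jacobian of the translation and the Haar density cancel; only the twist by
    the determinant remains, which becomes the power of \<open>gram y\<close>.\<close>
  also have "(\<Prod>j\<in>UNIV. \<bar>?t $ j $ j\<bar> ^ Suc (rk j)) * c = ?T powr (- ?k)"
  proof -
    have "(\<Prod>j\<in>UNIV. \<bar>?t $ j $ j\<bar> ^ Suc (rk j)) * (\<Prod>j\<in>UNIV. ?t $ j $ j powr (- real (Suc (rk j)))) =
        (\<Prod>j\<in>UNIV. ?t $ j $ j powr real (Suc (rk j)) * ?t $ j $ j powr (- real (Suc (rk j))))"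
      using t(2) by (simp add: prod.distrib powr_realpow abs_of_pos del: of_nat_Suc)
    also have "\<dots> = 1" using t(2) by (intro prod.neutral ballI) (simp add: powr_add[symmetric] less_imp_neq[OF t(2), symmetric])
    finally show ?thesis by (simp add: c_def mult.assoc[symmetric])
  qed
  also have "?T powr (- ?k) = gram y powr (- ?k / 2)"
  proof -
    have "gram y = ?T powr 2" using t Pt by (simp add: gram_tri det_upper)
    then show ?thesis by (simp add: powr_powr)
  qed
  finally show ?thesis by (simp add: mult.commute)
qed

text \<open>A continuous positive function on a compact set has a positive minimum: on the slab
  times the unit sphere y z is nonzero, because y has full column rank.\<close>

lemma slab_mult_lower:
  obtains c where "c > 0" "\<And>(y :: real^'m^'k) (z :: real^'l^'m). y \<in> slab \<Longrightarrow> c * norm z \<le> norm (y ** z)"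
proof (cases "(slab :: (real^'m^'k) set) = {}")
  case True
  then show ?thesis using that[of 1] by auto
next
  case False
  let ?S = "(slab :: (real^'m^'k) set) \<times> sphere (0 :: real^'l^'m) 1"
  have "compact ?S" by (intro compact_Times compact_slab compact_sphere)
  moreover have "?S \<noteq> {}" using False by simp
  moreover have "continuous_on ?S (\<lambda>(y, z). norm (y ** z))"
    unfolding case_prod_unfold by (intro continuous_intros)
  ultimately obtain p where p: "p \<in> ?S" "\<And>q. q \<in> ?S \<Longrightarrow> (\<lambda>(y, z). norm (y ** z)) p \<le> (\<lambda>(y, z). norm (y ** z)) q"
    using continuous_attains_inf[of ?S "\<lambda>(y, z). norm (y ** z)"] by blast
  obtain y0 z0 where yz: "p = (y0, z0)" by force
  define c where "c = norm (y0 ** z0)"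
  have y0: "y0 \<in> slab" and z0: "norm z0 = 1" using p(1) yz by auto
  have "c \<noteq> 0"
  proof
    assume "c = 0"
    let ?s = "transpose y0 ** y0"
    have "det ?s \<noteq> 0" using slab_gram_nz[OF y0] by (simp add: gram_def)
    then have "z0 = (cinv ?s ** ?s) ** z0" by (simp add: cinv_mult)
    also have "\<dots> = cinv ?s ** (transpose y0 ** (y0 ** z0))" by (simp only: matrix_mul_assoc)
    also have "\<dots> = 0" using \<open>c = 0\<close> by (simp add: c_def)
    finally have "z0 = 0" .
    then show False using z0 by simp
  qed
  then have "c > 0" by (simp add: c_def)
  moreover have "c * norm z \<le> norm (y ** z)" if "y \<in> slab" for y :: "real^'m^'k" and z :: "real^'l^'m"
  proof (cases "z = 0")
    case False
    have "c \<le> norm (y ** (z /\<^sub>R norm z))"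
      using p(2)[of "(y, z /\<^sub>R norm z)"] that False by (simp add: yz c_def)
    also have "\<dots> = norm (y ** z) / norm z"
      by (simp add: bounded_bilinear.scaleR_right[OF bilinear_matrix_mult] divide_inverse mult.commute)
    finally show ?thesis using False by (simp add: field_simps)
  qed simp
  ultimately show ?thesis using that by blast
qed

lemma abs_nth_nth_le: "\<bar>(b :: real^'m^'n) $ i $ j\<bar> \<le> norm b"
proof -
  have "axis i (axis j 1) \<in> (Basis :: (real^'m^'n) set)" by (auto simp: Basis_matrix)
  then show ?thesis using Basis_le_norm[of "axis i (axis j 1)" b] by (simp add: inner_axis_axis)
qed

lemma norm_le_entries:
  assumes "\<And>i j. \<bar>(b :: real^'m^'n) $ i $ j\<bar> \<le> B"
  shows "norm b \<le> real (CARD('m) * CARD('n)) * B"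
proof -
  have "norm b \<le> (\<Sum>e\<in>Basis. \<bar>b \<bullet> e\<bar>)" by (rule norm_le_l1)
  also have "\<dots> \<le> (\<Sum>e\<in>(Basis :: (real^'m^'n) set). B)"
    using assms by (intro sum_mono) (auto simp: Basis_matrix inner_axis_axis)
  finally show ?thesis by (simp add: mult.commute)
qed

text \<open>Where the integrand is nonzero, \<open>up b\<close> is the inverse of a slab matrix, so
  its norm is bounded and its determinant bounded away from 0. This bounds each diagonal entry from
  below, so the integrand is bounded and has bounded support.\<close>

lemma slab_const_finite: "slab_const TYPE('m::finite) TYPE('k::finite) < \<infinity>"
proof -
  let ?k = "real CARD('k)"
  let ?P = "\<lambda>b :: real^'m^'m. det (up b)"
  obtain c where c: "c > 0" "\<And>(y :: real^'m^'m) (z :: real^'m^'m). y \<in> slab \<Longrightarrow> c * norm z \<le> norm (y ** z)"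
    using slab_mult_lower[where 'm='m and 'k='m and 'l='m] by metis
  have "bounded ((det :: real^'m^'m \<Rightarrow> real) ` slab)"
    by (intro compact_imp_bounded compact_continuous_image compact_slab continuous_intros)
  then obtain D where D: "D > 0" "\<And>a :: real^'m^'m. a \<in> slab \<Longrightarrow> \<bar>det a\<bar> \<le> D"
    unfolding bounded_pos by auto
  define B where "B = max 1 (norm (mat 1 :: real^'m^'m) / c)"
  \<comment> \<open>The product of the diagonal entries has modulus at least 1/D while each of the
    other m - 1 factors is at most B, leaving this lower bound for every single one.\<close>
  define \<delta> where "\<delta> = min 1 (1 / (D * B ^ (CARD('m) - 1)))"
  have B1: "B \<ge> 1" by (simp add: B_def)
  have \<delta>0: "\<delta> > 0" using D(1) B1 by (simp add: \<delta>_def)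
  define E where "E = (\<Prod>j\<in>(UNIV :: 'm set). \<delta> powr (- real (Suc (rk j)))) * (1 / D) powr (- ?k)"
  define R where "R = real (CARD('m) * CARD('m)) * B"
  have E0: "E \<ge> 0" by (simp add: E_def prod_nonneg)
  have bound: "haar_weight b * (\<bar>?P b\<bar> powr (- ?k)) \<le> E \<and> norm b \<le> R"
    if b: "cinv (up b) \<in> slab" "haar_weight b \<noteq> 0" for b :: "real^'m^'m"
  proof -
    have nz: "b $ j $ j \<noteq> 0" for j using haar_weight_nz[OF b(2)] .
    then have du: "det (up b) \<noteq> 0" by (simp add: det_up)
    have "c * norm (up b) \<le> norm (cinv (up b) ** up b)" by (rule c(2)[OF b(1)])
    then have "norm (up b) \<le> B" using c(1) cinv_mult[OF du] by (simp add: B_def field_simps le_max_iff_disj)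
    then have ub: "\<bar>up b $ i $ j\<bar> \<le> B" for i j using abs_nth_nth_le[of "up b" i j] by linarith
    have lb: "b \<in> lowbox" using b(2) by (auto simp: haar_weight_def indicator_def split: if_splits)
    have eb: "\<bar>b $ i $ j\<bar> \<le> B" for i j
    proof (cases "rk i \<le> rk j")
      case True then show ?thesis using ub[of i j] by (simp add: up_nth)
    next
      case False
      then have "\<bar>b $ i $ j\<bar> \<le> 1" using lb by (simp add: lowbox_def)
      then show ?thesis using B1 by linarith
    qed
    have "det (cinv (up b)) * ?P b = 1"
      using cinv_mult[OF du] by (metis det_I det_mul)
    then have "\<bar>det (cinv (up b))\<bar> * \<bar>?P b\<bar> = 1" by (metis abs_mult abs_one)
    moreover have "\<bar>det (cinv (up b))\<bar> * \<bar>?P b\<bar> \<le> D * \<bar>?P b\<bar>" using D(2)[OF b(1)] by (rule mult_right_mono) simp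
    ultimately have Pb: "1 / D \<le> \<bar>?P b\<bar>" using D(1) by (simp add: field_simps)
    have dj: "\<delta> \<le> \<bar>b $ j $ j\<bar>" for j
    proof -
      have "\<bar>?P b\<bar> = \<bar>b $ j $ j\<bar> * (\<Prod>i\<in>UNIV - {j}. \<bar>b $ i $ i\<bar>)"
        by (subst det_up, subst prod.remove[of UNIV j]) (auto simp: abs_mult abs_prod)
      also have "(\<Prod>i\<in>UNIV - {j}. \<bar>b $ i $ i\<bar>) \<le> (\<Prod>i\<in>UNIV - {j}. B)"
        using eb by (intro prod_mono) auto
      also have "\<dots> = B ^ (CARD('m) - 1)" by simp
      finally have "1 / D \<le> \<bar>b $ j $ j\<bar> * B ^ (CARD('m) - 1)"
        using Pb by (simp add: mult_left_mono)
      then have "1 / (D * B ^ (CARD('m) - 1)) \<le> \<bar>b $ j $ j\<bar>"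
        using D(1) B1 by (simp add: field_simps)
      then show ?thesis by (simp add: \<delta>_def)
    qed
    have "haar_weight b \<le> (\<Prod>j\<in>UNIV. \<bar>b $ j $ j\<bar> powr (- real (Suc (rk j))))"
      by (simp add: haar_weight_def indicator_def prod_nonneg)
    also have "\<dots> \<le> (\<Prod>j\<in>(UNIV :: 'm set). \<delta> powr (- real (Suc (rk j))))"
      using dj \<delta>0 by (intro prod_mono conjI powr_mono2') auto
    finally have "haar_weight b * (\<bar>?P b\<bar> powr (- ?k)) \<le> E"
      unfolding E_def using Pb D(1) by (intro mult_mono powr_mono2') (auto simp: prod_nonneg)
    moreover have "norm b \<le> R" unfolding R_def by (rule norm_le_entries[OF eb])
    ultimately show ?thesis by blast
  qed
  have "slab_const TYPE('m) TYPE('k) \<le> (\<integral>\<^sup>+b. ennreal E * indicator (cball 0 R) b \<partial>(lborel :: (real^'m^'m) measure))"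
    unfolding slab_const_def
  proof (rule nn_integral_mono)
    fix b :: "real^'m^'m"
    show "ennreal (haar_weight b * (\<bar>?P b\<bar> powr (- ?k))) * indicator slab (cinv (up b)) \<le> ennreal E * indicator (cball 0 R) b"
      using bound[of b] by (cases "haar_weight b = 0") (auto simp: E0 intro: ennreal_leI split: split_indicator)
  qed
  also have "\<dots> = ennreal E * emeasure lborel (cball (0 :: real^'m^'m) R)"
    by (rule nn_integral_cmult_indicator) simp
  also have "\<dots> < \<infinity>"
    using emeasure_bounded_finite[OF bounded_cball, of "0 :: real^'m^'m" R] by (simp add: ennreal_mult_less_top)
  finally show ?thesis .
qed

text \<open>The integrand is positive near half the identity, whose inverse 2 * \<open>mat 1\<close>
  is interior to the slab and whose lower entries are interior to the box. Positivity is what allows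
  division by the constant later.\<close>

lemma slab_const_pos: "slab_const TYPE('m::finite) TYPE('k::finite) > 0"
proof (rule ccontr)
  assume "\<not> ?thesis"
  then have z: "slab_const TYPE('m) TYPE('k) = 0" by simp
  let ?F = "\<lambda>b :: real^'m^'m. ennreal (haar_weight b * (\<bar>det (up b)\<bar> powr (- real CARD('k)))) * indicator slab (cinv (up b))"
  have AE: "AE b in lborel. ?F b = 0"
    using z unfolding slab_const_def by (subst (asm) nn_integral_0_iff_AE) measurable
  let ?N = "{b :: real^'m^'m. det (up b) \<noteq> 0}"
  let ?W = "{a :: real^'m^'m. norm a < 3 * real CARD('m)} \<inter> {a. 1 < gram a}"
  let ?L = "\<Inter>i. \<Inter>j\<in>{j. rk j < rk i}. {b :: real^'m^'m. \<bar>b $ i $ j\<bar> < 1}"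
  let ?U = "?N \<inter> (\<lambda>b. cinv (up b)) -` ?W \<inter> ?L"
  have oN: "open ?N" by (intro open_Collect_neq continuous_intros)
  have oW: "open ?W" by (intro open_Int open_Collect_less continuous_intros)
  have oX: "open (?N \<inter> (\<lambda>b. cinv (up b)) -` ?W)"
    by (intro continuous_open_preimage oN oW continuous_intros) simp
  have "open ?L" by (intro open_INT ballI open_Collect_less continuous_intros) auto
  with oX have oU: "open ?U" by (rule open_Int)
  let ?b0 = "(1/2) *\<^sub>R mat 1 :: real^'m^'m"
  have upb: "up ?b0 = ?b0" by (auto simp: up_def vec_eq_iff mat_def)
  have db: "det ?b0 \<noteq> 0" using det_up[of ?b0] upb by (simp add: mat_def)
  have "cinv ?b0 = 2 *\<^sub>R mat 1"
  proof -
    have "cinv ?b0 = 2 *\<^sub>R (cinv ?b0 ** ?b0)"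
      by (simp add: bounded_bilinear.scaleR_right[OF bilinear_matrix_mult])
    then show ?thesis by (simp only: cinv_mult[OF db])
  qed
  moreover have "(mat 1 :: real^'m^'m) \<in> stiefel" by (simp add: stiefel_def)
  ultimately have "?b0 \<in> ?U"
    using db double_stiefel_interior_slab[of "mat 1 :: real^'m^'m"] by (auto simp: upb) (auto simp: mat_def)
  then obtain e where e: "e > 0" "ball ?b0 e \<subseteq> ?U" using oU by (meson openE)
  have "AE b in lborel. b \<notin> ball ?b0 e"
    using AE
  proof eventually_elim
    case (elim b)
    show ?case
    proof
      assume "b \<in> ball ?b0 e"
      then have b: "b \<in> ?U" using e(2) by blast
      then have db: "det (up b) \<noteq> 0" by blast
      then have nz: "b $ j $ j \<noteq> 0" for j by (auto simp: det_up)
      have "b \<in> lowbox" using b by (auto simp: lowbox_def intro: less_imp_le)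
      then have "haar_weight b > 0" using nz by (auto simp: haar_weight_def intro!: prod_pos)
      moreover have "cinv (up b) \<in> slab" using b by (auto simp: slab_def)
      ultimately show False using elim nz db by (auto simp: ennreal_eq_0_iff mult_le_0_iff not_le)
    qed
  qed
  then have "emeasure lborel (ball ?b0 e) = 0"
    by (subst (asm) AE_iff_measurable[OF _ refl]) (auto simp: ball_def)
  then show False
    using e(1) unit_ball_vol_nonzero[of "CARD('m) * CARD('m)"] by (simp add: emeasure_ball)
qed

text \<open>For fixed b the substitution of \<open>stretch u b x\<close> moves the group element
  from f into the slab condition, at the cost of |det b|^k. After exchanging the integrals, the one
  over b is \<open>slab_mass\<close>.\<close>

lemma stretch_nn_integral:
  fixes u :: "real^'k^'n" and f :: "real^'m^'n \<Rightarrow> ennreal"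
  assumes u: "u \<in> stiefel" and kn: "CARD('k) \<le> CARD('n)" and f [measurable]: "f \<in> borel_measurable borel"
  shows "(\<integral>\<^sup>+b. (\<integral>\<^sup>+x. ennreal (haar_weight b) * indicator slab (transpose u ** x) * f (stretch u b x) \<partial>lborel) \<partial>lborel) =
    (\<integral>\<^sup>+x. slab_mass (transpose u ** x) * f x \<partial>lborel)"
proof -
  let ?k = "real CARD('k)"
  let ?g = "\<lambda>b x. indicator slab (transpose u ** x ** cinv (up b)) * f x"
  have inner: "(\<integral>\<^sup>+x. ennreal (haar_weight b) * indicator slab (transpose u ** x) * f (stretch u b x) \<partial>lborel) =
      (\<integral>\<^sup>+x. ennreal (haar_weight b * (\<bar>det (up b)\<bar> powr (- ?k))) * ?g b x \<partial>lborel)" for b :: "real^'m^'m"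
  proof (cases "haar_weight b = 0")
    case False
    then have nz: "b $ j $ j \<noteq> 0" for j by (rule haar_weight_nz)
    then have db: "det (up b) \<noteq> 0" by (simp add: det_up)
    have g: "?g b (stretch u b x) = indicator slab (transpose u ** x) * f (stretch u b x)" for x :: "real^'m^'n"
    proof -
      have "transpose u ** stretch u b x ** cinv (up b) = transpose u ** x ** (up b ** cinv (up b))"
        by (simp add: transpose_stretch[OF u] matrix_mul_assoc)
      then show ?thesis by (simp add: mult_cinv[OF db])
    qed
    have P: "(\<Prod>j\<in>UNIV. \<bar>b $ j $ j\<bar>) ^ CARD('k) = \<bar>det (up b)\<bar> powr ?k"
      using db by (simp add: det_up abs_prod powr_realpow prod_pos nz)
    have "(\<integral>\<^sup>+x. ?g b x \<partial>lborel) =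
        ennreal (\<bar>det (up b)\<bar> powr ?k) * (\<integral>\<^sup>+x. indicator slab (transpose u ** x) * f (stretch u b x) \<partial>lborel)"
      unfolding P[symmetric] g[symmetric] by (rule nn_integral_stretch[OF u kn nz]) measurable
    then have "ennreal (\<bar>det (up b)\<bar> powr (- ?k)) * (\<integral>\<^sup>+x. ?g b x \<partial>lborel) =
        ennreal (\<bar>det (up b)\<bar> powr (- ?k) * \<bar>det (up b)\<bar> powr ?k) *
        (\<integral>\<^sup>+x. indicator slab (transpose u ** x) * f (stretch u b x) \<partial>lborel)"
      by (simp add: ennreal_mult mult.assoc)
    also have "\<bar>det (up b)\<bar> powr (- ?k) * \<bar>det (up b)\<bar> powr ?k = 1"
      using db by (simp add: powr_add[symmetric])
    finally show ?thesis
      by (simp add: nn_integral_cmult ennreal_mult haar_weight_nonneg mult.assoc)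
  qed simp
  have "(\<integral>\<^sup>+b. (\<integral>\<^sup>+x. ennreal (haar_weight b) * indicator slab (transpose u ** x) * f (stretch u b x) \<partial>lborel) \<partial>lborel) =
     (\<integral>\<^sup>+x. (\<integral>\<^sup>+b. ennreal (haar_weight b * (\<bar>det (up b)\<bar> powr (- ?k))) * ?g b x \<partial>lborel) \<partial>lborel)"
    unfolding inner by (rule lborel_pair.Fubini') measurable
  also have "\<dots> = (\<integral>\<^sup>+x. slab_mass (transpose u ** x) * f x \<partial>lborel)"
    unfolding slab_mass_def mult.assoc[symmetric] by (intro nn_integral_cong nn_integral_multc) measurable
  finally show ?thesis .
qed

text \<open>The nonnegative formula, read for indicators, identifies the image under
  \<open>stretch\<close> of the weighted measure on pairs (b, x) with a density of Lebesgue measure;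
  integrals of complex functions then transfer.\<close>

lemma stretch_integral:
  fixes u :: "real^'k^'n" and f :: "real^'m^'n \<Rightarrow> complex"
  assumes u: "u \<in> stiefel" and kn: "CARD('k) \<le> CARD('n)" and f [measurable]: "f \<in> borel_measurable borel"
    and int: "integrable lborel (\<lambda>x. (gram (transpose u ** x) powr (- real CARD('k) / 2)) *\<^sub>R f x)"
  defines "C \<equiv> enn2real (slab_const TYPE('m) TYPE('k))"
  shows "integrable lborel (\<lambda>(b, x). (haar_weight b * indicator slab (transpose u ** x)) *\<^sub>R f (stretch u b x))"
    and "(\<integral>(b, x). (haar_weight b * indicator slab (transpose u ** x)) *\<^sub>R f (stretch u b x) \<partial>lborel) =
      C *\<^sub>R (\<integral>x. (gram (transpose u ** x) powr (- real CARD('k) / 2)) *\<^sub>R f x \<partial>lborel)"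
proof -
  let ?W = "\<lambda>p. haar_weight (fst p) * indicator slab (transpose u ** snd p) :: real"
  let ?\<Phi> = "\<lambda>p. stretch u (fst p) (snd p)"
  let ?w = "\<lambda>x. C * gram (transpose u ** x) powr (- real CARD('k) / 2)"
  have C: "slab_const TYPE('m) TYPE('k) = ennreal C"
    unfolding C_def using slab_const_finite[where 'm='m and 'k='k] by simp
  have [measurable]: "?W \<in> borel_measurable borel" "?\<Phi> \<in> borel_measurable borel" "?w \<in> borel_measurable borel"
    unfolding borel_prod[symmetric] by measurable
  have W0: "?W p \<ge> 0" for p by (simp add: haar_weight_nonneg)
  have C0: "C \<ge> 0" by (simp add: C_def)
  then have w0: "?w x \<ge> 0" for x by simp
  define D where "D = density (lborel :: ((real^'m^'m) \<times> (real^'m^'n)) measure) (\<lambda>p. ennreal (?W p))"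
  have [simp]: "space D = UNIV" "sets D = sets borel" by (simp_all add: D_def)
  have [measurable]: "?\<Phi> \<in> borel_measurable D" by (simp add: D_def)
  have eq: "distr D borel ?\<Phi> = density lborel (\<lambda>x. ennreal (?w x))"
  proof (rule measure_eqI)
    fix A assume "A \<in> sets (distr D borel ?\<Phi>)"
    then have A [measurable]: "A \<in> sets borel" by simp
    have "emeasure (distr D borel ?\<Phi>) A = (\<integral>\<^sup>+x. indicator A x \<partial>distr D borel ?\<Phi>)" by simp
    also have "\<dots> = (\<integral>\<^sup>+p. indicator A (?\<Phi> p) \<partial>D)" by (rule nn_integral_distr) simp_all
    also have "\<dots> = (\<integral>\<^sup>+p. ennreal (?W p) * indicator A (?\<Phi> p) \<partial>lborel)"
      unfolding D_def by (rule nn_integral_density) simp_all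
    also have "\<dots> = (\<integral>\<^sup>+p. ennreal (?W p) * indicator A (?\<Phi> p) \<partial>(lborel \<Otimes>\<^sub>M lborel))"
      by (simp add: lborel_prod)
    also have "\<dots> = (\<integral>\<^sup>+b. (\<integral>\<^sup>+x. ennreal (?W (b, x)) * indicator A (?\<Phi> (b, x)) \<partial>lborel) \<partial>lborel)"
      by (rule lborel.nn_integral_fst[symmetric]) (simp add: lborel_prod)
    also have "\<dots> = (\<integral>\<^sup>+b. (\<integral>\<^sup>+x. ennreal (haar_weight b) * indicator slab (transpose u ** x) * indicator A (stretch u b x) \<partial>lborel) \<partial>lborel)"
      by (intro nn_integral_cong) (auto simp: split: split_indicator)
    also have "\<dots> = (\<integral>\<^sup>+x. slab_mass (transpose u ** x) * indicator A x \<partial>lborel)"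
      by (rule stretch_nn_integral[OF u kn]) simp
    also have "\<dots> = (\<integral>\<^sup>+x. ennreal (?w x) * indicator A x \<partial>lborel)"
      by (simp add: slab_mass_eq C ennreal_mult C0)
    also have "\<dots> = emeasure (density lborel (\<lambda>x. ennreal (?w x))) A"
      by (rule emeasure_density[symmetric]) simp_all
    finally show "emeasure (distr D borel ?\<Phi>) A = emeasure (density lborel (\<lambda>x. ennreal (?w x))) A" .
  qed simp
  have "integrable lborel (\<lambda>x. C *\<^sub>R ((gram (transpose u ** x) powr (- real CARD('k) / 2)) *\<^sub>R f x))"
    using int by (rule integrable_scaleR_right)
  then have "integrable lborel (\<lambda>x. ?w x *\<^sub>R f x)" by simp
  then have "integrable (distr D borel ?\<Phi>) f"
    unfolding eq by (subst integrable_density) (simp_all add: C0)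
  then have "integrable D (\<lambda>p. f (?\<Phi> p))"
    by (subst (asm) integrable_distr_eq) simp_all
  then have "integrable lborel (\<lambda>p. ?W p *\<^sub>R f (?\<Phi> p))"
    unfolding D_def by (subst (asm) integrable_density) (simp_all add: W0)
  then show "integrable lborel (\<lambda>(b, x). (haar_weight b * indicator slab (transpose u ** x)) *\<^sub>R f (stretch u b x))"
    by (simp add: case_prod_unfold)
  have "(\<integral>p. ?W p *\<^sub>R f (?\<Phi> p) \<partial>lborel) = (\<integral>p. f (?\<Phi> p) \<partial>D)"
    unfolding D_def by (rule integral_density[symmetric]) (simp_all add: W0)
  also have "\<dots> = (\<integral>x. f x \<partial>distr D borel ?\<Phi>)" by (rule integral_distr[symmetric]) simp_all
  also have "\<dots> = (\<integral>x. ?w x *\<^sub>R f x \<partial>lborel)"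
    unfolding eq by (rule integral_density) (simp_all add: C0)
  also have "\<dots> = C *\<^sub>R (\<integral>x. (gram (transpose u ** x) powr (- real CARD('k) / 2)) *\<^sub>R f x \<partial>lborel)"
    unfolding scaleR_scaleR[symmetric] by (rule integral_scaleR_right)
  finally show "(\<integral>(b, x). (haar_weight b * indicator slab (transpose u ** x)) *\<^sub>R f (stretch u b x) \<partial>lborel) =
      C *\<^sub>R (\<integral>x. (gram (transpose u ** x) powr (- real CARD('k) / 2)) *\<^sub>R f x \<partial>lborel)"
    by (simp add: case_prod_unfold)
qed

section \<open>Integration by parts along an axis\<close>

text \<open>For a unit vector e, positive s gives the dilation through which homogeneity in that
  coordinate is expressed, and s = -1 the reflection that separates even from odd.\<close>

definition dil :: "'a::real_inner \<Rightarrow> real \<Rightarrow> 'a \<Rightarrow> 'a" where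
  "dil e s z = z + ((s - 1) * (z \<bullet> e)) *\<^sub>R e"

definition par :: "'a::real_normed_vector \<Rightarrow> ('a \<Rightarrow> 'b::real_normed_vector) \<Rightarrow> 'a \<Rightarrow> 'b" where
  "par e f z = frechet_derivative f (at z) e"

text \<open>Hadamard's form of \<open>(\<partial>\<^sub>e f(z) - \<partial>\<^sub>e f(z')) / 2(z \<bullet> e)\<close>, \<open>z'\<close> the reflection of \<open>z\<close>:
  unlike the quotient it is visibly as smooth as \<open>\<partial>\<^sub>e\<^sup>2 f\<close>.\<close>

definition hadm :: "'a::euclidean_space \<Rightarrow> ('a \<Rightarrow> complex) \<Rightarrow> 'a \<Rightarrow> complex" where
  "hadm e f z = (1/2) *\<^sub>R integral (cbox (-1) 1) (\<lambda>s. par e (par e f) (dil e s z))"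

lemma dil_inner: "e \<in> Basis \<Longrightarrow> e' \<in> Basis \<Longrightarrow> dil e s z \<bullet> e' = (if e' = e then s * (z \<bullet> e) else z \<bullet> e')"
  by (auto simp: dil_def inner_add_left inner_Basis algebra_simps)

lemma dil_dil: "e \<in> Basis \<Longrightarrow> dil e s (dil e t z) = dil e (s * t) z"
  by (rule euclidean_eqI) (auto simp: dil_inner)

lemma dil_1 [simp]: "dil e 1 z = z"
  by (simp add: dil_def)

lemma continuous_on_dil [continuous_intros]:
  "continuous_on S f \<Longrightarrow> continuous_on S g \<Longrightarrow> continuous_on S (\<lambda>x. dil e (f x) (g x))"
  unfolding dil_def by (intro continuous_intros)

lemma higher_differentiable_on_par:
  "higher_differentiable_on UNIV f (Suc r) \<Longrightarrow> higher_differentiable_on UNIV (par e f) r"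
  by (simp add: par_def[abs_def])

lemma par_has_vector_derivative:
  assumes "higher_differentiable_on UNIV f (Suc r)"
  shows "((\<lambda>t. f (z + t *\<^sub>R e)) has_vector_derivative par e f (z + t *\<^sub>R e)) (at t)"
proof -
  have f: "(f has_derivative frechet_derivative f (at (z + t *\<^sub>R e))) (at (z + t *\<^sub>R e))"
    using assms by (intro frechet_derivative_works[THEN iffD1]) simp
  have "((\<lambda>t. z + t *\<^sub>R e) has_derivative (\<lambda>h. h *\<^sub>R e)) (at t)"
    by (auto intro!: derivative_eq_intros)
  from has_derivative_compose[OF this f] show ?thesis
    unfolding has_vector_derivative_def par_def
    by (simp add: linear_cmul[OF has_derivative_linear[OF f]])
qed

text \<open>Differentiation under the integral sign. A derivative along e pulls a factor s out of
  \<open>dil e s\<close>, while the other directions do not; the power \<open>s ^ p\<close> in the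
  statement is there so that the induction absorbs this factor.\<close>

lemma higher_differentiable_on_dil_integral:
  fixes f :: "'a::euclidean_space \<Rightarrow> complex"
  assumes e: "e \<in> Basis" and f: "higher_differentiable_on UNIV f r"
  shows "higher_differentiable_on UNIV (\<lambda>z. integral (cbox (-1) (1::real)) (\<lambda>s. s ^ p *\<^sub>R f (dil e s z))) r"
  using f
proof (induction r arbitrary: f p)
  case 0
  then have fc: "continuous_on UNIV f" by simp
  have "continuous_on (UNIV \<times> cbox (-1) (1::real)) (\<lambda>(z, s). s ^ p *\<^sub>R f (dil e s z))"
    unfolding case_prod_unfold
    by (intro continuous_intros continuous_on_compose2[OF fc]) simp_all
  from integral_continuous_on_param[OF this] show ?case by simp
next
  case (Suc r)
  let ?D = "\<lambda>z. frechet_derivative f (at z)"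
  let ?I = "\<lambda>p g z. integral (cbox (-1) (1::real)) (\<lambda>s. s ^ p *\<^sub>R g (dil e s z))"
  have D: "(f has_derivative ?D z) (at z)" for z
    using Suc.prems by (intro frechet_derivative_works[THEN iffD1]) simp
  have Dc: "continuous_on UNIV (\<lambda>z. ?D z h)" for h
    using Suc.prems by (intro higher_differentiable_on_imp_continuous_on[where r=r]) simp
  have fc: "continuous_on UNIV f" using Suc.prems by (rule higher_differentiable_on_imp_continuous_on)
  define fx where "fx z s = Blinfun (\<lambda>h. s ^ p *\<^sub>R ?D (dil e s z) (dil e s h))" for z s
  have dl: "bounded_linear (dil e s)" for s
    unfolding dil_def by (intro bounded_linear_intros bounded_linear_ident bounded_linear_add
      bounded_linear_compose[OF bounded_linear_scaleR_left] bounded_linear_const_mult bounded_linear_inner_left)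
  have bl: "bounded_linear (\<lambda>h. s ^ p *\<^sub>R ?D (dil e s z) (dil e s h))" for s z
    by (intro bounded_linear_const_scaleR bounded_linear_compose[OF has_derivative_bounded_linear[OF D] dl])
  have fx: "blinfun_apply (fx z s) h = s ^ p *\<^sub>R ?D (dil e s z) (dil e s h)" for z s h
    unfolding fx_def by (simp add: bounded_linear_Blinfun_apply[OF bl])
  have split: "?D x (dil e s h) = ?D x (h - (h \<bullet> e) *\<^sub>R e) + s *\<^sub>R ((h \<bullet> e) *\<^sub>R ?D x e)" for x s h
  proof -
    have "dil e s h = (h - (h \<bullet> e) *\<^sub>R e) + (s * (h \<bullet> e)) *\<^sub>R e" by (simp add: dil_def algebra_simps)
    then show ?thesis
      by (simp only: linear_add[OF has_derivative_linear[OF D]] linear_cmul[OF has_derivative_linear[OF D]] scaleR_scaleR)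
  qed
  have comp: "continuous_on (UNIV \<times> cbox (-1) (1::real)) (\<lambda>(z, s). blinfun_apply (fx z s) h)" for h
    unfolding case_prod_unfold fx split
    by (intro continuous_intros continuous_on_compose2[OF Dc]) simp_all
  have cfx: "continuous_on (UNIV \<times> cbox (-1) (1::real)) (\<lambda>(z, s). fx z s)"
    using comp unfolding case_prod_unfold by (intro continuous_on_blinfun_componentwise) auto
  have cI: "(\<lambda>s. s ^ p *\<^sub>R f (dil e s z)) integrable_on cbox (-1) (1::real)" for z
    by (intro integrable_continuous continuous_intros continuous_on_compose2[OF fc]) simp_all
  have cF: "fx z integrable_on cbox (-1) (1::real)" for z
    by (intro integrable_continuous continuous_on_compose2[OF cfx, of _ "\<lambda>s. (z, s)", simplified])
      (auto intro!: continuous_intros)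
  have der: "(?I p f has_derivative blinfun_apply (integral (cbox (-1) 1) (fx z))) (at z)" for z
  proof (rule leibniz_rule[where U=UNIV, OF _ cI cfx])
    fix z s
    show "((\<lambda>z. s ^ p *\<^sub>R f (dil e s z)) has_derivative blinfun_apply (fx z s)) (at z)"
      unfolding fx[abs_def]
      by (intro has_derivative_scaleR_right has_derivative_compose[OF bounded_linear_imp_has_derivative[OF dl] D])
  qed auto
  have der': "blinfun_apply (integral (cbox (-1) 1) (fx z)) h =
      ?I p (\<lambda>x. ?D x (h - (h \<bullet> e) *\<^sub>R e)) z + (h \<bullet> e) *\<^sub>R ?I (Suc p) (\<lambda>x. ?D x e) z" for z h
  proof -
    have "blinfun_apply (integral (cbox (-1) 1) (fx z)) h = integral (cbox (-1) 1) (\<lambda>s. blinfun_apply (fx z s) h)"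
      using integral_linear[OF cF blinfun.bounded_linear_left[of h]] by (simp add: o_def)
    also have "\<dots> = integral (cbox (-1) 1) (\<lambda>s. s ^ p *\<^sub>R ?D (dil e s z) (h - (h \<bullet> e) *\<^sub>R e) +
        (h \<bullet> e) *\<^sub>R (s ^ Suc p *\<^sub>R ?D (dil e s z) e))"
      unfolding fx split by (intro integral_cong) (simp add: algebra_simps)
    also have "\<dots> = ?I p (\<lambda>x. ?D x (h - (h \<bullet> e) *\<^sub>R e)) z + (h \<bullet> e) *\<^sub>R ?I (Suc p) (\<lambda>x. ?D x e) z"
      unfolding integral_cmul[symmetric]
      by (intro integral_add integrable_continuous continuous_intros continuous_on_compose2[OF Dc]) simp_all
    finally show ?thesis .
  qed
  show ?case
  proof (rule higher_differentiable_on_SucI)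
    show "higher_differentiable_on UNIV (\<lambda>z. blinfun_apply (integral (cbox (-1) 1) (fx z)) h) r" for h
      unfolding der' using Suc.prems
      by (intro higher_differentiable_on_add higher_differentiable_on_scaleR higher_differentiable_on_const Suc.IH) auto
  qed (use der in auto)
qed

lemma higher_differentiable_on_hadm:
  assumes "e \<in> Basis" "higher_differentiable_on UNIV f (Suc (Suc r))"
  shows "higher_differentiable_on UNIV (hadm e f) r"
  using higher_differentiable_on_dil_integral[OF assms(1) higher_differentiable_on_par[OF higher_differentiable_on_par[OF assms(2)]], of 0 e e]
  unfolding hadm_def[abs_def]
  by (intro higher_differentiable_on_scaleR higher_differentiable_on_const) simp_all

text \<open>The right side is the increment over [-1, 1] of s \<mapsto>
  \<open>par e f (dil e s z)\<close>, whose derivative is z \<bullet> e times the second derivative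
  along e.\<close>

lemma hadm_eq:
  assumes e: "e \<in> Basis" and f: "higher_differentiable_on UNIV f 2"
  shows "(2 * (z \<bullet> e)) *\<^sub>R hadm e f z = par e f z - par e f (dil e (-1) z)"
proof -
  have f1: "higher_differentiable_on UNIV (par e f) (Suc 0)"
    using f by (intro higher_differentiable_on_par) (simp add: numeral_2_eq_2)
  let ?c = "z - (z \<bullet> e) *\<^sub>R e"
  have dz: "dil e s z = ?c + (s * (z \<bullet> e)) *\<^sub>R e" for s by (simp add: dil_def algebra_simps)
  have "((\<lambda>s. (z \<bullet> e) *\<^sub>R par e (par e f) (dil e s z)) has_integral par e f (dil e 1 z) - par e f (dil e (-1) z)) {-1..1}"
  proof (rule fundamental_theorem_of_calculus)
    fix s :: real
    have "((\<lambda>s. s * (z \<bullet> e)) has_vector_derivative (z \<bullet> e)) (at s within {-1..1})"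
      by (auto intro!: derivative_eq_intros)
    from vector_diff_chain_within[OF this has_vector_derivative_at_within[OF par_has_vector_derivative[OF f1, of ?c e]]]
    show "((\<lambda>s. par e f (dil e s z)) has_vector_derivative (z \<bullet> e) *\<^sub>R par e (par e f) (dil e s z)) (at s within {-1..1})"
      unfolding dz o_def .
  qed simp
  from integral_unique[OF this] have "(z \<bullet> e) *\<^sub>R integral {-1..1} (\<lambda>s. par e (par e f) (dil e s z)) =
      par e f z - par e f (dil e (-1) z)"
    by (simp only: integral_cmul dil_1)
  then show ?thesis by (simp add: hadm_def)
qed

text \<open>Stated for arbitrary g: if g is not measurable, neither side is integrable and both
  integrals have the default value 0.\<close>

lemma lborel_integral_dil:
  fixes g :: "'a::euclidean_space \<Rightarrow> complex"
  assumes e: "e \<in> Basis" and t: "t \<noteq> 0"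
  shows "(\<integral>b. g b \<partial>lborel) = \<bar>t\<bar> *\<^sub>R (\<integral>b. g (dil e t b) \<partial>lborel)"
    and "integrable lborel (\<lambda>b. g (dil e t b)) \<longleftrightarrow> integrable lborel g"
proof -
  have T: "0 + (\<Sum>j\<in>Basis. ((if j = e then t else 1) * (x \<bullet> j)) *\<^sub>R j) = dil e t x" for x :: 'a
    by (rule euclidean_eqI) (auto simp: inner_sum_left_Basis dil_inner[OF e])
  have P: "(\<Prod>j\<in>Basis. \<bar>if j = e then t else 1\<bar>) = \<bar>t\<bar>"
    using e by (subst prod.remove[of _ e]) (auto intro!: prod.neutral)
  have L: "lborel = density (distr lborel borel (dil e t)) (\<lambda>_. ennreal \<bar>t\<bar>)"
    using lborel_affine_euclidean[of "\<lambda>j. if j = e then t else 1" 0, unfolded T P] t by simp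
  have M [measurable]: "dil e t \<in> borel_measurable borel"
    by (intro borel_measurable_continuous_onI continuous_intros)
  have inv: "dil e (1/t) (dil e t b) = b" for b using e t by (simp add: dil_dil)
  have inv': "dil e t (dil e (1/t) b) = b" for b using e t by (simp add: dil_dil)
  have M' [measurable]: "dil e (1/t) \<in> borel_measurable borel"
    by (intro borel_measurable_continuous_onI continuous_intros)
  have meas: "g \<in> borel_measurable borel" if "(\<lambda>b. g (dil e t b)) \<in> borel_measurable borel"
    using measurable_compose[OF M' that] by (simp add: inv')
  have nint: "\<not> integrable lborel g" "\<not> integrable lborel (\<lambda>b. g (dil e t b))" if "g \<notin> borel_measurable borel"
  proof -
    show "\<not> integrable lborel g" using that borel_measurable_integrable[of lborel g] by auto
    show "\<not> integrable lborel (\<lambda>b. g (dil e t b))"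
    proof
      assume "integrable lborel (\<lambda>b. g (dil e t b))"
      from borel_measurable_integrable[OF this] have "(\<lambda>b. g (dil e t b)) \<in> borel_measurable borel" by simp
      from meas[OF this] that show False by simp
    qed
  qed
  show "integrable lborel (\<lambda>b. g (dil e t b)) \<longleftrightarrow> integrable lborel g" (is "?l \<longleftrightarrow> ?r")
  proof (cases "g \<in> borel_measurable borel")
    case True
    note [measurable] = this
    have "?r \<longleftrightarrow> integrable (density (distr lborel borel (dil e t)) (\<lambda>_. ennreal \<bar>t\<bar>)) g"
      unfolding L[symmetric] ..
    also have "\<dots> \<longleftrightarrow> integrable lborel (\<lambda>b. \<bar>t\<bar> *\<^sub>R g (dil e t b))"
      by (subst integrable_density) (auto simp: integrable_distr_eq)
    also have "\<dots> \<longleftrightarrow> ?l"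
    proof
      assume "integrable lborel (\<lambda>b. \<bar>t\<bar> *\<^sub>R g (dil e t b))"
      from integrable_scaleR_right[OF this, of "inverse \<bar>t\<bar>"] show ?l using t by simp
    qed simp
    finally show ?thesis ..
  next
    case False
    then show ?thesis using nint by blast
  qed
  show "(\<integral>b. g b \<partial>lborel) = \<bar>t\<bar> *\<^sub>R (\<integral>b. g (dil e t b) \<partial>lborel)"
  proof (cases "g \<in> borel_measurable borel")
    case True
    note [measurable] = this
    have "(\<integral>b. g b \<partial>lborel) = (\<integral>b. g b \<partial>density (distr lborel borel (dil e t)) (\<lambda>_. ennreal \<bar>t\<bar>))"
      unfolding L[symmetric] ..
    also have "\<dots> = (\<integral>b. \<bar>t\<bar> *\<^sub>R g b \<partial>distr lborel borel (dil e t))"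
      by (rule integral_density) auto
    also have "\<dots> = (\<integral>b. \<bar>t\<bar> *\<^sub>R g (dil e t b) \<partial>lborel)"
      by (rule integral_distr) auto
    finally show ?thesis by simp
  next
    case False
    then show ?thesis using nint[OF False] by (simp add: not_integrable_integral_eq)
  qed
qed

section \<open>Complex powers of nonnegative reals and their difference quotients\<close>

abbreviation cpow :: "real \<Rightarrow> complex \<Rightarrow> complex" where
  "cpow t z \<equiv> complex_of_real t powr z"

lemma norm_cpow: "t \<ge> 0 \<Longrightarrow> norm (cpow t z) = t powr Re z"
  by (simp add: norm_powr_real_powr)

lemma cpow_mult: "s \<ge> 0 \<Longrightarrow> t \<ge> 0 \<Longrightarrow> cpow (s * t) z = cpow s z * cpow t z"
  by (simp add: powr_times_real)

lemma cpow_plus_2: "cpow \<bar>t\<bar> (z + 2) = cpow \<bar>t\<bar> z * (complex_of_real t)\<^sup>2"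
proof (cases "t = 0")
  case False
  have "cpow \<bar>t\<bar> (z + of_nat 2) = cpow \<bar>t\<bar> z * cpow \<bar>t\<bar> (of_nat 2)" by (rule powr_add)
  also have "cpow \<bar>t\<bar> (of_nat 2) = (complex_of_real \<bar>t\<bar>)\<^sup>2" using False by (subst powr_nat) simp
  also have "\<dots> = (complex_of_real t)\<^sup>2" by (simp add: of_real_power[symmetric] del: of_real_power)
  finally show ?thesis by simp
qed simp

text \<open>The derivative of w powr z at w = 1, along a sequence because dominated convergence is
  applied to sequences.\<close>

lemma cpow_deriv_sequence:
  assumes "\<And>n. t n \<noteq> (1::real)" "t \<longlonglongrightarrow> 1"
  shows "(\<lambda>n. (cpow (t n) z - 1) / complex_of_real (t n - 1)) \<longlonglongrightarrow> z"
proof -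
  have "((\<lambda>w. w powr z) has_field_derivative z * 1 powr (z - 1)) (at 1)"
    by (rule has_field_derivative_powr) (auto simp: complex_nonpos_Reals_iff)
  then have D: "((\<lambda>w. (w powr z - 1) / (w - 1)) \<longlongrightarrow> z) (at 1)"
    by (simp add: has_field_derivative_iff)
  have "filterlim (\<lambda>n. complex_of_real (t n)) (at 1) sequentially"
    unfolding filterlim_at using assms tendsto_of_real[OF assms(2), where 'a=complex] by (auto simp: of_real_eq_1_iff)
  from filterlim_compose[OF D this] show ?thesis by simp
qed

lemma has_vector_derivative_sequence:
  assumes f: "(f has_vector_derivative D) (at (x::real))" and t: "\<And>n. t n \<noteq> 0" "t \<longlonglongrightarrow> 0"
  shows "(\<lambda>n. (f (x + t n) - f x) /\<^sub>R t n) \<longlonglongrightarrow> D"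
proof -
  have "((\<lambda>h. norm (f (x + h) - f x - h *\<^sub>R D) / norm h) \<longlongrightarrow> 0) (at 0)"
    using f by (simp add: has_vector_derivative_def has_derivative_at)
  moreover have "filterlim t (at 0) sequentially" unfolding filterlim_at using t by auto
  ultimately have "(\<lambda>n. norm (f (x + t n) - f x - t n *\<^sub>R D) / norm (t n)) \<longlonglongrightarrow> 0"
    by (rule filterlim_compose)
  moreover have "norm (f (x + t n) - f x - t n *\<^sub>R D) / norm (t n) = norm ((f (x + t n) - f x) /\<^sub>R t n - D)" for n
  proof -
    have "(f (x + t n) - f x) /\<^sub>R t n - D = (f (x + t n) - f x - t n *\<^sub>R D) /\<^sub>R t n"
      using t(1)[of n] by (simp add: scaleR_diff_right)
    then show ?thesis by (simp add: divide_inverse mult.commute)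
  qed
  ultimately have "(\<lambda>n. norm ((f (x + t n) - f x) /\<^sub>R t n - D)) \<longlonglongrightarrow> 0" by simp
  then show ?thesis using tendsto_norm_zero_iff LIM_zero_iff by blast
qed

text \<open>The left side sees only the part of \<open>h\<close> even in \<open>b \<bullet> e\<close>, whose derivative is \<open>(b \<bullet> e) h2 b\<close>; hence
  the exponent rises by 2, as the factors of the Gamma function require.\<close>

lemma integral_by_parts_radial:
  fixes h h1 h2 W :: "'a::euclidean_space \<Rightarrow> complex" and e :: 'a
  assumes e: "e \<in> Basis"
    and [measurable]: "h \<in> borel_measurable borel" "h1 \<in> borel_measurable borel" "W \<in> borel_measurable borel" "S \<in> sets borel"
    and Wdil: "\<And>t b. t \<noteq> 0 \<Longrightarrow> W (dil e t b) = W b"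
    and der: "\<And>b t. ((\<lambda>t. h (b + t *\<^sub>R e)) has_vector_derivative h1 (b + t *\<^sub>R e)) (at t)"
    and h2: "\<And>b. W b \<noteq> 0 \<Longrightarrow> (2 * (b \<bullet> e)) *\<^sub>R h2 b = h1 b - h1 (dil e (-1) b)"
    and supp: "\<And>b. W b \<noteq> 0 \<Longrightarrow> b \<notin> S \<Longrightarrow> h b = 0 \<and> h1 b = 0"
    and M: "\<And>b. W b \<noteq> 0 \<Longrightarrow> norm (h b) \<le> M \<and> norm (h1 b) \<le> M"
    and Sexp: "\<And>b t. b \<notin> S \<Longrightarrow> t \<ge> 1 \<Longrightarrow> dil e t b \<notin> S"
    and Sbd: "\<And>b. b \<in> S \<Longrightarrow> \<bar>b \<bullet> e\<bar> \<le> B"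
    and Sflip: "\<And>b. dil e (-1) b \<in> S \<longleftrightarrow> b \<in> S"
    and int: "integrable lborel (\<lambda>b. \<bar>b \<bullet> e\<bar> powr (Re s - 1) * norm (W b) * indicator S b)"
  shows "s * (\<integral>b. cpow \<bar>b \<bullet> e\<bar> (s - 1) * W b * h b \<partial>lborel) =
    - (\<integral>b. cpow \<bar>b \<bullet> e\<bar> (s + 1) * W b * h2 b \<partial>lborel)"
proof -
  define P where "P b = cpow \<bar>b \<bullet> e\<bar> (s - 1) * W b" for b
  have [measurable]: "P \<in> borel_measurable borel" unfolding P_def by measurable
  have nP: "norm (P b) = \<bar>b \<bullet> e\<bar> powr (Re s - 1) * norm (W b)" for b
    by (simp add: P_def norm_mult norm_cpow)
  have PW: "P b \<noteq> 0 \<Longrightarrow> W b \<noteq> 0" for b by (auto simp: P_def)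
  have intP: "integrable lborel (\<lambda>b. norm (P b) * indicator S b)" using int by (simp add: nP)
  have ie: "e \<bullet> e = 1" using e by simp
  have dile: "dil e t b \<bullet> e = t * (b \<bullet> e)" for t b using e by (simp add: dil_inner)
  have bnd: "integrable lborel (\<lambda>b. P b * k b)"
    if [measurable]: "k \<in> borel_measurable borel"
      and K: "\<And>b. W b \<noteq> 0 \<Longrightarrow> norm (k b) \<le> K * indicator S b" for k K
  proof (rule Bochner_Integration.integrable_bound)
    show "integrable lborel (\<lambda>b. K * (norm (P b) * indicator S b))" using intP by simp
    show "AE b in lborel. norm (P b * k b) \<le> norm (K * (norm (P b) * indicator S b))"
    proof (rule AE_I2)
      fix b :: 'a
      show "norm (P b * k b) \<le> norm (K * (norm (P b) * indicator S b))"
      proof (cases "P b = 0")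
        case False
        have "norm (P b * k b) \<le> norm (P b) * (K * indicator S b)"
          unfolding norm_mult by (intro mult_left_mono K[OF PW[OF False]]) simp
        also have "\<dots> \<le> norm (K * (norm (P b) * indicator S b))" by (simp add: mult_ac)
        finally show ?thesis .
      qed simp
    qed
  qed measurable
  have M0: "M \<ge> 0" if "W b \<noteq> 0" for b using M[OF that] norm_ge_zero[of "h b"] by linarith
  have inth: "integrable lborel (\<lambda>b. P b * h b)"
    by (rule bnd[where K=M]) (use M supp in \<open>auto simp: indicator_def\<close>)
  have dilm [measurable]: "dil e t \<in> borel_measurable borel" for t
    by (intro borel_measurable_continuous_onI continuous_intros)
  \<comment> \<open>The factors decrease to 1 from above. Dilation by a factor of at least 1 keeps
    the complement of S invariant, so all difference quotients are supported in S.\<close>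
  define \<tau> where "\<tau> n = 1 + 1 / (real n + 1)" for n
  have \<tau>1: "\<tau> n > 1" for n by (simp add: \<tau>_def)
  have d0: "(\<lambda>n. \<tau> n - 1) \<longlonglongrightarrow> 0" unfolding \<tau>_def using LIMSEQ_inverse_real_of_nat by (simp add: inverse_eq_divide add.commute)
  then have \<tau>lim: "\<tau> \<longlonglongrightarrow> 1" by (simp add: LIM_zero_iff)
  have line: "((\<lambda>t. h (dil e t b)) has_vector_derivative (b \<bullet> e) *\<^sub>R h1 (dil e t b)) (at t)" for b t
  proof -
    have "((\<lambda>t. (t - 1) * (b \<bullet> e)) has_vector_derivative (b \<bullet> e)) (at t)"
      by (auto intro!: derivative_eq_intros)
    from vector_diff_chain_at[OF this der] show ?thesis unfolding dil_def o_def .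
  qed
  have lip: "norm (h (dil e (\<tau> n) b) - h b) \<le> (\<tau> n - 1) * (\<bar>b \<bullet> e\<bar> * M)" if W: "W b \<noteq> 0" for n b
  proof -
    have "norm (h (dil e (\<tau> n) b) - h (dil e 1 b)) \<le> (\<bar>b \<bullet> e\<bar> * M) * norm (\<tau> n - 1)"
    proof (rule differentiable_bound[where S="{1..\<tau> n}" and f'="\<lambda>t x. x *\<^sub>R ((b \<bullet> e) *\<^sub>R h1 (dil e t b))"])
      fix t assume t: "t \<in> {1..\<tau> n}"
      show "((\<lambda>t. h (dil e t b)) has_derivative (\<lambda>x. x *\<^sub>R ((b \<bullet> e) *\<^sub>R h1 (dil e t b)))) (at t within {1..\<tau> n})"
        using line[of b t] unfolding has_vector_derivative_def by (rule has_derivative_at_withinI)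
      have "norm (h1 (dil e t b)) \<le> M" using M[of "dil e t b"] Wdil[of t b] W t by auto
      then have *: "\<bar>b \<bullet> e\<bar> * norm (h1 (dil e t b)) \<le> \<bar>b \<bullet> e\<bar> * M" by (rule mult_left_mono) simp
      show "onorm (\<lambda>x. x *\<^sub>R ((b \<bullet> e) *\<^sub>R h1 (dil e t b))) \<le> \<bar>b \<bullet> e\<bar> * M"
      proof (rule onorm_le)
        fix x :: real
        have "norm (x *\<^sub>R ((b \<bullet> e) *\<^sub>R h1 (dil e t b))) = (\<bar>b \<bullet> e\<bar> * norm (h1 (dil e t b))) * norm x"
          by (simp add: abs_mult mult_ac)
        also have "\<dots> \<le> (\<bar>b \<bullet> e\<bar> * M) * norm x" using * by (rule mult_right_mono) simp
        finally show "norm (x *\<^sub>R ((b \<bullet> e) *\<^sub>R h1 (dil e t b))) \<le> (\<bar>b \<bullet> e\<bar> * M) * norm x" .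
      qed
    qed (use \<tau>1[of n] in auto)
    then show ?thesis using \<tau>1[of n] by (simp add: mult.commute)
  qed
  \<comment> \<open>P is homogeneous of degree s - 1 in b \<bullet> e and the dilation has Jacobian
    \<tau>, so a change of variables moves the dilation off h at the price of \<tau> powr
    (-s).\<close>
  have Ih: "(\<integral>b. P b * h (dil e (\<tau> n) b) \<partial>lborel) = cpow (\<tau> n) (- s) * (\<integral>b. P b * h b \<partial>lborel)"
    and inthd: "integrable lborel (\<lambda>b. P b * h (dil e (\<tau> n) b))" for n
  proof -
    have t: "\<tau> n > 0" using \<tau>1[of n] by linarith
    have Pd: "P (dil e (\<tau> n) b) = cpow (\<tau> n) (s - 1) * P b" for b
    proof -
      have "cpow \<bar>\<tau> n * (b \<bullet> e)\<bar> (s - 1) = cpow (\<tau> n) (s - 1) * cpow \<bar>b \<bullet> e\<bar> (s - 1)"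
        using cpow_mult[of "\<tau> n" "\<bar>b \<bullet> e\<bar>" "s - 1"] t by (simp add: abs_mult)
      then show ?thesis using t by (simp add: P_def dile Wdil)
    qed
    have c: "cpow (\<tau> n) (s - 1) \<noteq> 0" using t by (simp add: powr_def)
    have "integrable lborel (\<lambda>b. cpow (\<tau> n) (s - 1) * (P b * h (dil e (\<tau> n) b)))"
      using inth lborel_integral_dil(2)[OF e, of "\<tau> n" "\<lambda>b. P b * h b"] t by (simp add: Pd mult.assoc)
    from integrable_mult_right[OF this, of "inverse (cpow (\<tau> n) (s - 1))"]
    show "integrable lborel (\<lambda>b. P b * h (dil e (\<tau> n) b))"
      unfolding mult.assoc[symmetric, of "inverse _"] left_inverse[OF c] by simp
    have "(\<integral>b. P b * h b \<partial>lborel) = \<tau> n *\<^sub>R (\<integral>b. P (dil e (\<tau> n) b) * h (dil e (\<tau> n) b) \<partial>lborel)"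
      using lborel_integral_dil(1)[OF e, of "\<tau> n" "\<lambda>b. P b * h b"] t by simp
    also have "\<dots> = (cpow (\<tau> n) 1 * cpow (\<tau> n) (s - 1)) * (\<integral>b. P b * h (dil e (\<tau> n) b) \<partial>lborel)"
      using t by (simp add: Pd mult.assoc scaleR_conv_of_real)
    also have "cpow (\<tau> n) 1 * cpow (\<tau> n) (s - 1) = cpow (\<tau> n) s" unfolding powr_add[symmetric] by simp
    finally have "cpow (\<tau> n) (- s) * (\<integral>b. P b * h b \<partial>lborel) =
        (cpow (\<tau> n) (- s) * cpow (\<tau> n) s) * (\<integral>b. P b * h (dil e (\<tau> n) b) \<partial>lborel)" by simp
    also have "cpow (\<tau> n) (- s) * cpow (\<tau> n) s = 1" using t by (simp add: powr_add[symmetric])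
    finally show "(\<integral>b. P b * h (dil e (\<tau> n) b) \<partial>lborel) = cpow (\<tau> n) (- s) * (\<integral>b. P b * h b \<partial>lborel)" by simp
  qed
  \<comment> \<open>Difference quotients of the preceding identity at dilation factor 1. Their
    limits are the integral with the radial derivative on one side and -s times the integral of P h
    on the other: integration by parts without boundary terms.\<close>
  define F where "F n b = P b * ((h (dil e (\<tau> n) b) - h b) /\<^sub>R (\<tau> n - 1))" for n b
  have "(\<lambda>n. \<integral>b. F n b \<partial>lborel) \<longlonglongrightarrow> (\<integral>b. P b * ((b \<bullet> e) *\<^sub>R h1 b) \<partial>lborel)"
  proof (rule integral_dominated_convergence[where w="\<lambda>b. (B * M) * (norm (P b) * indicator S b)"])
    show "integrable lborel (\<lambda>b. (B * M) * (norm (P b) * indicator S b))" using intP by simp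
    show "AE b in lborel. (\<lambda>n. F n b) \<longlonglongrightarrow> P b * ((b \<bullet> e) *\<^sub>R h1 b)"
    proof (rule AE_I2)
      fix b
      have "(\<lambda>n. (h (dil e (1 + (\<tau> n - 1)) b) - h (dil e 1 b)) /\<^sub>R (\<tau> n - 1)) \<longlonglongrightarrow> (b \<bullet> e) *\<^sub>R h1 (dil e 1 b)"
        by (rule has_vector_derivative_sequence[OF line _ d0]) (use \<tau>1 in \<open>auto simp: less_imp_neq[symmetric]\<close>)
      then show "(\<lambda>n. F n b) \<longlonglongrightarrow> P b * ((b \<bullet> e) *\<^sub>R h1 b)"
        unfolding F_def by (intro tendsto_mult_left) simp
    qed
    show "AE b in lborel. norm (F n b) \<le> (B * M) * (norm (P b) * indicator S b)" for n
    proof (rule AE_I2)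
      fix b
      show "norm (F n b) \<le> (B * M) * (norm (P b) * indicator S b)"
      proof (cases "P b = 0")
        case True then show ?thesis by (simp add: F_def)
      next
        case False
        then have W: "W b \<noteq> 0" by (rule PW)
        show ?thesis
        proof (cases "b \<in> S")
          case True
          have "norm (h (dil e (\<tau> n) b) - h b) / (\<tau> n - 1) \<le> \<bar>b \<bullet> e\<bar> * M"
            using lip[OF W, of n] \<tau>1[of n] by (simp add: field_simps)
          also have "\<dots> \<le> B * M" using Sbd[OF True] M0[OF W] by (rule mult_right_mono)
          finally have "norm (P b) * (norm (h (dil e (\<tau> n) b) - h b) / (\<tau> n - 1)) \<le> norm (P b) * (B * M)"
            by (rule mult_left_mono) simp
          then show ?thesis using True \<tau>1[of n] by (simp add: F_def norm_mult divide_inverse mult_ac)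
        next
          case False
          have "dil e (\<tau> n) b \<notin> S" using Sexp[OF False] \<tau>1[of n] by simp
          moreover have "W (dil e (\<tau> n) b) \<noteq> 0" using W Wdil[of "\<tau> n" b] \<tau>1[of n] by simp
          ultimately have "h (dil e (\<tau> n) b) = 0" using supp by blast
          then show ?thesis using supp[OF W False] False by (simp add: F_def)
        qed
      qed
    qed
  qed (simp_all add: F_def)
  moreover have "(\<integral>b. F n b \<partial>lborel) = ((cpow (\<tau> n) (- s) - 1) / complex_of_real (\<tau> n - 1)) * (\<integral>b. P b * h b \<partial>lborel)" for n
  proof -
    have "F n b = (P b * h (dil e (\<tau> n) b) - P b * h b) / complex_of_real (\<tau> n - 1)" for b
      by (simp add: F_def scaleR_conv_of_real field_simps)
    then have "(\<integral>b. F n b \<partial>lborel) = ((\<integral>b. P b * h (dil e (\<tau> n) b) \<partial>lborel) - (\<integral>b. P b * h b \<partial>lborel)) / complex_of_real (\<tau> n - 1)"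
      using inth inthd[of n] by simp
    then show ?thesis by (simp add: Ih field_simps)
  qed
  moreover have "(\<lambda>n. ((cpow (\<tau> n) (- s) - 1) / complex_of_real (\<tau> n - 1)) * (\<integral>b. P b * h b \<partial>lborel)) \<longlonglongrightarrow>
      (- s) * (\<integral>b. P b * h b \<partial>lborel)"
    by (intro tendsto_mult_right cpow_deriv_sequence \<tau>lim) (use \<tau>1 in \<open>auto simp: less_imp_neq[symmetric]\<close>)
  ultimately have J: "(\<integral>b. P b * ((b \<bullet> e) *\<^sub>R h1 b) \<partial>lborel) = (- s) * (\<integral>b. P b * h b \<partial>lborel)"
    using LIMSEQ_unique by fastforce
  have i1: "integrable lborel (\<lambda>b. P b * ((b \<bullet> e) *\<^sub>R h1 b))"
  proof (rule bnd[where K="B * M"])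
    fix b assume W: "W b \<noteq> 0"
    show "norm ((b \<bullet> e) *\<^sub>R h1 b) \<le> B * M * indicator S b"
      using supp[OF W] M[OF W] Sbd[of b] by (cases "b \<in> S") (auto intro!: mult_mono)
  qed measurable
  let ?fl = "dil e (-1)"
  have Pf: "P (?fl b) = P b" for b by (simp add: P_def dile Wdil)
  \<comment> \<open>P is even and b \<bullet> e odd under the reflection. Averaging with the mirror
    image leaves h1 b - h1 (dil e (-1) b), which equals another factor b \<bullet> e times 2 * h2
    b.\<close>
  have J': "(\<integral>b. P b * ((b \<bullet> e) *\<^sub>R h1 b) \<partial>lborel) = - (\<integral>b. P b * ((b \<bullet> e) *\<^sub>R h1 (?fl b)) \<partial>lborel)"
    by (subst lborel_integral_dil(1)[OF e, of "-1"]) (simp_all add: Pf dile)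
  have i2: "integrable lborel (\<lambda>b. P b * ((b \<bullet> e) *\<^sub>R h1 (?fl b)))"
    using i1 lborel_integral_dil(2)[OF e, of "-1" "\<lambda>b. P b * ((b \<bullet> e) *\<^sub>R h1 b)"] by (simp add: Pf dile)
  have "2 * (\<integral>b. P b * ((b \<bullet> e) *\<^sub>R h1 b) \<partial>lborel) =
      (\<integral>b. P b * ((b \<bullet> e) *\<^sub>R h1 b) - P b * ((b \<bullet> e) *\<^sub>R h1 (?fl b)) \<partial>lborel)"
    using J' i1 i2 by (simp add: Bochner_Integration.integral_diff)
  also have "\<dots> = (\<integral>b. 2 * (cpow \<bar>b \<bullet> e\<bar> (s + 1) * W b * h2 b) \<partial>lborel)"
  proof (rule Bochner_Integration.integral_cong)
    fix b :: 'a
    show "P b * ((b \<bullet> e) *\<^sub>R h1 b) - P b * ((b \<bullet> e) *\<^sub>R h1 (?fl b)) = 2 * (cpow \<bar>b \<bullet> e\<bar> (s + 1) * W b * h2 b)"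
    proof (cases "W b = 0")
      case False
      have "P b * ((b \<bullet> e) *\<^sub>R h1 b) - P b * ((b \<bullet> e) *\<^sub>R h1 (?fl b)) = P b * ((b \<bullet> e) *\<^sub>R (h1 b - h1 (?fl b)))"
        by (simp add: scaleR_diff_right right_diff_distrib)
      also have "\<dots> = P b * ((b \<bullet> e) *\<^sub>R (2 * (b \<bullet> e)) *\<^sub>R h2 b)" by (simp add: h2[OF False])
      also have "\<dots> = 2 * ((cpow \<bar>b \<bullet> e\<bar> (s - 1) * (complex_of_real (b \<bullet> e))\<^sup>2) * W b * h2 b)"
        by (simp add: P_def scaleR_conv_of_real power2_eq_square mult_ac)
      also have "\<dots> = 2 * (cpow \<bar>b \<bullet> e\<bar> (s + 1) * W b * h2 b)"
        using cpow_plus_2[of "b \<bullet> e" "s - 1"] by (simp add: add.commute)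
      finally show ?thesis .
    qed (simp add: P_def)
  qed simp
  finally have "(\<integral>b. P b * ((b \<bullet> e) *\<^sub>R h1 b) \<partial>lborel) = (\<integral>b. cpow \<bar>b \<bullet> e\<bar> (s + 1) * W b * h2 b \<partial>lborel)"
    by simp
  then show ?thesis using J by (simp add: P_def)
qed

section \<open>Weights homogeneous in several coordinates\<close>

lemma Pair_zero_Basis: "e \<in> Basis \<Longrightarrow> (0, e) \<in> Basis"
  by (simp add: Basis_prod_def)

lemma nn_integral_abs_powr_finite:
  assumes a: "a > -1"
  shows "(\<integral>\<^sup>+t. ennreal (\<bar>t\<bar> powr a) * indicator {-B..B} t \<partial>lborel) < \<infinity>"
proof (cases "B \<ge> 0")
  case True
  define g where "g t = (if t \<in> {0..B} then t powr a else 0)" for t :: real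
  have [measurable]: "g \<in> borel_measurable borel" unfolding g_def by measurable
  obtain I where "((\<lambda>x. x powr a) has_integral I) {0..B}"
    using integrable_on_powr_from_0[OF a True] by (auto simp: integrable_on_def)
  then have gI: "(g has_integral I) UNIV"
    unfolding g_def[abs_def] by (subst has_integral_restrict_UNIV)
  have I: "(\<integral>\<^sup>+t. ennreal (g t) \<partial>lborel) = ennreal I"
    by (rule nn_integral_has_integral_lborel[OF _ _ gI]) (simp_all add: g_def)
  have "(\<integral>\<^sup>+t. ennreal (\<bar>t\<bar> powr a) * indicator {-B..B} t \<partial>lborel) \<le> (\<integral>\<^sup>+t. ennreal (g t) + ennreal (g (0 - t)) \<partial>lborel)"
    by (intro nn_integral_mono) (auto simp: g_def indicator_def ennreal_plus[symmetric] simp del: ennreal_plus)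
  also have "\<dots> = (\<integral>\<^sup>+t. ennreal (g t) \<partial>lborel) + (\<integral>\<^sup>+t. ennreal (g (0 - t)) \<partial>lborel)"
    by (rule nn_integral_add) measurable
  also have "(\<integral>\<^sup>+t. ennreal (g (0 - t)) \<partial>lborel) = (\<integral>\<^sup>+t. ennreal (g t) \<partial>lborel)"
    by (rule nn_integral_lborel_shift(2)) measurable
  finally show ?thesis by (auto simp: I intro: le_less_trans)
qed simp

text \<open>D contains the coordinates with singular powers, \<open>low\<close> is a cut-off that
  ignores them, and B is the half-side of a cube containing the relevant supports. In the
  application D consists of the diagonal entries and \<open>low\<close> confines the dummy entries
  below the diagonal.\<close>

locale radial_weight =
  fixes D :: "'b::euclidean_space set" and low :: "'b \<Rightarrow> real" and B :: real
  assumes D: "D \<subseteq> Basis"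
    and low_measurable [measurable]: "low \<in> borel_measurable borel"
    and low_range: "0 \<le> low b" "low b \<le> 1"
    and low_shift: "e \<in> D \<Longrightarrow> low (b + t *\<^sub>R e) = low b"
begin

definition cube :: "'b set" where
  "cube = {b. \<forall>e\<in>Basis. \<bar>b \<bullet> e\<bar> \<le> B}"

text \<open>Exponents are s - 1, so that Re s > 0 is the condition of convergence and s/2 the
  natural argument of Gamma.\<close>

definition wt :: "('b \<Rightarrow> complex) \<Rightarrow> 'b \<Rightarrow> complex" where
  "wt s b = (\<Prod>e\<in>D. cpow \<bar>b \<bullet> e\<bar> (s e - 1)) * complex_of_real (low b)"

text \<open>Support is tested only where \<open>low\<close> is nonzero: the function used later
  ignores the entries below the diagonal and cannot vanish for large values of these.\<close>

definition supp_in :: "('p \<times> 'b \<Rightarrow> complex) \<Rightarrow> 'p \<Rightarrow> bool" where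
  "supp_in f p \<longleftrightarrow> (\<forall>b. low b \<noteq> 0 \<longrightarrow> b \<notin> cube \<longrightarrow> f (p, b) = 0)"

lemma finite_D: "finite D"
  using D finite_Basis finite_subset by blast

lemma low_dil: "e \<in> D \<Longrightarrow> low (dil e t b) = low b"
  unfolding dil_def by (rule low_shift)

lemma cube_cbox: "cube = cbox (- (\<Sum>e\<in>Basis. B *\<^sub>R e)) (\<Sum>e\<in>Basis. B *\<^sub>R e)"
  by (auto simp: cube_def mem_box inner_sum_left_Basis abs_le_iff minus_le_iff)

lemma compact_cube: "compact cube"
  by (simp add: cube_cbox)

lemma cube_borel [measurable]: "cube \<in> sets borel"
  by (intro borel_closed compact_imp_closed compact_cube)

lemma wt_measurable [measurable]: "wt s \<in> borel_measurable borel"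
  unfolding wt_def by measurable

lemma norm_wt: "norm (wt s b) = (\<Prod>e\<in>D. \<bar>b \<bullet> e\<bar> powr (Re (s e) - 1)) * low b"
  using low_range by (simp add: wt_def norm_mult prod_norm[symmetric] norm_cpow)

text \<open>On the cube the weight is dominated by a product of functions of one coordinate each,
  and |t| powr a is integrable on bounded intervals for a > -1.\<close>

lemma wt_integrable:
  assumes s: "\<And>e. e \<in> D \<Longrightarrow> Re (s e) > 0"
  shows "integrable lborel (\<lambda>b. norm (wt s b) * indicator cube b)"
proof (rule integrableI_bounded)
  let ?f = "\<lambda>e t. ennreal (if e \<in> D then \<bar>t\<bar> powr (Re (s e) - 1) else 1) * indicator {-B..B} t"
  have "(\<integral>\<^sup>+b. ennreal (norm (norm (wt s b) * indicator cube b)) \<partial>lborel) \<le> (\<integral>\<^sup>+b. (\<Prod>e\<in>Basis. ?f e (b \<bullet> e)) \<partial>lborel)"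
  proof (rule nn_integral_mono)
    fix b
    show "ennreal (norm (norm (wt s b) * indicator cube b)) \<le> (\<Prod>e\<in>Basis. ?f e (b \<bullet> e))"
    proof (cases "b \<in> cube")
      case True
      have "(\<Prod>e\<in>D. \<bar>b \<bullet> e\<bar> powr (Re (s e) - 1)) * low b \<le> (\<Prod>e\<in>D. \<bar>b \<bullet> e\<bar> powr (Re (s e) - 1)) * 1"
        by (intro mult_left_mono low_range prod_nonneg) simp
      also have "\<dots> = (\<Prod>e\<in>Basis. if e \<in> D then \<bar>b \<bullet> e\<bar> powr (Re (s e) - 1) else 1)"
        using D by (simp add: prod.If_cases Int_absorb1)
      finally have "ennreal (norm (norm (wt s b) * indicator cube b)) \<le>
          ennreal (\<Prod>e\<in>Basis. if e \<in> D then \<bar>b \<bullet> e\<bar> powr (Re (s e) - 1) else 1)"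
        using True by (intro ennreal_leI) (simp add: norm_wt prod_nonneg low_range abs_mult)
      also have "\<dots> = (\<Prod>e\<in>Basis. ?f e (b \<bullet> e))"
      proof (subst prod_ennreal[symmetric])
        show "(\<Prod>e\<in>Basis. ennreal (if e \<in> D then \<bar>b \<bullet> e\<bar> powr (Re (s e) - 1) else 1)) = (\<Prod>e\<in>Basis. ?f e (b \<bullet> e))"
          using True by (intro prod.cong refl) (auto simp: cube_def indicator_def abs_le_iff minus_le_iff)
      qed auto
      finally show ?thesis .
    qed simp
  qed
  also have "\<dots> = (\<Prod>e\<in>Basis. (\<integral>\<^sup>+t. ?f e t \<partial>lborel))"
    by (rule nn_integral_lborel_prod) auto
  also have "\<dots> < \<infinity>"
  proof -
    have "(\<integral>\<^sup>+t. ?f e t \<partial>lborel) < \<infinity>" for e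
    proof (cases "e \<in> D")
      case True
      then show ?thesis using nn_integral_abs_powr_finite[of "Re (s e) - 1" B] s[OF True] by simp
    next
      case False
      then show ?thesis by (simp add: emeasure_lborel_Icc_eq)
    qed
    then have "(\<integral>\<^sup>+t. ?f e t \<partial>lborel) \<noteq> top" for e by (simp add: less_top)
    then show ?thesis unfolding infinity_ennreal_def less_top[symmetric] ennreal_prod_eq_top by blast
  qed
  finally show "(\<integral>\<^sup>+b. ennreal (norm (norm (wt s b) * indicator cube b)) \<partial>lborel) < \<infinity>" .
qed measurable

text \<open>Moving along e leaves \<open>low\<close> unchanged, and the complement of the cube is
  open, so f vanishes on a whole segment around the point.\<close>

lemma supp_in_par:
  fixes f :: "'p::euclidean_space \<times> 'b \<Rightarrow> complex"
  assumes f: "higher_differentiable_on UNIV f (Suc r)" and supp: "supp_in f p" and e: "e \<in> D"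
  shows "supp_in (par (0, e) f) p"
  unfolding supp_in_def
proof (intro allI impI)
  fix b assume b: "low b \<noteq> 0" "b \<notin> cube"
  let ?U = "(\<lambda>t. b + t *\<^sub>R e) -` (- cube)"
  have oU: "open ?U"
    by (intro open_vimage continuous_intros) (simp add: open_Compl compact_imp_closed compact_cube)
  have U0: "0 \<in> ?U" using b by simp
  have eq: "0 = f ((p, b) + t *\<^sub>R (0, e))" if "t \<in> ?U" for t
    using that supp b low_shift[OF e, of b t] by (simp add: supp_in_def)
  have "((\<lambda>t. f ((p, b) + t *\<^sub>R (0, e))) has_vector_derivative 0) (at 0)"
    by (rule has_vector_derivative_transform_within_open[OF has_vector_derivative_const oU U0 eq])
  moreover have "((\<lambda>t. f ((p, b) + t *\<^sub>R (0, e))) has_vector_derivative par (0, e) f ((p, b) + 0 *\<^sub>R (0, e))) (at 0)"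
    by (rule par_has_vector_derivative[OF f])
  ultimately show "par (0, e) f (p, b) = 0"
    using vector_derivative_unique_at by fastforce
qed

lemma dil_Pair: "dil (0, e) t (p, b) = (p, dil e t b)"
  by (simp add: dil_def)

lemma dil_cube: "e \<in> Basis \<Longrightarrow> \<bar>t\<bar> \<ge> 1 \<Longrightarrow> dil e t b \<in> cube \<Longrightarrow> b \<in> cube"
  unfolding cube_def
proof (intro CollectI ballI)
  fix e' :: 'b assume *: "e \<in> Basis" "\<bar>t\<bar> \<ge> 1" "dil e t b \<in> {b. \<forall>e\<in>Basis. \<bar>b \<bullet> e\<bar> \<le> B}" "e' \<in> Basis"
  then have "\<bar>dil e t b \<bullet> e'\<bar> \<le> B" by blast
  moreover have "\<bar>b \<bullet> e'\<bar> \<le> \<bar>dil e t b \<bullet> e'\<bar>"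
    using * by (auto simp: dil_inner abs_mult mult_le_cancel_right1)
  ultimately show "\<bar>b \<bullet> e'\<bar> \<le> B" by linarith
qed

text \<open>For b \<bullet> e nonzero, \<open>hadm_eq\<close> expresses the value by first
  derivatives at b and its reflection, both outside the cube. For b \<bullet> e = 0 every dilation
  fixes b, and the integrand is the second derivative there, which vanishes as well.\<close>

lemma supp_in_hadm:
  fixes f :: "'p::euclidean_space \<times> 'b \<Rightarrow> complex"
  assumes f: "higher_differentiable_on UNIV f (Suc (Suc r))" and supp: "supp_in f p" and e: "e \<in> D"
  shows "supp_in (hadm (0, e) f) p"
  unfolding supp_in_def
proof (intro allI impI)
  fix b assume b: "low b \<noteq> 0" "b \<notin> cube"
  have eB: "e \<in> Basis" "(0, e) \<in> (Basis :: ('p \<times> 'b) set)" using e D by (auto intro: Pair_zero_Basis)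
  have f1: "higher_differentiable_on UNIV (par (0, e) f) (Suc r)" by (rule higher_differentiable_on_par[OF f])
  have f2: "higher_differentiable_on UNIV f 2" by (rule higher_differentiable_on_le[OF f]) simp
  have s1: "supp_in (par (0, e) f) p" by (rule supp_in_par[OF f supp e])
  have s2: "supp_in (par (0, e) (par (0, e) f)) p" by (rule supp_in_par[OF f1 s1 e])
  show "hadm (0, e) f (p, b) = 0"
  proof (cases "b \<bullet> e = 0")
    case True
    then have "dil (0, e) t (p, b) = (p, b)" for t by (simp add: dil_def)
    then show ?thesis using s2 b by (simp add: hadm_def supp_in_def)
  next
    case False
    have "dil e (-1) b \<notin> cube" using dil_cube[OF eB(1), of "-1" b] b by auto
    then have "par (0, e) f (dil (0, e) (-1) (p, b)) = 0"
      using s1 b low_dil[OF e] by (simp add: dil_Pair supp_in_def)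
    moreover have "par (0, e) f (p, b) = 0" using s1 b by (simp add: supp_in_def)
    ultimately show ?thesis using hadm_eq[OF eB(2) f2, of "(p, b)"] False by simp
  qed
qed

lemma integral_wt_step:
  fixes f :: "'p::euclidean_space \<times> 'b \<Rightarrow> complex"
  assumes f: "higher_differentiable_on UNIV f (Suc (Suc r))" and supp: "supp_in f p" and e0: "e0 \<in> D"
    and s: "\<And>e. e \<in> D \<Longrightarrow> Re (s e) > 0"
  shows "s e0 * (\<integral>b. wt s b * f (p, b) \<partial>lborel) =
    - (\<integral>b. wt (s(e0 := s e0 + 2)) b * hadm (0, e0) f (p, b) \<partial>lborel)"
proof -
  define W where "W b = (\<Prod>e\<in>D - {e0}. cpow \<bar>b \<bullet> e\<bar> (s e - 1)) * complex_of_real (low b)" for b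
  have wts: "wt s b = cpow \<bar>b \<bullet> e0\<bar> (s e0 - 1) * W b" for b
    unfolding wt_def W_def by (subst prod.remove[OF finite_D e0]) (simp add: mult.assoc)
  have wts': "wt (s(e0 := s e0 + 2)) b = cpow \<bar>b \<bullet> e0\<bar> (s e0 + 1) * W b" for b
  proof -
    have "(\<Prod>e\<in>D - {e0}. cpow \<bar>b \<bullet> e\<bar> ((s(e0 := s e0 + 2)) e - 1)) = (\<Prod>e\<in>D - {e0}. cpow \<bar>b \<bullet> e\<bar> (s e - 1))"
      by (rule prod.cong) auto
    then show ?thesis
      unfolding wt_def W_def by (subst prod.remove[OF finite_D e0]) (simp add: mult.assoc add.commute)
  qed
  have e: "e0 \<in> Basis" "(0, e0) \<in> (Basis :: ('p \<times> 'b) set)" using e0 D by (auto intro: Pair_zero_Basis)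
  have f1: "higher_differentiable_on UNIV (par (0, e0) f) (Suc r)" by (rule higher_differentiable_on_par[OF f])
  have f2: "higher_differentiable_on UNIV f 2" by (rule higher_differentiable_on_le[OF f]) simp
  have cf: "continuous_on UNIV (\<lambda>b. f (p, b))"
    by (rule continuous_on_compose2[OF higher_differentiable_on_imp_continuous_on[OF f]]) (auto intro!: continuous_intros)
  have cf1: "continuous_on UNIV (\<lambda>b. par (0, e0) f (p, b))"
    by (rule continuous_on_compose2[OF higher_differentiable_on_imp_continuous_on[OF f1]]) (auto intro!: continuous_intros)
  have s1: "supp_in (par (0, e0) f) p" by (rule supp_in_par[OF f supp e0])
  have Wlow: "W b \<noteq> 0 \<Longrightarrow> low b \<noteq> 0" for b by (auto simp: W_def)
  have z: "f (p, b) = 0 \<and> par (0, e0) f (p, b) = 0" if "W b \<noteq> 0" "b \<notin> cube" for b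
    using that Wlow supp s1 by (auto simp: supp_in_def)
  have "bounded ((\<lambda>b. f (p, b)) ` cube)" "bounded ((\<lambda>b. par (0, e0) f (p, b)) ` cube)"
    by (intro compact_imp_bounded compact_continuous_image compact_cube continuous_on_subset[OF cf] continuous_on_subset[OF cf1] subset_UNIV)+
  then obtain M1 M2 where M12: "\<And>b. b \<in> cube \<Longrightarrow> norm (f (p, b)) \<le> M1" "\<And>b. b \<in> cube \<Longrightarrow> norm (par (0, e0) f (p, b)) \<le> M2"
    unfolding bounded_iff by blast
  define M where "M = max 0 (max M1 M2)"
  have M: "norm (f (p, b)) \<le> M \<and> norm (par (0, e0) f (p, b)) \<le> M" if "W b \<noteq> 0" for b
    using M12[of b] z[OF that] by (cases "b \<in> cube") (auto simp: M_def le_max_iff_disj)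
  have [measurable]: "W \<in> borel_measurable borel" unfolding W_def by measurable
  show ?thesis
    unfolding wts wts'
  proof (rule integral_by_parts_radial[OF e(1), where S=cube and M=M and B=B and ?h1.0="\<lambda>b. par (0, e0) f (p, b)"])
    show "(\<lambda>b. f (p, b)) \<in> borel_measurable borel" "(\<lambda>b. par (0, e0) f (p, b)) \<in> borel_measurable borel"
      by (intro borel_measurable_continuous_onI cf cf1)+
    show "W (dil e0 t b) = W b" if "t \<noteq> 0" for t b
    proof -
      have "dil e0 t b \<bullet> e = b \<bullet> e" if "e \<in> D - {e0}" for e
        using that D dil_inner[OF e(1), of e t b] by auto
      then show ?thesis unfolding W_def low_dil[OF e0] by simp
    qed
    show "((\<lambda>t. f (p, b + t *\<^sub>R e0)) has_vector_derivative par (0, e0) f (p, b + t *\<^sub>R e0)) (at t)" for b t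
      using par_has_vector_derivative[OF f, of "(p, b)" "(0, e0)" t] by simp
    show "(2 * (b \<bullet> e0)) *\<^sub>R hadm (0, e0) f (p, b) = par (0, e0) f (p, b) - par (0, e0) f (p, dil e0 (-1) b)" for b
      using hadm_eq[OF e(2) f2, of "(p, b)"] by (simp add: dil_Pair)
    show "dil e0 t b \<notin> cube" if "b \<notin> cube" "t \<ge> 1" for b t
      using dil_cube[OF e(1), of t b] that by auto
    show "\<bar>b \<bullet> e0\<bar> \<le> B" if "b \<in> cube" for b using that e(1) by (simp add: cube_def)
    show "dil e0 (-1) b \<in> cube \<longleftrightarrow> b \<in> cube" for b
      using dil_cube[OF e(1), of "-1" b] dil_cube[OF e(1), of "-1" "dil e0 (-1) b"] by (auto simp: dil_dil[OF e(1)])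
    show "integrable lborel (\<lambda>b. \<bar>b \<bullet> e0\<bar> powr (Re (s e0) - 1) * norm (W b) * indicator cube b)"
      using wt_integrable[of s] s by (simp add: wts norm_mult norm_cpow)
  qed (use z M in auto)
qed

text \<open>Induction on the total number of integrations by parts, each of which costs two
  derivatives. The parameter p rides along so that f' is jointly continuous, which later yields
  bounds uniform in p on compact sets.\<close>

lemma integral_wt_shift:
  fixes f :: "'p::euclidean_space \<times> 'b \<Rightarrow> complex"
  assumes "higher_differentiable_on UNIV f (2 * (\<Sum>e\<in>D. n e))" "\<And>p. p \<in> G \<Longrightarrow> supp_in f p"
  shows "\<exists>f'. continuous_on UNIV f' \<and> (\<forall>p\<in>G. supp_in f' p) \<and>
    (\<forall>p\<in>G. \<forall>s. (\<forall>e\<in>D. Re (s e) > 0) \<longrightarrow>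
      (\<Prod>e\<in>D. pochhammer (s e / 2) (n e)) * (\<integral>b. wt s b * f (p, b) \<partial>lborel) =
      (\<integral>b. wt (\<lambda>e. s e + 2 * of_nat (n e)) b * f' (p, b) \<partial>lborel))"
  using assms
proof (induction "\<Sum>e\<in>D. n e" arbitrary: n f)
  case 0
  then have n0: "n e = 0" if "e \<in> D" for e using that finite_D by simp
  have "wt (\<lambda>e. s e + 2 * of_nat (n e)) = wt s" for s
    by (auto simp: wt_def n0 fun_eq_iff intro!: prod.cong)
  then show ?case using 0 n0
    by (intro exI[of _ f]) (auto dest: higher_differentiable_on_imp_continuous_on)
next
  case (Suc N)
  obtain e0 where e0: "e0 \<in> D" "n e0 > 0"
    using Suc.hyps(2) by (metis gr0I sum.neutral nat.simps(3))
  define n' where "n' = n(e0 := n e0 - 1)"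
  have sum: "(\<Sum>e\<in>D. n e) = Suc (\<Sum>e\<in>D. n' e)"
    using e0 by (simp add: sum.remove[OF finite_D e0(1)] n'_def)
  \<comment> \<open>The factor -1/2 absorbs the sign of \<open>integral_wt_step\<close> and turns s
    into s/2, the leading factor of the Pochhammer symbol.\<close>
  define f1 where "f1 z = (- 1 / 2) *\<^sub>R hadm (0, e0) f z" for z
  have f: "higher_differentiable_on UNIV f (Suc (Suc (2 * (\<Sum>e\<in>D. n' e))))"
    using Suc.prems(1) by (simp add: sum)
  have "(0, e0) \<in> (Basis :: ('p \<times> 'b) set)" using e0 D by (auto intro: Pair_zero_Basis)
  from higher_differentiable_on_hadm[OF this f] have f1: "higher_differentiable_on UNIV f1 (2 * (\<Sum>e\<in>D. n' e))"
    unfolding f1_def by (intro higher_differentiable_on_scaleR higher_differentiable_on_const) auto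
  have f1s: "supp_in f1 p" if "p \<in> G" for p
    using supp_in_hadm[OF f Suc.prems(2)[OF that] e0(1)] by (simp add: f1_def supp_in_def)
  have "N = (\<Sum>e\<in>D. n' e)" using Suc.hyps(2) sum by simp
  from Suc.hyps(1)[OF this f1 f1s] obtain f' where f': "continuous_on UNIV f'" "\<forall>p\<in>G. supp_in f' p"
    "\<And>p s. p \<in> G \<Longrightarrow> (\<forall>e\<in>D. Re (s e) > 0) \<Longrightarrow>
      (\<Prod>e\<in>D. pochhammer (s e / 2) (n' e)) * (\<integral>b. wt s b * f1 (p, b) \<partial>lborel) =
      (\<integral>b. wt (\<lambda>e. s e + 2 * of_nat (n' e)) b * f' (p, b) \<partial>lborel)" by blast
  have "(\<Prod>e\<in>D. pochhammer (s e / 2) (n e)) * (\<integral>b. wt s b * f (p, b) \<partial>lborel) =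
      (\<integral>b. wt (\<lambda>e. s e + 2 * of_nat (n e)) b * f' (p, b) \<partial>lborel)"
    if p: "p \<in> G" and s: "\<forall>e\<in>D. Re (s e) > 0" for p s
  proof -
    let ?s = "s(e0 := s e0 + 2)"
    have s': "\<forall>e\<in>D. Re (?s e) > 0" using s by auto
    have A: "(s e0 / 2) * (\<integral>b. wt s b * f (p, b) \<partial>lborel) = (\<integral>b. wt ?s b * f1 (p, b) \<partial>lborel)"
      using integral_wt_step[OF f Suc.prems(2)[OF p] e0(1), of s] s
      by (simp add: f1_def scaleR_conv_of_real field_simps)
    have Pm: "(\<Prod>e\<in>D. pochhammer (s e / 2) (n e)) = (\<Prod>e\<in>D. pochhammer (?s e / 2) (n' e)) * (s e0 / 2)"
    proof -
      have "pochhammer (s e0 / 2) (n e0) = (s e0 / 2) * pochhammer ((s e0 + 2) / 2) (n e0 - 1)"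
        using e0(2) pochhammer_rec[of "s e0 / 2" "n e0 - 1"] by (simp add: add_divide_distrib)
      moreover have "(\<Prod>e\<in>D - {e0}. pochhammer (s e / 2) (n e)) = (\<Prod>e\<in>D - {e0}. pochhammer (?s e / 2) (n' e))"
        by (rule prod.cong) (auto simp: n'_def)
      ultimately show ?thesis
        by (simp add: prod.remove[OF finite_D e0(1)] n'_def mult_ac)
    qed
    have "(\<Prod>e\<in>D. pochhammer (s e / 2) (n e)) * (\<integral>b. wt s b * f (p, b) \<partial>lborel) =
        (\<Prod>e\<in>D. pochhammer (?s e / 2) (n' e)) * (\<integral>b. wt ?s b * f1 (p, b) \<partial>lborel)"
      unfolding Pm mult.assoc A ..
    also have "\<dots> = (\<integral>b. wt (\<lambda>e. ?s e + 2 * of_nat (n' e)) b * f' (p, b) \<partial>lborel)"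
      by (rule f'(3)[OF p s'])
    also have "(\<lambda>e. ?s e + 2 * of_nat (n' e)) = (\<lambda>e. s e + 2 * of_nat (n e))"
      using e0(2) by (auto simp: fun_eq_iff n'_def of_nat_diff)
    finally show ?thesis .
  qed
  then show ?case using f' by blast
qed

end

section \<open>Holomorphic parameter integrals\<close>

text \<open>The Cauchy estimate converts a dominating function for f into one for its complex
  difference quotients; dominated convergence then gives the complex derivative of the
  integral.\<close>

lemma holomorphic_on_integral:
  fixes f :: "complex \<Rightarrow> 'a \<Rightarrow> complex"
  assumes S: "open S"
    and meas: "\<And>z. z \<in> S \<Longrightarrow> f z \<in> borel_measurable M"
    and hol: "\<And>x. x \<in> space M \<Longrightarrow> (\<lambda>z. f z x) holomorphic_on S"
    and dom: "\<And>w. w \<in> S \<Longrightarrow> \<exists>r>0. \<exists>G. cball w r \<subseteq> S \<and> integrable M G \<and>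
      (\<forall>z\<in>cball w r. \<forall>x\<in>space M. norm (f z x) \<le> G x)"
  shows "(\<lambda>z. \<integral>x. f z x \<partial>M) holomorphic_on S"
proof (subst holomorphic_on_open[OF S], intro ballI)
  fix w assume w: "w \<in> S"
  obtain r G where r: "r > 0" "cball w r \<subseteq> S" and G: "integrable M G"
    and bd: "\<And>z x. z \<in> cball w r \<Longrightarrow> x \<in> space M \<Longrightarrow> norm (f z x) \<le> G x"
    using dom[OF w] by blast
  define d where "d x = deriv (\<lambda>z. f z x) w" for x
  \<comment> \<open>Half the radius, so that discs of radius r/2 about points of \<open>?B\<close>
    stay where G dominates.\<close>
  let ?B = "ball w (r/2)"
  have BS: "?B \<subseteq> S" using r by auto
  have int: "integrable M (f z)" if "z \<in> cball w r" for z
    by (rule Bochner_Integration.integrable_bound[OF G]) (use that r bd meas in \<open>auto intro!: AE_I2 order.trans[OF bd]\<close>)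
  have lip: "norm ((f z x - f w x) / (z - w)) \<le> 2 / r * G x" if z: "z \<in> ?B" "z \<noteq> w" and x: "x \<in> space M" for z x
  proof -
    have "norm (f z x - f w x) \<le> (2 / r * G x) * norm (z - w)"
    proof (rule field_differentiable_bound[of ?B _ "deriv (\<lambda>z. f z x)"])
      fix y assume y: "y \<in> ?B"
      then have yS: "y \<in> S" using BS by blast
      show "((\<lambda>z. f z x) has_field_derivative deriv (\<lambda>z. f z x) y) (at y within ?B)"
        using holomorphic_derivI[OF hol[OF x] S yS] by (rule has_field_derivative_at_within)
      have sub: "cball y (r/2) \<subseteq> cball w r"
      proof
        fix a assume "a \<in> cball y (r/2)"
        then show "a \<in> cball w r" using y dist_triangle[of w a y] by (auto simp: dist_commute)
      qed
      have "norm ((deriv ^^ 1) (\<lambda>z. f z x) y) \<le> fact 1 * G x / (r/2) ^ 1"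
      proof (rule Cauchy_inequality)
        show "(\<lambda>z. f z x) holomorphic_on ball y (r/2)"
          by (rule holomorphic_on_subset[OF hol[OF x]]) (use sub r ball_subset_cball in blast)
        show "continuous_on (cball y (r/2)) (\<lambda>z. f z x)"
          by (rule continuous_on_subset[OF holomorphic_on_imp_continuous_on[OF hol[OF x]]]) (use sub r in blast)
        show "norm (f a x) \<le> G x" if "norm (y - a) = r/2" for a
          using sub that x by (intro bd) (auto simp: dist_norm)
      qed (use r in simp)
      then show "norm (deriv (\<lambda>z. f z x) y) \<le> 2 / r * G x" by (simp add: field_simps)
    qed (use z r in auto)
    then show ?thesis using z by (simp add: norm_divide divide_le_eq)
  qed
  have lim: "((\<lambda>z. (f z x - f w x) / (z - w)) \<longlongrightarrow> d x) (at w)" if "x \<in> space M" for x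
    using holomorphic_derivI[OF hol[OF that] S w] unfolding d_def has_field_derivative_iff .
  have seq: "(\<lambda>n. ((\<integral>x. f (X n) x \<partial>M) - (\<integral>x. f w x \<partial>M)) / (X n - w)) \<longlonglongrightarrow> (\<integral>x. d x \<partial>M)"
    if X: "\<And>n. X n \<in> ?B - {w}" "X \<longlonglongrightarrow> w" for X
  proof -
    have fl: "filterlim X (at w) sequentially" unfolding filterlim_at using X by auto
    have ms: "(\<lambda>x. (f (X n) x - f w x) / (X n - w)) \<in> borel_measurable M" for n
      using meas[OF w] meas[of "X n"] X(1)[of n] BS by (intro borel_measurable_divide borel_measurable_diff) auto
    have ptw: "(\<lambda>n. (f (X n) x - f w x) / (X n - w)) \<longlonglongrightarrow> d x" if "x \<in> space M" for x
      by (rule filterlim_compose[OF lim[OF that] fl])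
    have "(\<lambda>n. \<integral>x. (f (X n) x - f w x) / (X n - w) \<partial>M) \<longlonglongrightarrow> (\<integral>x. d x \<partial>M)"
    proof (rule integral_dominated_convergence[where w="\<lambda>x. 2 / r * G x"])
      show "d \<in> borel_measurable M" by (rule borel_measurable_LIMSEQ_metric[OF ms ptw])
      show "AE x in M. norm ((f (X n) x - f w x) / (X n - w)) \<le> 2 / r * G x" for n
        using lip[of "X n"] X(1)[of n] by (intro AE_I2) auto
      show "AE x in M. (\<lambda>n. (f (X n) x - f w x) / (X n - w)) \<longlonglongrightarrow> d x"
        using ptw by (intro AE_I2)
    qed (use ms G in auto)
    moreover have "(\<integral>x. (f (X n) x - f w x) / (X n - w) \<partial>M) = ((\<integral>x. f (X n) x \<partial>M) - (\<integral>x. f w x \<partial>M)) / (X n - w)" for n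
      using int[of "X n"] int[of w] X(1)[of n] r by simp
    ultimately show ?thesis by (simp only:)
  qed
  have "((\<lambda>z. ((\<integral>x. f z x \<partial>M) - (\<integral>x. f w x \<partial>M)) / (z - w)) \<longlongrightarrow> (\<integral>x. d x \<partial>M)) (at w within ?B)"
    unfolding tendsto_at_iff_sequentially using seq by (auto simp: o_def)
  then have "((\<lambda>z. \<integral>x. f z x \<partial>M) has_field_derivative (\<integral>x. d x \<partial>M)) (at w)"
    unfolding has_field_derivative_iff using r at_within_open[of w ?B] by simp
  then show "\<exists>f'. ((\<lambda>z. \<integral>x. f z x \<partial>M) has_field_derivative f') (at w)" by blast
qed

text \<open>Two of the local extensions coincide with f on the part of the smaller disc inside the
  half-plane, hence on all of that disc by the identity theorem.\<close>

lemma entire_gluing: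
  fixes f :: "complex \<Rightarrow> complex" and a :: real
  assumes ext: "\<And>R. R > 0 \<Longrightarrow> \<exists>Z. Z holomorphic_on ball 0 R \<and> (\<forall>z\<in>ball 0 R. Re z > a \<longrightarrow> Z z = f z)"
  shows "\<exists>Z. Z holomorphic_on UNIV \<and> (\<forall>z. Re z > a \<longrightarrow> Z z = f z)"
proof -
  obtain Y where Y: "\<And>R. R > 0 \<Longrightarrow> Y R holomorphic_on ball 0 R"
    "\<And>R z. R > 0 \<Longrightarrow> z \<in> ball 0 R \<Longrightarrow> Re z > a \<Longrightarrow> Y R z = f z"
    using ext by metis
  \<comment> \<open>A real point inside the half-plane: discs of radius larger than b meet the
    half-plane in a nonempty open set, as the identity theorem requires.\<close>
  define b where "b = \<bar>a\<bar> + 1"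
  have b: "b > 0" "b > a" by (auto simp: b_def)
  have agree: "Y R z = Y R' z" if R: "b < R" "R \<le> R'" and z: "z \<in> ball 0 R" for R R' z
  proof -
    let ?U = "ball 0 R \<inter> {z. Re z > a}"
    have "(\<lambda>z. Y R z - Y R' z) z = 0"
    proof (rule analytic_continuation_open[of ?U "ball 0 R" "\<lambda>z. Y R z - Y R' z" "\<lambda>_. 0"])
      show "open ?U" by (intro open_Int open_halfspace_Re_gt) simp
      have "complex_of_real b \<in> ?U" using b R by simp
      then show "?U \<noteq> {}" by blast
      show "(\<lambda>z. Y R z - Y R' z) holomorphic_on ball 0 R"
        using R b by (intro holomorphic_intros holomorphic_on_subset[OF Y(1)]) auto
      show "Y R x - Y R' x = 0" if "x \<in> ?U" for x
        using that R b Y(2)[of R x] Y(2)[of R' x] by auto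
    qed (use z in auto)
    then show ?thesis by simp
  qed
  define Z where "Z z = Y (norm z + b + 1) z" for z
  have ZY: "Z z = Y R z" if "b < R" "z \<in> ball 0 R" for R z
  proof (cases "R \<le> norm z + b + 1")
    case True
    show ?thesis unfolding Z_def by (rule agree[OF that(1) True that(2), symmetric])
  next
    case False
    have "z \<in> ball 0 (norm z + b + 1)" "b < norm z + b + 1"
      using b norm_ge_zero[of z] by (simp, linarith)
    with False show ?thesis unfolding Z_def by (intro agree) simp_all
  qed
  have "Z holomorphic_on UNIV"
  proof (subst holomorphic_on_open[OF open_UNIV], intro ballI)
    fix w :: complex
    define R where "R = norm w + b + 1"
    have w: "w \<in> ball 0 R" "b < R" "R > 0" using b norm_ge_zero[of w] by (simp_all add: R_def, linarith+)
    have "(Y R has_field_derivative deriv (Y R) w) (at w)"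
      by (rule holomorphic_derivI[OF Y(1)[OF w(3)] open_ball w(1)])
    then have "(Z has_field_derivative deriv (Y R) w) (at w)"
      by (rule has_field_derivative_transform_within_open[of _ _ _ "ball 0 R"]) (use w ZY in auto)
    then show "\<exists>f'. (Z has_field_derivative f') (at w)" by blast
  qed
  moreover have "Z z = f z" if "Re z > a" for z
    unfolding Z_def using that b norm_ge_zero[of z] by (intro Y(2)) (linarith, simp, linarith)
  ultimately show ?thesis by blast
qed

section \<open>Cut-off functions around the Stiefel manifold\<close>

lemma higher_differentiable_on_orth:
  "higher_differentiable_on {x. gram x \<noteq> 0} (orth :: real^'m^'n \<Rightarrow> real^'m^'n) r"
proof -
  let ?W = "{x :: real^'m^'n. gram x \<noteq> 0}"
  have oW: "open ?W" by (intro open_Collect_neq continuous_intros)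
  define J :: "'m \<Rightarrow> real^'n \<Rightarrow> real^'m^'n" where "J j v = (\<chi> i l. if l = j then v $ i else 0)" for j v
  have linJ: "bounded_linear (J j)" for j
    unfolding linear_conv_bounded_linear[symmetric] J_def by (auto intro!: linearI simp: vec_eq_iff)
  have lc: "bounded_linear (\<lambda>x :: real^'m^'n. cols x j)" for j
    unfolding linear_conv_bounded_linear[symmetric] cols_def column_def by (auto intro!: linearI simp: vec_eq_iff)
  have nz: "gs_res (cols x) j \<noteq> 0" if "x \<in> ?W" "j < CARD('m)" for x :: "real^'m^'n" and j
  proof -
    have "j \<in> {..<CARD('m)}" using that by simp
    then obtain i :: 'm where "j = rk i" using bij_betw_rk by (metis bij_betw_def imageE)
    then show ?thesis using tri_pos[of x i] that by (auto simp: tri_def)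
  qed
  have "higher_differentiable_on ?W (\<lambda>x. \<Sum>j\<in>UNIV. J j (gs_vec (cols x) (rk j))) r"
    by (intro higher_differentiable_on_sum oW higher_differentiable_on_compose[OF oW open_UNIV
        higher_differentiable_on_linear[OF linJ open_UNIV]]
        higher_differentiable_on_gs_vec[OF oW _ nz rk_less] higher_differentiable_on_linear[OF lc oW]) auto
  moreover have "(\<Sum>j\<in>UNIV. J j (gs_vec (cols x) (rk j))) = orth x" for x :: "real^'m^'n"
    by (simp add: vec_eq_iff J_def orth_def)
  ultimately show ?thesis by simp
qed

text \<open>Only of class \<open>C\<^sup>r\<close>, which suffices.\<close>

definition bump :: "nat \<Rightarrow> real \<Rightarrow> real^'m^'n \<Rightarrow> real" where
  "bump r \<delta> x = max 0 (1 - (4 / \<delta>\<^sup>2) * ((transpose x ** x - mat 1) \<bullet> (transpose x ** x - mat 1))) ^ Suc r"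

lemma bump_nonneg: "bump r \<delta> x \<ge> 0"
  by (simp add: bump_def)

lemma bump_nz: "bump r \<delta> x \<noteq> 0 \<Longrightarrow> \<delta> > 0 \<Longrightarrow> norm (transpose x ** x - mat 1) < \<delta> / 2"
proof -
  assume *: "bump r \<delta> x \<noteq> 0" "\<delta> > 0"
  let ?n = "norm (transpose x ** x - mat 1)"
  have "1 - (4 / \<delta>\<^sup>2) * ?n\<^sup>2 > 0"
  proof (rule ccontr)
    assume "\<not> ?thesis"
    then have "max 0 (1 - (4 / \<delta>\<^sup>2) * ?n\<^sup>2) = 0" by linarith
    then have "bump r \<delta> x = 0" unfolding bump_def power2_norm_eq_inner by (simp only: power_0_Suc)
    then show False using *(1) by simp
  qed
  then have "?n\<^sup>2 < (\<delta> / 2)\<^sup>2" using *(2) by (simp add: field_simps power2_eq_square)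
  then show ?thesis using *(2) by (intro power2_less_imp_less[of _ "\<delta> / 2"]) auto
qed

lemma bump_stiefel: "v \<in> stiefel \<Longrightarrow> bump r \<delta> v = 1"
  by (simp add: bump_def stiefel_def)

lemma bump_invariant: "orthogonal_matrix q \<Longrightarrow> bump r \<delta> (q ** x) = bump r \<delta> x"
proof -
  assume "orthogonal_matrix q"
  moreover have "transpose (q ** x) ** (q ** x) = transpose x ** (transpose q ** q) ** x"
    by (simp add: matrix_transpose_mul matrix_mul_assoc)
  ultimately show ?thesis by (simp add: bump_def orthogonal_matrix)
qed

lemma higher_differentiable_on_bump: "higher_differentiable_on UNIV (bump r \<delta> :: real^'m^'n \<Rightarrow> real) r"
proof -
  have bt: "bounded_linear (transpose :: real^'m^'n \<Rightarrow> real^'n^'m)"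
    unfolding linear_conv_bounded_linear[symmetric] transpose_def by (auto intro!: linearI simp: vec_eq_iff)
  have A: "higher_differentiable_on UNIV (\<lambda>x :: real^'m^'n. transpose x ** x + (- mat 1)) r"
    by (intro higher_differentiable_on_add higher_differentiable_on_bilinear[OF bilinear_matrix_mult]
        higher_differentiable_on_const higher_differentiable_on_linear[OF bt] higher_differentiable_on_linear[OF bounded_linear_ident] open_UNIV)
  have "higher_differentiable_on UNIV (\<lambda>x :: real^'m^'n. 1 + (- (4 / \<delta>\<^sup>2)) * ((transpose x ** x + (- mat 1)) \<bullet> (transpose x ** x + (- mat 1)))) r"
    by (intro higher_differentiable_on_add higher_differentiable_on_mult higher_differentiable_on_inner higher_differentiable_on_const A open_UNIV)
  from higher_differentiable_on_compose[OF open_UNIV open_UNIV higher_differentiable_on_max_power this]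
  show ?thesis by (simp add: bump_def[abs_def])
qed

lemma bump_norm:
  assumes "bump r \<delta> x \<noteq> 0" "0 < \<delta>" "\<delta> \<le> 1" shows "norm (x :: real^'m^'n) \<le> 2 * real CARD('m)"
proof -
  have "(transpose x ** x) $ j $ j \<le> 2" for j
  proof -
    have "\<bar>(transpose x ** x - mat 1) $ j $ j\<bar> \<le> norm (transpose x ** x - mat 1)" by (rule abs_nth_nth_le)
    also have "\<dots> < 1" using bump_nz[OF assms(1,2)] assms(3) by linarith
    finally show ?thesis by (simp add: mat_def)
  qed
  then have "(\<Sum>j\<in>UNIV. (transpose x ** x) $ j $ j) \<le> (\<Sum>j\<in>(UNIV :: 'm set). 2)" by (intro sum_mono)
  moreover have "x \<bullet> x = (\<Sum>j\<in>UNIV. (transpose x ** x) $ j $ j)"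
    by (simp add: inner_vec_def transpose_mult_nth column_def) (rule sum.swap)
  ultimately have "(norm x)\<^sup>2 \<le> 2 * real CARD('m)" by (simp add: power2_norm_eq_inner)
  also have "\<dots> \<le> (2 * real CARD('m))\<^sup>2"
  proof -
    have "1 \<le> real CARD('m)" by (simp add: Suc_le_eq)
    then have "2 * real CARD('m) * 1 \<le> 2 * real CARD('m) * (2 * real CARD('m))"
      by (intro mult_left_mono) linarith+
    then show ?thesis by (simp only: power2_eq_square mult_1_right)
  qed
  finally show ?thesis by (rule power2_le_imp_le) simp
qed

lemma gram_near_1:
  assumes "\<eta> > 0"
  obtains \<delta> where "0 < \<delta>" "\<delta> \<le> 1" "\<And>x :: real^'m^'n. norm (transpose x ** x - mat 1) < \<delta> \<Longrightarrow> \<bar>gram x - 1\<bar> < \<eta>"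
proof -
  have "continuous_on UNIV (\<lambda>a :: real^'m^'m. det a)" by (intro continuous_intros)
  then have "isCont (det :: real^'m^'m \<Rightarrow> real) (mat 1)" by (simp add: continuous_on_eq_continuous_at)
  from this[unfolded continuous_at_eps_delta, rule_format, OF assms]
  obtain d where d: "d > 0" "\<And>a :: real^'m^'m. dist a (mat 1) < d \<Longrightarrow> dist (det a) (det (mat 1 :: real^'m^'m)) < \<eta>"
    by metis
  show ?thesis
  proof (rule that[of "min 1 d"])
    fix x :: "real^'m^'n" assume "norm (transpose x ** x - mat 1) < min 1 d"
    then show "\<bar>gram x - 1\<bar> < \<eta>"
      using d(2)[of "transpose x ** x"] by (simp add: dist_norm gram_def)
  qed (use d in auto)
qed

text \<open>Near a matrix of full rank, \<open>orth\<close> is smooth and \<omega> may be replaced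
  by a local smooth extension. A matrix of smaller rank is at distance at least \<delta> in the
  sense of \<open>near\<close>, and there the bump vanishes in a whole neighbourhood.\<close>

lemma higher_differentiable_on_bump_mult:
  fixes \<omega> :: "real^'m^'n \<Rightarrow> complex"
  assumes \<omega>: "smooth_on_submanifold stiefel \<omega>" and \<delta>: "\<delta> > 0"
    and near: "\<And>x :: real^'m^'n. norm (transpose x ** x - mat 1) < \<delta> \<Longrightarrow> gram x \<noteq> 0"
  shows "higher_differentiable_on UNIV (\<lambda>x. bump r \<delta> x *\<^sub>R cnj (\<omega> (orth x))) r"
proof (rule higher_differentiable_on_local)
  fix x0 :: "real^'m^'n"
  let ?W = "{x :: real^'m^'n. gram x \<noteq> 0}"
  have oW: "open ?W" by (intro open_Collect_neq continuous_intros)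
  show "\<exists>T. open T \<and> x0 \<in> T \<and> higher_differentiable_on T (\<lambda>x. bump r \<delta> x *\<^sub>R cnj (\<omega> (orth x))) r"
  proof (cases "x0 \<in> ?W")
    case True
    then have "orth x0 \<in> stiefel" by (simp add: orth_stiefel)
    from bspec[OF \<omega>[unfolded smooth_on_submanifold_def] this] obtain U F where
      UF: "open U \<and> orth x0 \<in> U \<and> (\<forall>r. higher_differentiable_on U F r) \<and> (\<forall>y\<in>U \<inter> stiefel. F y = \<omega> y)"
      by (elim exE)
    then have U: "open U" "orth x0 \<in> U" "\<And>r. higher_differentiable_on U F r"
      "\<And>y. y \<in> U \<inter> stiefel \<Longrightarrow> F y = \<omega> y"
      by simp_all
    let ?V = "?W \<inter> orth -` U"
    have oV: "open ?V"
      by (rule continuous_open_preimage[OF higher_differentiable_on_imp_continuous_on[OF higher_differentiable_on_orth] oW U(1)])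
    have 1: "higher_differentiable_on ?V (\<lambda>x. F (orth x)) r"
      by (rule higher_differentiable_on_compose[OF oV U(1,3) higher_differentiable_on_subset[OF higher_differentiable_on_orth]]) auto
    have "higher_differentiable_on ?V (\<lambda>x. bump r \<delta> x *\<^sub>R cnj (F (orth x))) r"
      by (intro higher_differentiable_on_scaleR oV higher_differentiable_on_subset[OF higher_differentiable_on_bump]
          higher_differentiable_on_compose[OF oV open_UNIV higher_differentiable_on_linear[OF bounded_linear_cnj open_UNIV] 1]) auto
    then have "higher_differentiable_on ?V (\<lambda>x. bump r \<delta> x *\<^sub>R cnj (\<omega> (orth x))) r"
      by (rule higher_differentiable_on_cong_open[OF oV, rotated]) (use U(4) orth_stiefel in auto)
    then show ?thesis using oV True U(2) by (intro exI[of _ ?V]) auto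
  next
    case False
    let ?V = "{x :: real^'m^'n. \<delta> / 2 < norm (transpose x ** x - mat 1)}"
    have oV: "open ?V" by (intro open_Collect_less continuous_intros)
    have "\<not> norm (transpose x0 ** x0 - mat 1) < \<delta>" using near[of x0] False by auto
    then have x0: "x0 \<in> ?V" using \<delta> by simp
    have "higher_differentiable_on ?V (\<lambda>x. bump r \<delta> x *\<^sub>R cnj (\<omega> (orth x))) r"
    proof (rule higher_differentiable_on_cong_open[OF oV _ higher_differentiable_on_const[OF oV]])
      fix x assume "x \<in> ?V"
      then have "bump r \<delta> x = 0" using bump_nz[of r \<delta> x] \<delta> by force
      then show "0 = bump r \<delta> x *\<^sub>R cnj (\<omega> (orth x))" by simp
    qed
    then show ?thesis using oV x0 by blast
  qed
qed

section \<open>The regularised kernel\<close>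

lemma norm_transpose_stiefel_mult:
  obtains c where "c > 0" "\<And>(u :: real^'k^'n) (y :: real^'m^'n). u \<in> stiefel \<Longrightarrow> norm (transpose u ** y) \<le> c * norm y"
proof -
  have "bounded (transpose ` (stiefel :: (real^'k^'n) set))"
    by (intro compact_imp_bounded compact_continuous_image compact_stiefel continuous_intros)
  then obtain T where T: "T > 0" "\<And>u :: real^'k^'n. u \<in> stiefel \<Longrightarrow> norm (transpose u) \<le> T"
    unfolding bounded_pos by auto
  obtain L where L: "L > 0" "\<And>(a :: real^'n^'k) (b :: real^'m^'n). norm (a ** b) \<le> norm a * norm b * L"
    using bounded_bilinear.pos_bounded[OF bilinear_matrix_mult] by metis
  show ?thesis
  proof (rule that[of "T * L"])
    fix u :: "real^'k^'n" and y :: "real^'m^'n" assume u: "u \<in> stiefel"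
    have "norm (transpose u ** y) \<le> norm (transpose u) * norm y * L" by (rule L(2))
    also have "\<dots> \<le> T * norm y * L" using T(2)[OF u] L(1) by (intro mult_right_mono) auto
    finally show "norm (transpose u ** y) \<le> T * L * norm y" by (simp add: mult_ac)
  qed (use T L in simp)
qed

text \<open>With y = u' x in the slab, the norm of \<open>up b\<close> is controlled by that of y b
  = u' \<open>stretch u b x\<close>, since y is bounded below as a map; then x differs from
  \<open>stretch u b x\<close> by a bounded matrix. A function of bounded support thus becomes
  boundedly supported in both variables, uniformly in u.\<close>

lemma stretch_bounds:
  obtains B B' where "B \<ge> 1"
    "\<And>(u :: real^'k^'n) (b :: real^'m^'m) x. u \<in> stiefel \<Longrightarrow> transpose u ** x \<in> slab \<Longrightarrow> norm (stretch u b x) \<le> A \<Longrightarrow>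
      norm (up b) \<le> B \<and> norm x \<le> B'"
proof -
  obtain c where c: "c > 0" "\<And>(u :: real^'k^'n) (y :: real^'m^'n). u \<in> stiefel \<Longrightarrow> norm (transpose u ** y) \<le> c * norm y"
    using norm_transpose_stiefel_mult by metis
  obtain d where d: "d > 0" "\<And>(y :: real^'m^'k) (z :: real^'m^'m). y \<in> slab \<Longrightarrow> d * norm z \<le> norm (y ** z)"
    using slab_mult_lower[where 'l='m] by metis
  obtain L where L: "L > 0" "\<And>(a :: real^'m^'k) (b :: real^'m^'m). norm (a ** b) \<le> norm a * norm b * L"
    using bounded_bilinear.pos_bounded[OF bilinear_matrix_mult] by metis
  define B where "B = max 1 (c * A / d)"
  define N1 where "N1 = norm (mat 1 :: real^'m^'m)"
  define B' where "B' = A + 3 * real CARD('m) * (B + N1) * L"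
  show ?thesis
  proof (rule that[of B B'])
    fix u :: "real^'k^'n" and b :: "real^'m^'m" and x
    assume u: "u \<in> stiefel" and s: "transpose u ** x \<in> slab" and A: "norm (stretch u b x) \<le> A"
    have "d * norm (up b) \<le> norm (transpose u ** x ** up b)" by (rule d(2)[OF s])
    also have "\<dots> = norm (transpose u ** stretch u b x)" by (simp add: transpose_stretch[OF u])
    also have "\<dots> \<le> c * norm (stretch u b x)" by (rule c(2)[OF u])
    also have "\<dots> \<le> c * A" using A c(1) by simp
    finally have "norm (up b) \<le> c * A / d" using d(1) by (simp add: field_simps)
    then have B: "norm (up b) \<le> B" by (simp add: B_def)
    let ?z = "transpose u ** x ** (up b - mat 1)"
    have "norm ?z \<le> norm (transpose u ** x) * norm (up b - mat 1) * L" by (rule L(2))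
    also have "\<dots> \<le> (3 * real CARD('m)) * (B + N1) * L"
    proof (intro mult_mono)
      show "norm (transpose u ** x) \<le> 3 * real CARD('m)" using s by (simp add: slab_def)
      show "norm (up b - mat 1) \<le> B + N1" using norm_triangle_ineq4[of "up b" "mat 1"] B by (simp add: N1_def)
      show "0 \<le> 3 * real CARD('m) * (B + N1)" by (simp add: B_def N1_def)
    qed (use L in auto)
    finally have z: "norm (u ** ?z) \<le> 3 * real CARD('m) * (B + N1) * L" by (simp add: norm_stiefel_mult[OF u])
    have "x = stretch u b x - u ** ?z" by (simp add: stretch_def matrix_mul_assoc)
    then have "norm x \<le> norm (stretch u b x) + norm (u ** ?z)" using norm_triangle_ineq4 by metis
    then show "norm (up b) \<le> B \<and> norm x \<le> B'" using A z B by (simp add: B'_def)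
  qed (simp add: B_def)
qed

section \<open>The triangular kernel as a product of powers\<close>

definition diag_unit :: "'m::finite \<Rightarrow> real^'m^'m" where
  "diag_unit j = axis j (axis j 1)"

definition diag_index :: "real^'m^'m \<Rightarrow> 'm" where
  "diag_index e = (SOME j. e = diag_unit j)"

lemma diag_unit_inject [simp]: "diag_unit i = diag_unit j \<longleftrightarrow> i = j"
  by (auto simp: diag_unit_def axis_eq_axis)

lemma diag_index_unit [simp]: "diag_index (diag_unit j) = j"
  unfolding diag_index_def by (rule some_equality) auto

lemma inner_diag_unit: "b \<bullet> diag_unit j = b $ j $ j"
  by (simp add: diag_unit_def inner_axis_axis)

lemma diag_unit_Basis: "diag_unit j \<in> Basis"
  by (auto simp: diag_unit_def Basis_matrix)

lemma radial_weight_lowbox: "radial_weight (range diag_unit) (indicator lowbox)"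
proof
  fix e b :: "real^'m^'m" and t assume "e \<in> range diag_unit"
  then obtain j where "e = diag_unit j" by blast
  then have z: "e $ i $ l = 0" if "rk l < rk i" for i l
    using that by (auto simp: diag_unit_def axis_def)
  have "b + t *\<^sub>R e \<in> lowbox \<longleftrightarrow> b \<in> lowbox"
    by (simp add: lowbox_def z cong: imp_cong)
  then show "indicator lowbox (b + t *\<^sub>R e) = (indicator lowbox b :: real)"
    by (simp add: indicator_def)
qed (auto simp: diag_unit_Basis indicator_def)

text \<open>Twice the argument of the matching factor of the Siegel Gamma function. As
  \<open>wt\<close> subtracts 1 and ranks start at 0, the entry b_jj carries the power \<alpha> - rk
  j - 1.\<close>

definition expo :: "complex \<Rightarrow> real^'m^'m \<Rightarrow> complex" where
  "expo \<alpha> e = \<alpha> - of_nat (rk (diag_index e))"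

lemma cpow_prod: "finite I \<Longrightarrow> (\<And>i. i \<in> I \<Longrightarrow> t i \<ge> 0) \<Longrightarrow> cpow (\<Prod>i\<in>I. t i) z = (\<Prod>i\<in>I. cpow (t i) z)"
proof (induction I rule: finite_induct)
  case (insert x F)
  then show ?case by (simp add: cpow_mult[of "t x" "\<Prod>i\<in>F. t i", unfolded of_real_mult] prod_nonneg del: of_real_prod)
qed simp

lemma cpow_square: "cpow (t\<^sup>2) (z / 2) = cpow \<bar>t\<bar> z"
proof (cases "t = 0")
  case False
  have "ln (t\<^sup>2) = 2 * ln \<bar>t\<bar>" using False ln_realpow[of "\<bar>t\<bar>" 2] by simp
  then show ?thesis using False by (simp add: powr_def Ln_of_real del: of_real_power)
qed simp

lemma cpow_of_real: "t \<ge> 0 \<Longrightarrow> cpow t (complex_of_real a) = complex_of_real (t powr a)"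
  by (simp add: powr_of_real)

context
  fixes B :: real
begin

interpretation radial_weight "range diag_unit :: (real^'m^'m) set" "indicator lowbox" B
  by (rule radial_weight_lowbox)

lemma wt_diag: "wt s b = (\<Prod>j\<in>UNIV. cpow \<bar>b $ j $ j\<bar> (s (diag_unit j) - 1)) * indicator lowbox b"
proof -
  have "(\<Prod>e\<in>range diag_unit. cpow \<bar>b \<bullet> e\<bar> (s e - 1)) = (\<Prod>j\<in>UNIV. cpow \<bar>b $ j $ j\<bar> (s (diag_unit j) - 1))"
    by (subst prod.reindex) (auto simp: inj_def inner_diag_unit)
  then show ?thesis by (simp add: wt_def indicator_def)
qed

text \<open>\<open>gram (y ** up b)\<close> contains the square of \<open>det (up b)\<close>, so its
  power \<alpha>/2 contributes |b_jj| powr \<alpha> for every j; the Haar density lowers these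
  exponents by \<open>Suc (rk j)\<close>.\<close>

lemma haar_weight_cpow:
  "complex_of_real (haar_weight b) * cpow (gram (y ** up b)) (\<alpha> / 2) = wt (expo \<alpha>) b * cpow (gram y) (\<alpha> / 2)"
proof -
  have "cpow (gram (y ** up b)) (\<alpha> / 2) = cpow ((det (up b))\<^sup>2) (\<alpha> / 2) * cpow (gram y) (\<alpha> / 2)"
    unfolding gram_mult by (rule cpow_mult) (simp_all add: gram_nonneg)
  also have "cpow ((det (up b))\<^sup>2) (\<alpha> / 2) = (\<Prod>j\<in>UNIV. cpow \<bar>b $ j $ j\<bar> \<alpha>)"
    unfolding cpow_square det_up abs_prod by (rule cpow_prod) auto
  finally have g: "cpow (gram (y ** up b)) (\<alpha> / 2) = (\<Prod>j\<in>UNIV. cpow \<bar>b $ j $ j\<bar> \<alpha>) * cpow (gram y) (\<alpha> / 2)" .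
  have "complex_of_real (\<bar>b $ j $ j\<bar> powr (- real (Suc (rk j)))) * cpow \<bar>b $ j $ j\<bar> \<alpha> =
      cpow \<bar>b $ j $ j\<bar> (expo \<alpha> (diag_unit j) - 1)" for j
  proof -
    have "complex_of_real (\<bar>b $ j $ j\<bar> powr (- real (Suc (rk j)))) = cpow \<bar>b $ j $ j\<bar> (- of_nat (Suc (rk j)))"
      by (subst cpow_of_real[symmetric]) auto
    then show ?thesis by (simp add: powr_add[symmetric] expo_def algebra_simps)
  qed
  then have "complex_of_real (haar_weight b) * (\<Prod>j\<in>UNIV. cpow \<bar>b $ j $ j\<bar> \<alpha>) = wt (expo \<alpha>) b"
    unfolding wt_diag by (simp add: haar_weight_def prod.distrib[symmetric] mult_ac indicator_def)
  then show ?thesis unfolding g by (simp add: mult.assoc[symmetric])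
qed

lemma expo_pos: "Re \<alpha> > real CARD('m) - 1 \<Longrightarrow> Re (expo \<alpha> (e :: real^'m^'m)) > 0"
  using rk_less[of "diag_index e"] by (simp add: expo_def)

text \<open>The dummy entries are bounded by 1, whence B \<ge> 1; all others are bounded by the norm
  of \<open>up b\<close>.\<close>

lemma lowbox_cube: "b \<in> lowbox \<Longrightarrow> norm (up b) \<le> B \<Longrightarrow> B \<ge> 1 \<Longrightarrow> b \<in> cube"
proof -
  assume b: "b \<in> lowbox" "norm (up b) \<le> B" "B \<ge> 1"
  have "\<bar>b $ i $ j\<bar> \<le> B" for i j
  proof (cases "rk i \<le> rk j")
    case True
    then show ?thesis using abs_nth_nth_le[of "up b" i j] b(2) by (simp add: up_nth)
  next
    case False
    then have "\<bar>b $ i $ j\<bar> \<le> 1" using b(1) by (simp add: lowbox_def)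
    then show ?thesis using b(3) by linarith
  qed
  then show ?thesis by (auto simp: cube_def Basis_matrix inner_axis_axis)
qed

end

lemma slab_gram_bound:
  obtains \<Gamma> where "\<Gamma> \<ge> 1" "\<And>y :: real^'m^'k. y \<in> slab \<Longrightarrow> 1 \<le> gram y \<and> gram y \<le> \<Gamma>"
proof -
  have "bounded ((gram :: real^'m^'k \<Rightarrow> real) ` slab)"
    by (intro compact_imp_bounded compact_continuous_image compact_slab continuous_intros)
  then obtain G where G: "\<And>y :: real^'m^'k. y \<in> slab \<Longrightarrow> norm (gram y) \<le> G"
    unfolding bounded_iff by auto
  show ?thesis
  proof (rule that[of "max 1 G"])
    show "1 \<le> gram y \<and> gram y \<le> max 1 G" if "y \<in> slab" for y :: "real^'m^'k"
      using G[OF that] that by (auto simp: slab_def)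
  qed simp
qed

text \<open>The exponent may be negative, and the power then blows up where u' x loses rank.
  Averaging over the triangular group converts this singularity into the integrable weight
  \<open>wt\<close>, times a power of a Gram determinant bounded on the slab;
  \<open>stretch_bounds\<close> makes the result uniform in u.\<close>

lemma gram_powr_nn_bound:
  assumes kn: "CARD('k) \<le> CARD('n)" and a: "a > real CARD('m) - 1"
  shows "\<exists>c :: real. \<forall>u \<in> (stiefel :: (real^'k^'n) set).
    (\<integral>\<^sup>+x. indicator (cball 0 A) x * ennreal (gram (transpose u ** (x :: real^'m^'n)) powr ((a - real CARD('k)) / 2)) \<partial>lborel) \<le> ennreal c"
proof -
  obtain B B' where B: "B \<ge> 1"
    "\<And>(u :: real^'k^'n) (b :: real^'m^'m) x. u \<in> stiefel \<Longrightarrow> transpose u ** x \<in> slab \<Longrightarrow> norm (stretch u b x) \<le> A \<Longrightarrow>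
      norm (up b) \<le> B \<and> norm x \<le> B'" using stretch_bounds by metis
  obtain \<Gamma> where \<Gamma>: "\<Gamma> \<ge> 1" "\<And>y :: real^'m^'k. y \<in> slab \<Longrightarrow> 1 \<le> gram y \<and> gram y \<le> \<Gamma>"
    using slab_gram_bound by metis
  interpret radial_weight "range diag_unit :: (real^'m^'m) set" "indicator lowbox" B by (rule radial_weight_lowbox)
  define C where "C = enn2real (slab_const TYPE('m) TYPE('k))"
  have C: "slab_const TYPE('m) TYPE('k) = ennreal C"
    unfolding C_def using slab_const_finite[where 'm='m and 'k='k] by simp
  have Cp: "C > 0" using slab_const_pos[where 'm='m and 'k='k] slab_const_finite[where 'm='m and 'k='k]
    unfolding C_def by (simp add: enn2real_positive_iff)
  define w where "w b = norm (wt (expo (complex_of_real a)) b) * indicator cube b" for b :: "real^'m^'m"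
  have wi: "integrable lborel w" unfolding w_def[abs_def] by (rule wt_integrable, rule expo_pos) (use a in simp)
  have a0: "a > 0 \<or> a = 0 \<or> a > -1" using a by linarith
  define E where "E = \<Gamma> powr (\<bar>a\<bar> / 2)"
  define V where "V = enn2real (emeasure lborel (cball (0 :: real^'m^'n) B'))"
  have V: "emeasure lborel (cball (0 :: real^'m^'n) B') = ennreal V"
    unfolding V_def using emeasure_bounded_finite[OF bounded_cball, of "0 :: real^'m^'n" B'] by simp
  define I where "I = enn2real (\<integral>\<^sup>+b. ennreal (w b) \<partial>lborel)"
  have w0: "w b \<ge> 0" for b by (simp add: w_def)
  have I: "(\<integral>\<^sup>+b. ennreal (w b) \<partial>lborel) = ennreal I"
    unfolding I_def using wi w0 by (simp add: integrable_iff_bounded)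
  have pos: "E \<ge> 0" "V \<ge> 0" "I \<ge> 0" by (simp_all add: E_def V_def I_def)
  show ?thesis
  proof (intro exI[of _ "I * E * V / C"] ballI)
    fix u :: "real^'k^'n" assume u: "u \<in> stiefel"
    let ?f = "\<lambda>x :: real^'m^'n. indicator (cball 0 A) x * ennreal (gram (transpose u ** x) powr (a / 2))"
    have cb [measurable]: "(indicator (cball 0 R) :: real^'m^'n \<Rightarrow> ennreal) \<in> borel_measurable borel" for R
      by (intro borel_measurable_indicator) simp
    have [measurable]: "w \<in> borel_measurable borel" unfolding w_def by measurable
    have le: "ennreal (haar_weight b) * indicator slab (transpose u ** x) * ?f (stretch u b x) \<le>
        ennreal (w b) * (ennreal E * indicator (cball 0 B') x)" for b x
    proof (cases "transpose u ** x \<in> slab \<and> norm (stretch u b x) \<le> A \<and> b \<in> lowbox")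
      case True
      then have b: "norm (up b) \<le> B" "norm x \<le> B'" using B(2)[OF u, of x b] by auto
      have bc: "b \<in> cube" using lowbox_cube[of b B] True b B(1) by blast
      have "haar_weight b * gram (transpose u ** stretch u b x) powr (a / 2) =
          norm (complex_of_real (haar_weight b) * cpow (gram (transpose u ** x ** up b)) (complex_of_real a / 2))"
        by (simp add: norm_mult norm_cpow gram_nonneg haar_weight_nonneg transpose_stretch[OF u])
      also have "\<dots> = norm (wt (expo (complex_of_real a)) b) * gram (transpose u ** x) powr (a / 2)"
        unfolding haar_weight_cpow by (simp add: norm_mult norm_cpow gram_nonneg)
      also have "\<dots> \<le> w b * E"
      proof (intro mult_mono)
        have "gram (transpose u ** x) powr (a / 2) \<le> gram (transpose u ** x) powr (\<bar>a\<bar> / 2)"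
          using \<Gamma>(2)[of "transpose u ** x"] True by (intro powr_mono) auto
        also have "\<dots> \<le> E" unfolding E_def using \<Gamma>(2)[of "transpose u ** x"] True by (intro powr_mono2) auto
        finally show "gram (transpose u ** x) powr (a / 2) \<le> E" .
      qed (use bc w0 in \<open>simp_all add: w_def\<close>)
      finally have "ennreal (haar_weight b * gram (transpose u ** stretch u b x) powr (a / 2)) \<le> ennreal (w b * E)"
        by (rule ennreal_leI)
      then show ?thesis using True b pos w0[of b]
        by (simp add: ennreal_mult haar_weight_nonneg)
    next
      case False
      then show ?thesis by (auto simp: haar_weight_def)
    qed
    have "ennreal C * (\<integral>\<^sup>+x. indicator (cball 0 A) x * ennreal (gram (transpose u ** (x :: real^'m^'n)) powr ((a - real CARD('k)) / 2)) \<partial>lborel) =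
        (\<integral>\<^sup>+x. slab_mass (transpose u ** x) * ?f x \<partial>lborel)"
    proof (subst nn_integral_cmult[symmetric])
      show "(\<integral>\<^sup>+x. ennreal C * (indicator (cball 0 A) x * ennreal (gram (transpose u ** (x :: real^'m^'n)) powr ((a - real CARD('k)) / 2))) \<partial>lborel) =
        (\<integral>\<^sup>+x. slab_mass (transpose u ** x) * ?f x \<partial>lborel)"
      proof (rule nn_integral_cong)
        fix x :: "real^'m^'n"
        have "gram (transpose u ** x) powr ((a - real CARD('k)) / 2) =
            gram (transpose u ** x) powr (- real CARD('k) / 2) * gram (transpose u ** x) powr (a / 2)"
          by (simp add: powr_add[symmetric] diff_divide_distrib add.commute)
        then show "ennreal C * (indicator (cball 0 A) x * ennreal (gram (transpose u ** x) powr ((a - real CARD('k)) / 2))) =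
            slab_mass (transpose u ** x) * ?f x"
          unfolding slab_mass_eq C by (simp add: ennreal_mult mult_ac)
      qed
    qed measurable
    also have "\<dots> = (\<integral>\<^sup>+b. (\<integral>\<^sup>+x. ennreal (haar_weight b) * indicator slab (transpose u ** x) * ?f (stretch u b x) \<partial>lborel) \<partial>lborel)"
      by (rule stretch_nn_integral[OF u kn, symmetric]) measurable
    also have "\<dots> \<le> (\<integral>\<^sup>+b. (\<integral>\<^sup>+x. ennreal (w b) * (ennreal E * indicator (cball 0 B') (x :: real^'m^'n)) \<partial>lborel) \<partial>lborel)"
      by (intro nn_integral_mono le)
    also have "\<dots> = (\<integral>\<^sup>+b. ennreal (w b) * (ennreal E * ennreal V) \<partial>lborel)"
      by (simp add: nn_integral_cmult V)
    also have "\<dots> = ennreal I * (ennreal E * ennreal V)"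
      by (subst nn_integral_multc) (simp_all add: I)
    also have "\<dots> = ennreal C * ennreal (I * E * V / C)"
      using pos Cp by (simp add: ennreal_mult[symmetric] field_simps)
    finally show "(\<integral>\<^sup>+x. indicator (cball 0 A) x * ennreal (gram (transpose u ** (x :: real^'m^'n)) powr ((a - real CARD('k)) / 2)) \<partial>lborel) \<le> ennreal (I * E * V / C)"
      using Cp by (subst (asm) ennreal_mult_le_mult_iff) auto
  qed
qed

lemma higher_differentiable_on_stretch:
  fixes g :: "real^'m^'n \<Rightarrow> complex"
  assumes g: "higher_differentiable_on UNIV g r"
  shows "higher_differentiable_on UNIV
    (\<lambda>z :: ((real^'k^'n) \<times> (real^'m^'n)) \<times> (real^'m^'m). g (stretch (fst (fst z)) (snd z) (snd (fst z)))) r"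
proof -
  have bt: "bounded_linear (transpose :: real^'k^'n \<Rightarrow> real^'n^'k)"
    unfolding linear_conv_bounded_linear[symmetric] transpose_def by (auto intro!: linearI simp: vec_eq_iff)
  have bu: "bounded_linear (up :: real^'m^'m \<Rightarrow> real^'m^'m)"
    unfolding linear_conv_bounded_linear[symmetric] up_def by (auto intro!: linearI simp: vec_eq_iff)
  have "higher_differentiable_on UNIV
    (\<lambda>z :: ((real^'k^'n) \<times> (real^'m^'n)) \<times> (real^'m^'m). snd (fst z) +
      fst (fst z) ** (transpose (fst (fst z)) ** snd (fst z)) ** (up (snd z) + (- mat 1))) r"
    by (intro higher_differentiable_on_add higher_differentiable_on_bilinear[OF bilinear_matrix_mult]
        higher_differentiable_on_const open_UNIV
        higher_differentiable_on_linear[OF bounded_linear_compose[OF bt bounded_linear_compose[OF bounded_linear_fst bounded_linear_fst]]]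
        higher_differentiable_on_linear[OF bounded_linear_compose[OF bu bounded_linear_snd]]
        higher_differentiable_on_linear[OF bounded_linear_compose[OF bounded_linear_fst bounded_linear_fst]]
        higher_differentiable_on_linear[OF bounded_linear_compose[OF bounded_linear_snd bounded_linear_fst]])
  from higher_differentiable_on_compose[OF open_UNIV open_UNIV g this]
  show ?thesis by (simp add: stretch_def)
qed

text \<open>The regularised kernel: on the half-plane of convergence its integral is the integral of
  \<open>g\<close> against a power of \<open>gram (u' x)\<close>, up to the polynomial factors absorbed by Gamma functions,
  but it converges on a larger half-plane, uniformly in \<open>u\<close>.\<close>

lemma regularised_kernel:
  fixes g :: "real^'m^'n \<Rightarrow> complex" and N :: nat
  assumes kn: "CARD('k) \<le> CARD('n)"
    and g: "higher_differentiable_on UNIV g (2 * (CARD('m) * N))" and supp: "\<And>x. g x \<noteq> 0 \<Longrightarrow> norm x \<le> A"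
  obtains \<kappa> :: "complex \<Rightarrow> real^'k^'n \<Rightarrow> (real^'m^'m) \<times> (real^'m^'n) \<Rightarrow> complex"
  where "\<And>u p. (\<lambda>\<alpha>. \<kappa> \<alpha> u p) holomorphic_on UNIV"
    and "\<And>\<alpha>. (\<lambda>z. \<kappa> \<alpha> (fst z) (snd z)) \<in> borel_measurable borel"
    and "\<And>\<alpha>. Re \<alpha> > real CARD('m) - 1 - 2 * real N \<Longrightarrow> \<exists>r>0. \<exists>G. cball \<alpha> r \<subseteq> {z. Re z > real CARD('m) - 1 - 2 * real N} \<and>
      integrable lborel G \<and> (\<forall>z\<in>cball \<alpha> r. \<forall>u\<in>stiefel. \<forall>p. norm (\<kappa> z u p) \<le> G p)"
    and "\<And>\<alpha> u. Re \<alpha> > real CARD('m) - 1 \<Longrightarrow> u \<in> stiefel \<Longrightarrow>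
      (\<Prod>j\<in>(UNIV :: 'm set). pochhammer ((\<alpha> - of_nat (rk j)) / 2) N) *
        (enn2real (slab_const TYPE('m) TYPE('k)) *\<^sub>R
          (\<integral>x. cpow (gram (transpose u ** x)) ((\<alpha> - of_nat CARD('k)) / 2) * g x \<partial>lborel)) =
      (\<integral>p. \<kappa> \<alpha> u p \<partial>lborel)"
proof -
  obtain B B' where B: "B \<ge> 1"
    "\<And>(u :: real^'k^'n) (b :: real^'m^'m) x. u \<in> stiefel \<Longrightarrow> transpose u ** x \<in> slab \<Longrightarrow> norm (stretch u b x) \<le> A \<Longrightarrow>
      norm (up b) \<le> B \<and> norm x \<le> B'" using stretch_bounds by metis
  obtain \<Gamma> where \<Gamma>: "\<Gamma> \<ge> 1" "\<And>y :: real^'m^'k. y \<in> slab \<Longrightarrow> 1 \<le> gram y \<and> gram y \<le> \<Gamma>"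
    using slab_gram_bound by metis
  interpret radial_weight "range diag_unit :: (real^'m^'m) set" "indicator lowbox" B by (rule radial_weight_lowbox)
  define f where "f = (\<lambda>z :: ((real^'k^'n) \<times> (real^'m^'n)) \<times> (real^'m^'m). g (stretch (fst (fst z)) (snd z) (snd (fst z))))"
  define S where "S = {(u :: real^'k^'n, x :: real^'m^'n). u \<in> stiefel \<and> transpose u ** x \<in> slab}"
  have dsum: "(\<Sum>e\<in>range (diag_unit :: 'm \<Rightarrow> real^'m^'m). N) = CARD('m) * N"
    by (simp add: card_image inj_def)
  have f: "higher_differentiable_on UNIV f (2 * (\<Sum>e\<in>range (diag_unit :: 'm \<Rightarrow> real^'m^'m). N))"
    unfolding f_def dsum by (rule higher_differentiable_on_stretch[OF g])
  have f0: "b \<in> cube \<and> norm x \<le> B'" if "u \<in> stiefel" "transpose u ** x \<in> slab" "b \<in> lowbox" "f ((u, x), b) \<noteq> 0" for u x b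
  proof -
    have "norm (stretch u b x) \<le> A" using supp that(4) by (simp add: f_def)
    with B(2)[OF that(1,2)] have "norm (up b) \<le> B" "norm x \<le> B'" by auto
    then show ?thesis using lowbox_cube[of b B] that(3) B(1) by blast
  qed
  have suppS: "supp_in f p" if "p \<in> S" for p
    using that f0 by (force simp: supp_in_def S_def indicator_def)
  have "\<exists>f'. continuous_on UNIV f' \<and> (\<forall>p\<in>S. supp_in f' p) \<and>
    (\<forall>p\<in>S. \<forall>s. (\<forall>e\<in>range diag_unit. Re (s e) > 0) \<longrightarrow>
      (\<Prod>e\<in>range diag_unit. pochhammer (s e / 2) N) * (\<integral>b. wt s b * f (p, b) \<partial>lborel) =
      (\<integral>b. wt (\<lambda>e. s e + 2 * of_nat N) b * f' (p, b) \<partial>lborel))"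
    by (rule integral_wt_shift[OF f]) (rule suppS)
  then obtain f' where F: "continuous_on UNIV f' \<and> (\<forall>p\<in>S. supp_in f' p) \<and>
    (\<forall>p\<in>S. \<forall>s. (\<forall>e\<in>range diag_unit. Re (s e) > 0) \<longrightarrow>
      (\<Prod>e\<in>range diag_unit. pochhammer (s e / 2) N) * (\<integral>b. wt s b * f (p, b) \<partial>lborel) =
      (\<integral>b. wt (\<lambda>e. s e + 2 * of_nat N) b * f' (p, b) \<partial>lborel))"
    by (elim exE)
  note f' = F[THEN conjunct1] F[THEN conjunct2, THEN conjunct1, THEN bspec]
  note shift = F[THEN conjunct2, THEN conjunct2, THEN bspec, THEN spec, THEN mp]
  let ?ex = "\<lambda>\<alpha> e. expo \<alpha> e + 2 * of_nat N"
  \<comment> \<open>The slab restricts only u' x, not x. By \<open>f0\<close> the original integrand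
    vanishes beyond norm B', so the ball can be inserted without changing its integral, and it keeps
    the domain of x bounded.\<close>
  define \<kappa> where "\<kappa> \<alpha> u p = indicator slab (transpose u ** snd p) * indicator (cball 0 B') (snd p) *
    cpow (gram (transpose u ** snd p)) (\<alpha> / 2) * (wt (?ex \<alpha>) (fst p) * f' ((u, snd p), fst p))"
    for \<alpha> and u :: "real^'k^'n" and p :: "(real^'m^'m) \<times> (real^'m^'n)"
  have [measurable]: "(indicator (cball 0 B') :: real^'m^'n \<Rightarrow> complex) \<in> borel_measurable borel"
    by (intro borel_measurable_indicator) simp
  have f'm: "f' \<in> borel_measurable borel" by (rule borel_measurable_continuous_onI[OF f'(1)])
  have fm: "f \<in> borel_measurable borel"
    by (rule borel_measurable_continuous_onI[OF higher_differentiable_on_imp_continuous_on[OF f]])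
  have gc: "continuous_on UNIV g" by (rule higher_differentiable_on_imp_continuous_on[OF g])
  have gm [measurable]: "g \<in> borel_measurable borel" by (rule borel_measurable_continuous_onI[OF gc])
  have meas: "(\<lambda>z. \<kappa> \<alpha> (fst z) (snd z)) \<in> borel_measurable borel" for \<alpha>
  proof -
    have "(\<lambda>z :: (real^'k^'n) \<times> (real^'m^'m) \<times> (real^'m^'n). ((fst z, snd (snd z)), fst (snd z))) \<in> borel_measurable borel"
      by (intro borel_measurable_continuous_onI continuous_intros)
    from measurable_compose[OF this f'm]
    have [measurable]: "(\<lambda>z :: (real^'k^'n) \<times> (real^'m^'m) \<times> (real^'m^'n). f' ((fst z, snd (snd z)), fst (snd z))) \<in> borel_measurable borel" .
    have [measurable]: "(\<lambda>z :: (real^'k^'n) \<times> (real^'m^'m) \<times> (real^'m^'n). fst z) \<in> borel_measurable borel"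
      "(\<lambda>z :: (real^'k^'n) \<times> (real^'m^'m) \<times> (real^'m^'n). fst (snd z)) \<in> borel_measurable borel"
      "(\<lambda>z :: (real^'k^'n) \<times> (real^'m^'m) \<times> (real^'m^'n). snd (snd z)) \<in> borel_measurable borel"
      by (intro borel_measurable_continuous_onI continuous_intros)+
    show ?thesis unfolding \<kappa>_def by measurable
  qed
  have measu: "\<kappa> \<alpha> u \<in> borel_measurable borel" for \<alpha> u
  proof -
    have "(\<lambda>p. (u, p)) \<in> borel_measurable borel" by (intro borel_measurable_continuous_onI continuous_intros)
    from measurable_compose[OF this meas[of \<alpha>]] show ?thesis by simp
  qed
  \<comment> \<open>The variable \<alpha> occurs only in exponents of fixed nonnegative reals; a
    base 0 gives the constant 0.\<close>
  have hol: "(\<lambda>\<alpha>. \<kappa> \<alpha> u p) holomorphic_on UNIV" for u p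
    unfolding \<kappa>_def wt_diag expo_def
    by (intro holomorphic_intros) auto
  define M' where "M' = (SOME M. M \<ge> 0 \<and> (\<forall>u\<in>stiefel. \<forall>x\<in>cball 0 B'. \<forall>b\<in>cube. norm (f' ((u, x), b)) \<le> M))"
  have "\<exists>M. M \<ge> 0 \<and> (\<forall>u\<in>stiefel. \<forall>x\<in>cball 0 B'. \<forall>b\<in>cube. norm (f' ((u, x), b)) \<le> M)"
  proof -
    have "bounded (f' ` ((stiefel \<times> cball 0 B') \<times> cube))"
      by (intro compact_imp_bounded compact_continuous_image compact_Times compact_stiefel compact_cball compact_cube
          continuous_on_subset[OF f'(1)] subset_UNIV)
    then obtain M where "\<forall>y\<in>f' ` ((stiefel \<times> cball 0 B') \<times> cube). norm y \<le> M" unfolding bounded_iff by blast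
    then show ?thesis by (intro exI[of _ "max 0 M"]) (auto simp: le_max_iff_disj)
  qed
  from someI_ex[OF this] have M': "M' \<ge> 0" "\<And>u x b. u \<in> stiefel \<Longrightarrow> x \<in> cball 0 B' \<Longrightarrow> b \<in> cube \<Longrightarrow> norm (f' ((u, x), b)) \<le> M'"
    unfolding M'_def[symmetric] by auto
  have pairint: "integrable lborel (\<lambda>p :: (real^'m^'m) \<times> (real^'m^'n). w (fst p) * indicator (cball 0 B') (snd p))"
    if w: "integrable lborel w" for w :: "real^'m^'m \<Rightarrow> real"
    unfolding lborel_prod[symmetric]
  proof (rule lborel_pair.Fubini_integrable)
    have [measurable]: "(indicator (cball 0 B') :: real^'m^'n \<Rightarrow> real) \<in> borel_measurable borel"
      by (intro borel_measurable_indicator) simp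
    have [measurable]: "w \<in> borel_measurable borel" using borel_measurable_integrable[OF w] by simp
    show "(\<lambda>p. w (fst p) * indicator (cball 0 B') (snd p)) \<in> borel_measurable (lborel \<Otimes>\<^sub>M (lborel :: (real^'m^'n) measure))"
      by measurable
    have i: "integrable lborel (indicator (cball 0 B') :: real^'m^'n \<Rightarrow> real)"
      using emeasure_bounded_finite[OF bounded_cball, of "0 :: real^'m^'n" B'] by (intro integrable_real_indicator) auto
    show "AE x in lborel. integrable lborel (\<lambda>y. w (fst (x, y)) * indicator (cball 0 B') (snd (x, y :: real^'m^'n)))"
      using i by simp
    show "integrable lborel (\<lambda>x. \<integral>y. norm (w (fst (x, y)) * indicator (cball 0 B') (snd (x, y :: real^'m^'n))) \<partial>lborel)"
      using w by (simp add: abs_mult)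
  qed
  let ?h = "real CARD('m) - 1 - 2 * real N"
  have expo_N: "Re (?ex (complex_of_real a) e) > 0" if "a > ?h" for a and e :: "real^'m^'m"
    using rk_less[of "diag_index e"] that by (simp add: expo_def)
  have dom: "\<exists>r>0. \<exists>G. cball \<alpha> r \<subseteq> {z. Re z > ?h} \<and>
      integrable lborel G \<and> (\<forall>z\<in>cball \<alpha> r. \<forall>u\<in>stiefel. \<forall>p. norm (\<kappa> z u p) \<le> G p)" if \<alpha>: "Re \<alpha> > ?h" for \<alpha>
  proof -
    \<comment> \<open>Half the distance to the boundary of the half-plane, so that a, the least real
      part on the disc, still satisfies the condition of integrability.\<close>
    define r where "r = (Re \<alpha> - ?h) / 2"
    define a where "a = Re \<alpha> - r"
    have r: "r > 0" and a: "a > ?h" using \<alpha> unfolding a_def r_def by (simp_all add: field_simps)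
    define E where "E = \<Gamma> powr ((\<bar>Re \<alpha>\<bar> + r) / 2)"
    define W where "W b = norm (wt (?ex (complex_of_real a)) b) * indicator cube b" for b :: "real^'m^'m"
    define Q where "Q = (B powr (2 * r)) ^ CARD('m)"
    define G where "G p = (E * Q * M') * (W (fst p) * indicator (cball 0 B') (snd p))" for p :: "(real^'m^'m) \<times> (real^'m^'n)"
    have pos: "E \<ge> 0" "Q \<ge> 0" "W b \<ge> 0" for b by (simp_all add: E_def Q_def W_def)
    have "integrable lborel W" unfolding W_def[abs_def] by (rule wt_integrable) (use expo_N[OF a] in auto)
    then have Gi: "integrable lborel G" unfolding G_def[abs_def] by (intro integrable_mult_right pairint)
    have Rz: "a \<le> Re z \<and> Re z - a \<le> 2 * r \<and> \<bar>Re z\<bar> \<le> \<bar>Re \<alpha>\<bar> + r" if "z \<in> cball \<alpha> r" for z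
      using that abs_Re_le_cmod[of "\<alpha> - z"] by (auto simp: a_def dist_norm)
    \<comment> \<open>On the cube |b_jj| is at most B, so increasing the exponent from its least
      value by at most 2 r costs at most a factor B powr (2 r) for each diagonal entry.\<close>
    have wtb: "norm (wt (?ex z) b) \<le> Q * W b" if z: "z \<in> cball \<alpha> r" and b: "b \<in> cube" for z b
    proof -
      have "norm (wt (?ex z) b) = (\<Prod>j\<in>UNIV. \<bar>b $ j $ j\<bar> powr (Re z - real (rk j) + 2 * real N - 1)) * indicator lowbox b"
        unfolding wt_diag by (simp add: norm_mult prod_norm[symmetric] norm_cpow expo_def indicator_def)
      also have "\<dots> \<le> (\<Prod>j\<in>UNIV. B powr (2 * r) * \<bar>b $ j $ j\<bar> powr (a - real (rk j) + 2 * real N - 1)) * indicator lowbox b"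
      proof (intro mult_right_mono prod_mono conjI)
        fix j :: 'm
        have bj: "\<bar>b $ j $ j\<bar> \<le> B" using b diag_unit_Basis[of j] by (auto simp: cube_def inner_diag_unit dest: bspec[of _ _ "diag_unit j"])
        show "\<bar>b $ j $ j\<bar> powr (Re z - real (rk j) + 2 * real N - 1) \<le> B powr (2 * r) * \<bar>b $ j $ j\<bar> powr (a - real (rk j) + 2 * real N - 1)"
        proof (cases "b $ j $ j = 0")
          case False
          have "\<bar>b $ j $ j\<bar> powr (Re z - real (rk j) + 2 * real N - 1) =
              \<bar>b $ j $ j\<bar> powr (Re z - a) * \<bar>b $ j $ j\<bar> powr (a - real (rk j) + 2 * real N - 1)"
            unfolding powr_add[symmetric] by (rule arg_cong) simp
          also have "\<dots> \<le> B powr (2 * r) * \<bar>b $ j $ j\<bar> powr (a - real (rk j) + 2 * real N - 1)"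
          proof (rule mult_right_mono)
            have "\<bar>b $ j $ j\<bar> powr (Re z - a) \<le> B powr (Re z - a)" using bj Rz[OF z] by (intro powr_mono2) auto
            also have "\<dots> \<le> B powr (2 * r)" using Rz[OF z] B(1) by (intro powr_mono) auto
            finally show "\<bar>b $ j $ j\<bar> powr (Re z - a) \<le> B powr (2 * r)" .
          qed simp
          finally show ?thesis .
        qed simp
      qed auto
      also have "\<dots> = Q * ((\<Prod>j\<in>UNIV. \<bar>b $ j $ j\<bar> powr (a - real (rk j) + 2 * real N - 1)) * indicator lowbox b)"
        by (simp add: prod.distrib Q_def)
      also have "(\<Prod>j\<in>UNIV. \<bar>b $ j $ j\<bar> powr (a - real (rk j) + 2 * real N - 1)) * indicator lowbox b = W b"
        unfolding W_def wt_diag using b by (simp add: norm_mult prod_norm[symmetric] norm_cpow expo_def indicator_def)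
      finally show ?thesis .
    qed
    have bound: "norm (\<kappa> z u p) \<le> G p" if z: "z \<in> cball \<alpha> r" and u: "u \<in> stiefel" for z u p
    proof (cases "transpose u ** snd p \<in> slab \<and> snd p \<in> cball 0 B' \<and> fst p \<in> lowbox \<and> f' ((u, snd p), fst p) \<noteq> 0")
      case True
      then have "supp_in f' (u, snd p)" using u by (intro f'(2)) (simp add: S_def)
      then have bc: "fst p \<in> cube" using True by (auto simp: supp_in_def indicator_def)
      have gb: "gram (transpose u ** snd p) powr (Re z / 2) \<le> E"
      proof -
        have "gram (transpose u ** snd p) powr (Re z / 2) \<le> gram (transpose u ** snd p) powr ((\<bar>Re \<alpha>\<bar> + r) / 2)"
          using \<Gamma>(2)[of "transpose u ** snd p"] True Rz[OF z] by (intro powr_mono) auto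
        also have "\<dots> \<le> E" unfolding E_def using \<Gamma>(2)[of "transpose u ** snd p"] True r by (intro powr_mono2) auto
        finally show ?thesis .
      qed
      have "norm (\<kappa> z u p) = gram (transpose u ** snd p) powr (Re z / 2) * (norm (wt (?ex z) (fst p)) * norm (f' ((u, snd p), fst p)))"
        using True by (simp add: \<kappa>_def norm_mult norm_cpow gram_nonneg)
      also have "\<dots> \<le> E * ((Q * W (fst p)) * M')"
        using True u by (intro mult_mono gb wtb[OF z bc] M'(2) bc) (auto simp: pos)
      also have "\<dots> = G p" using True by (simp add: G_def)
      finally show ?thesis .
    next
      case False
      then have "\<kappa> z u p = 0" by (auto simp: \<kappa>_def wt_diag indicator_def)
      then show ?thesis using pos M'(1) by (simp add: G_def)
    qed
    have "cball \<alpha> r \<subseteq> {z. Re z > ?h}" using Rz a by force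
    then show ?thesis using r Gi bound by blast
  qed
  have main: "(\<Prod>j\<in>(UNIV :: 'm set). pochhammer ((\<alpha> - of_nat (rk j)) / 2) N) *
        (enn2real (slab_const TYPE('m) TYPE('k)) *\<^sub>R
          (\<integral>x. cpow (gram (transpose u ** x)) ((\<alpha> - of_nat CARD('k)) / 2) * g x \<partial>lborel)) =
      (\<integral>p. \<kappa> \<alpha> u p \<partial>lborel)" if \<alpha>: "Re \<alpha> > real CARD('m) - 1" and u: "u \<in> stiefel" for \<alpha> u
  proof -
    let ?P = "\<Prod>j\<in>(UNIV :: 'm set). pochhammer ((\<alpha> - of_nat (rk j)) / 2) N"
    let ?c = "\<lambda>x. cpow (gram (transpose u ** x)) (\<alpha> / 2)"
    let ?K = "real CARD('k)"
    have gr: "(gram (transpose u ** x) powr (- ?K / 2)) *\<^sub>R (?c x * g x) =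
        cpow (gram (transpose u ** x)) ((\<alpha> - of_nat CARD('k)) / 2) * g x" for x
    proof -
      have "complex_of_real (gram (transpose u ** x) powr (- ?K / 2)) = cpow (gram (transpose u ** x)) (- of_nat CARD('k) / 2)"
        by (subst cpow_of_real[symmetric]) (auto simp: gram_nonneg)
      then show ?thesis
        by (simp add: scaleR_conv_of_real mult.assoc[symmetric] powr_add[symmetric] diff_divide_distrib)
    qed
    obtain c0 where c0: "\<forall>u \<in> (stiefel :: (real^'k^'n) set).
      (\<integral>\<^sup>+x. indicator (cball 0 A) x * ennreal (gram (transpose u ** (x :: real^'m^'n)) powr ((Re \<alpha> - ?K) / 2)) \<partial>lborel) \<le> ennreal c0"
      using gram_powr_nn_bound[OF kn \<alpha>, where A=A] by (elim exE)
    have "bounded (g ` cball 0 A)"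
      by (intro compact_imp_bounded compact_continuous_image compact_cball continuous_on_subset[OF gc] subset_UNIV)
    then obtain Mg where Mg: "\<And>x. x \<in> cball 0 A \<Longrightarrow> norm (g x) \<le> Mg" unfolding bounded_iff by blast
    have int: "integrable lborel (\<lambda>x. (gram (transpose u ** x) powr (- ?K / 2)) *\<^sub>R (?c x * g x))"
    proof (rule integrableI_bounded)
      have "(\<integral>\<^sup>+x. ennreal (norm ((gram (transpose u ** x) powr (- ?K / 2)) *\<^sub>R (?c x * g x))) \<partial>lborel) \<le>
        (\<integral>\<^sup>+x. ennreal \<bar>Mg\<bar> * (indicator (cball 0 A) x * ennreal (gram (transpose u ** (x :: real^'m^'n)) powr ((Re \<alpha> - ?K) / 2))) \<partial>lborel)"
      proof (rule nn_integral_mono)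
        fix x :: "real^'m^'n"
        show "ennreal (norm ((gram (transpose u ** x) powr (- ?K / 2)) *\<^sub>R (?c x * g x))) \<le>
          ennreal \<bar>Mg\<bar> * (indicator (cball 0 A) x * ennreal (gram (transpose u ** x) powr ((Re \<alpha> - ?K) / 2)))"
        proof (cases "g x = 0")
          case False
          then have x: "x \<in> cball 0 A" using supp by simp
          have "norm (cpow (gram (transpose u ** x)) ((\<alpha> - of_nat CARD('k)) / 2) * g x) \<le>
              gram (transpose u ** x) powr ((Re \<alpha> - ?K) / 2) * \<bar>Mg\<bar>"
            using Mg[OF x] by (simp add: norm_mult norm_cpow gram_nonneg mult_left_mono)
          then show ?thesis unfolding gr using x
            by (simp add: ennreal_mult[symmetric] mult.commute)
        qed simp
      qed
      also have "\<dots> = ennreal \<bar>Mg\<bar> * (\<integral>\<^sup>+x. indicator (cball 0 A) x * ennreal (gram (transpose u ** (x :: real^'m^'n)) powr ((Re \<alpha> - ?K) / 2)) \<partial>lborel)"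
      proof (rule nn_integral_cmult)
        have [measurable]: "(indicator (cball 0 A) :: real^'m^'n \<Rightarrow> ennreal) \<in> borel_measurable borel"
          by (intro borel_measurable_indicator) simp
        show "(\<lambda>x. indicator (cball 0 A) x * ennreal (gram (transpose u ** (x :: real^'m^'n)) powr ((Re \<alpha> - ?K) / 2))) \<in> borel_measurable lborel"
          by measurable
      qed
      also have "\<dots> < \<infinity>" using bspec[OF c0 u] by (simp add: ennreal_mult_less_top le_less_trans)
      finally show "(\<integral>\<^sup>+x. ennreal (norm ((gram (transpose u ** x) powr (- ?K / 2)) *\<^sub>R (?c x * g x))) \<partial>lborel) < \<infinity>" .
    qed measurable
    have cm: "(\<lambda>x. ?c x * g x) \<in> borel_measurable borel" by measurable
    define R where "R b x = indicator slab (transpose u ** x) * indicator (cball 0 B') x * ?c x * (wt (expo \<alpha>) b * f ((u, x), b))" for b x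
    \<comment> \<open>On the support of g (\<open>stretch u b x\<close>) the ball indicator is 1 by
      \<open>f0\<close>, and the Haar weight combines with the stretched Gram determinant into
      \<open>wt\<close>; where the support or slab condition fails, both sides vanish.\<close>
    have Req: "(haar_weight b * indicator slab (transpose u ** x)) *\<^sub>R (?c (stretch u b x) * g (stretch u b x)) = R b x" for b x
    proof (cases "transpose u ** x \<in> slab \<and> b \<in> lowbox \<and> g (stretch u b x) \<noteq> 0")
      case True
      then have "norm x \<le> B'" using f0[OF u, of x b] by (simp add: f_def)
      moreover have "complex_of_real (haar_weight b) * ?c (stretch u b x) = wt (expo \<alpha>) b * ?c x"
        using haar_weight_cpow[of b "transpose u ** x" \<alpha>] by (simp add: transpose_stretch[OF u])
      ultimately show ?thesis using True
        by (simp add: R_def f_def scaleR_conv_of_real mult_ac)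
    next
      case False
      then show ?thesis by (auto simp: R_def f_def haar_weight_def wt_diag)
    qed
    have Ri: "integrable (lborel \<Otimes>\<^sub>M lborel) (\<lambda>(b, x). R b x)"
      using stretch_integral(1)[OF u kn cm int] unfolding Req lborel_prod .
    have "enn2real (slab_const TYPE('m) TYPE('k)) *\<^sub>R
          (\<integral>x. cpow (gram (transpose u ** x)) ((\<alpha> - of_nat CARD('k)) / 2) * g x \<partial>lborel) = (\<integral>(b, x). R b x \<partial>lborel)"
      using stretch_integral(2)[OF u kn cm int] unfolding Req gr by simp
    also have "\<dots> = (\<integral>x. (\<integral>b. R b x \<partial>lborel) \<partial>lborel)"
      unfolding lborel_prod[symmetric] by (rule lborel_pair.integral_snd[OF Ri, symmetric])
    finally have eq1: "enn2real (slab_const TYPE('m) TYPE('k)) *\<^sub>R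
          (\<integral>x. cpow (gram (transpose u ** x)) ((\<alpha> - of_nat CARD('k)) / 2) * g x \<partial>lborel) = (\<integral>x. (\<integral>b. R b x \<partial>lborel) \<partial>lborel)" .
    have P: "?P = (\<Prod>e\<in>range (diag_unit :: 'm \<Rightarrow> real^'m^'m). pochhammer (expo \<alpha> e / 2) N)"
      by (subst prod.reindex) (auto simp: inj_def expo_def)
    \<comment> \<open>For fixed u and x the Gram factor is a constant in b, and the shift formula
      acts on the integral over b alone.\<close>
    have inner: "?P * (\<integral>b. R b x \<partial>lborel) = (\<integral>b. \<kappa> \<alpha> u (b, x) \<partial>lborel)" for x
    proof (cases "transpose u ** x \<in> slab \<and> x \<in> cball 0 B'")
      case True
      then have "(u, x) \<in> S" using u by (simp add: S_def)
      moreover have "\<forall>e\<in>range (diag_unit :: 'm \<Rightarrow> real^'m^'m). Re (expo \<alpha> e) > 0" using expo_pos[OF \<alpha>] by simp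
      ultimately have "?P * (\<integral>b. wt (expo \<alpha>) b * f ((u, x), b) \<partial>lborel) = (\<integral>b. wt (?ex \<alpha>) b * f' ((u, x), b) \<partial>lborel)"
        unfolding P by (rule shift)
      then have *: "?c x * (?P * (\<integral>b. wt (expo \<alpha>) b * f ((u, x), b) \<partial>lborel)) = ?c x * (\<integral>b. wt (?ex \<alpha>) b * f' ((u, x), b) \<partial>lborel)"
        by (simp only:)
      have Rb: "R b x = ?c x * (wt (expo \<alpha>) b * f ((u, x), b))" for b using True by (simp add: R_def)
      have \<kappa>b: "\<kappa> \<alpha> u (b, x) = ?c x * (wt (?ex \<alpha>) b * f' ((u, x), b))" for b using True by (simp add: \<kappa>_def)
      show ?thesis
        unfolding Rb \<kappa>b integral_mult_right_zero *[symmetric] by (rule mult.left_commute)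
    next
      case False
      then have "R b x = 0" "\<kappa> \<alpha> u (b, x) = 0" for b by (auto simp: R_def \<kappa>_def)
      then show ?thesis by simp
    qed
    have \<kappa>i: "integrable lborel (\<kappa> \<alpha> u)"
    proof -
      have "Re \<alpha> > ?h" using \<alpha> by simp
      from dom[OF this] obtain r G where "r > 0" "integrable lborel G" "\<forall>z\<in>cball \<alpha> r. \<forall>u\<in>stiefel. \<forall>p. norm (\<kappa> z u p) \<le> G p"
        by blast
      then have G: "integrable lborel G" "\<And>p. norm (\<kappa> \<alpha> u p) \<le> G p" using u by auto
      show ?thesis
        by (rule Bochner_Integration.integrable_bound[OF G(1)]) (use measu G(2) in \<open>auto intro!: AE_I2 order.trans[OF G(2)]\<close>)
    qed
    have "?P * (\<integral>x. (\<integral>b. R b x \<partial>lborel) \<partial>lborel) = (\<integral>x. (\<integral>b. \<kappa> \<alpha> u (b, x) \<partial>lborel) \<partial>lborel)"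
      unfolding inner[symmetric] by simp
    also have "\<dots> = (\<integral>(b, x). \<kappa> \<alpha> u (b, x) \<partial>(lborel \<Otimes>\<^sub>M lborel))"
      by (rule lborel_pair.integral_snd) (use \<kappa>i in \<open>simp add: lborel_prod\<close>)
    also have "\<dots> = (\<integral>p. \<kappa> \<alpha> u p \<partial>lborel)" by (simp add: lborel_prod)
    finally show ?thesis unfolding eq1 .
  qed
  show ?thesis by (rule that[OF hol meas dom main])
qed

section \<open>Uniform convergence, Gamma factors and the mass of the bump\<close>

lemma cpow_exp: "t > 0 \<Longrightarrow> cpow t z = exp (z * complex_of_real (ln t))"
  by (simp add: powr_def Ln_of_real)

text \<open>The argument of the power is at most 1 in modulus, hence less than pi/2. Positivity of
  the real part will rule out cancellation in the mass of the bump.\<close>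

lemma norm_cpow_near_1:
  assumes "t > 0" "norm z * \<bar>ln t\<bar> \<le> 1"
  shows "norm (cpow t z) \<le> exp 1" "Re (cpow t z) > 0"
proof -
  have R: "\<bar>Re z * ln t\<bar> \<le> 1" and I: "\<bar>Im z * ln t\<bar> \<le> 1"
    using assms(2) mult_right_mono[OF abs_Re_le_cmod[of z], of "\<bar>ln t\<bar>"] mult_right_mono[OF abs_Im_le_cmod[of z], of "\<bar>ln t\<bar>"]
    by (auto simp: abs_mult)
  show "norm (cpow t z) \<le> exp 1" using R assms(1) by (simp add: cpow_exp)
  have "cos (Im z * ln t) > 0"
    using I pi_gt3 by (intro cos_gt_zero_pi) (auto simp: abs_le_iff)
  then show "Re (cpow t z) > 0" using assms(1) by (simp add: cpow_exp Re_exp)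
qed

lemma smooth_imp_continuous_on:
  assumes "smooth_on_submanifold S f" shows "continuous_on S f"
  unfolding continuous_on_eq_continuous_within
proof
  fix x assume x: "x \<in> S"
  from bspec[OF assms[unfolded smooth_on_submanifold_def] this] obtain U F where
    "open U \<and> x \<in> U \<and> (\<forall>r. higher_differentiable_on U F r) \<and> (\<forall>y\<in>U \<inter> S. F y = f y)"
    by (elim exE)
  then have U: "open U" "x \<in> U" "higher_differentiable_on U F 0" "\<And>y. y \<in> U \<inter> S \<Longrightarrow> F y = f y"
    by (simp_all del: higher_differentiable_on.simps)
  have "continuous (at x) F"
    using U(1-3) by (simp add: continuous_on_eq_continuous_at)
  then have F: "continuous (at x within S) F" by (rule continuous_at_imp_continuous_at_within)
  obtain e where e: "e > 0" "ball x e \<subseteq> U" using U(1,2) by (meson openE)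
  show "continuous (at x within S) f"
  proof (rule continuous_transform_within[OF F e(1) x])
    fix y assume "y \<in> S" "dist y x < e"
    then have "y \<in> U \<inter> S" using e(2) by (auto simp: dist_commute)
    then show "F y = f y" by (rule U(4))
  qed
qed

lemma gram_transpose_orth: "gram (transpose u ** x) = gram x * gram (transpose u ** orth x)"
proof -
  have "transpose u ** x = transpose u ** orth x ** tri x" by (metis matrix_mul_assoc orth_tri)
  then show ?thesis by (simp add: gram_mult gram_tri[of x])
qed

text \<open>The bound for matrices descends to the manifold: weighting the slab with the same power
  of \<open>gram x\<close> makes the lifted integrand a power of \<open>gram (u' x)\<close> on a
  ball, and the total mass of the weight is positive.\<close>

lemma stiefel_gram_powr_bound:
  fixes \<mu> :: "(real^'m^'n) measure"
  assumes \<mu>: "stiefel_measure \<mu>" and mn: "CARD('m) \<le> CARD('n)" and kn: "CARD('k) \<le> CARD('n)"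
    and a: "a > real CARD('m) - 1"
  shows "\<exists>c :: real. \<forall>u \<in> (stiefel :: (real^'k^'n) set).
    (\<integral>\<^sup>+v. ennreal (gram (transpose u ** v) powr ((a - real CARD('k)) / 2)) \<partial>\<mu>) \<le> ennreal c"
proof -
  let ?e = "(a - real CARD('k)) / 2"
  let ?A = "3 * real CARD('m)"
  obtain c where c: "\<forall>u \<in> (stiefel :: (real^'k^'n) set).
    (\<integral>\<^sup>+x. indicator (cball 0 ?A) x * ennreal (gram (transpose u ** (x :: real^'m^'n)) powr ?e) \<partial>lborel) \<le> ennreal c"
    using gram_powr_nn_bound[OF kn a, where A="?A"] by (elim exE)
  define w where "w x = indicator slab x * ennreal (gram x powr ?e)" for x :: "real^'m^'n"
  have [measurable]: "w \<in> borel_measurable borel" unfolding w_def by measurable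
  have "(\<integral>\<^sup>+x. w x \<partial>lborel) \<noteq> 0"
  proof
    assume "(\<integral>\<^sup>+x. w x \<partial>lborel) = 0"
    then have "AE x in lborel. w x = 0" by (subst (asm) nn_integral_0_iff_AE) measurable
    then have "AE x in lborel. x \<notin> (slab :: (real^'m^'n) set)"
    proof eventually_elim
      case (elim x)
      show ?case
      proof
        assume "x \<in> slab"
        then have "gram x > 0" by (auto simp: slab_def)
        then show False using elim \<open>x \<in> slab\<close> by (simp add: w_def)
      qed
    qed
    then have "emeasure lborel (slab :: (real^'m^'n) set) = 0"
      by (subst (asm) AE_iff_measurable[OF _ refl]) auto
    then show False using emeasure_slab(1)[OF mn] by simp
  qed
  moreover define W where "W = (\<integral>\<^sup>+x. w x \<partial>lborel)"
  ultimately have "W \<noteq> 0" by simp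
  \<comment> \<open>Only a positive real lower bound for W is required, so the extended real value
    need not be known to be finite.\<close>
  then obtain d :: real where d: "d > 0" "ennreal d \<le> W"
  proof (cases "W = \<infinity>")
    case True
    then show ?thesis using that[of 1] by simp
  next
    case False
    then show ?thesis using \<open>W \<noteq> 0\<close> that[of "enn2real W"]
      by (simp add: enn2real_positive_iff less_top zero_less_iff_neq_zero)
  qed
  show ?thesis
  proof (intro exI[of _ "max 0 c / d"] ballI)
    fix u :: "real^'k^'n" assume u: "u \<in> stiefel"
    let ?I = "\<integral>\<^sup>+v. ennreal (gram (transpose u ** v) powr ?e) \<partial>\<mu>"
    have "ennreal d * ?I \<le> W * ?I" using d(2) by (rule mult_right_mono) simp
    also have "\<dots> = (\<integral>\<^sup>+x. w x * ennreal (gram (transpose u ** orth x) powr ?e) \<partial>lborel)"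
      unfolding W_def
    proof (rule stiefel_measure_lift_nn[OF \<mu> mn, symmetric])
      fix q :: "real^'n^'n" and x :: "real^'m^'n" assume "orthogonal_matrix q"
      then have "q \<in> stiefel" by (simp add: stiefel_def orthogonal_matrix)
      then show "w (q ** x) = w x" by (simp add: w_def slab_isometry_mult gram_isometry_mult indicator_def)
    next
      show "w x = 0" if "gram x = 0" for x using that by (simp add: w_def)
    qed measurable
    also have "\<dots> \<le> (\<integral>\<^sup>+x. indicator (cball 0 ?A) x * ennreal (gram (transpose u ** (x :: real^'m^'n)) powr ?e) \<partial>lborel)"
    proof (rule nn_integral_mono)
      fix x :: "real^'m^'n"
      show "w x * ennreal (gram (transpose u ** orth x) powr ?e) \<le> indicator (cball 0 ?A) x * ennreal (gram (transpose u ** x) powr ?e)"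
      proof (cases "x \<in> slab")
        case True
        then have "norm x \<le> ?A" by (simp add: slab_def)
        then show ?thesis using True
          by (simp add: w_def gram_transpose_orth[of u x] powr_mult gram_nonneg ennreal_mult)
      qed (simp add: w_def)
    qed
    also have "\<dots> \<le> ennreal c" using c u by blast
    also have "\<dots> \<le> ennreal d * ennreal (max 0 c / d)"
      using d(1) by (simp add: ennreal_mult[symmetric] ennreal_leI)
    finally show "?I \<le> ennreal (max 0 c / d)"
      using d(1) by (subst (asm) ennreal_mult_le_mult_iff) auto
  qed
qed

text \<open>Phrased with the entire function \<open>rGamma\<close>. The equation also holds at the
  poles, where \<open>Gamma\<close> has the value 0 and \<open>inverse 0 = 0\<close> matches the
  zero of \<open>rGamma\<close>.\<close>

lemma inverse_siegel_gamma:
  "1 / siegel_gamma CARD('m) (\<alpha> / 2) =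
    inverse (complex_of_real (pi powr (real (CARD('m) * (CARD('m) - 1)) / 4))) *
    (\<Prod>j\<in>(UNIV :: 'm::finite set). rGamma ((\<alpha> - of_nat (rk j)) / 2))"
proof -
  have "(\<Prod>j<CARD('m). Gamma (\<alpha> / 2 - of_nat j / 2)) = (\<Prod>j\<in>(UNIV :: 'm set). Gamma (\<alpha> / 2 - of_nat (rk j) / 2))"
    by (rule prod.reindex_bij_betw[OF bij_betw_rk, symmetric])
  then have G: "siegel_gamma CARD('m) (\<alpha> / 2) = complex_of_real (pi powr (real (CARD('m) * (CARD('m) - 1)) / 4)) *
      (\<Prod>j\<in>(UNIV :: 'm set). Gamma ((\<alpha> - of_nat (rk j)) / 2))"
    by (simp only: siegel_gamma_def diff_divide_distrib)
  have r: "(\<Prod>j\<in>(UNIV :: 'm set). rGamma ((\<alpha> - of_nat (rk j)) / 2)) =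
      inverse (\<Prod>j\<in>(UNIV :: 'm set). Gamma ((\<alpha> - of_nat (rk j)) / 2))"
    using prod_inversef[of "\<lambda>j :: 'm. Gamma ((\<alpha> - of_nat (rk j)) / 2)" UNIV]
    by (simp only: rGamma_inverse_Gamma o_def)
  have "1 / (a * b) = inverse a * inverse b" for a b :: complex by (simp add: divide_inverse)
  then show ?thesis unfolding G r .
qed

text \<open>The Pochhammer symbols are those produced by N integrations by parts in each diagonal
  entry; what is left is entire and can be multiplied in afterwards.\<close>

lemma rGamma_prod_shift:
  "(\<Prod>j\<in>(UNIV :: 'm::finite set). rGamma ((\<alpha> - of_nat (rk j)) / 2)) =
   (\<Prod>j\<in>(UNIV :: 'm set). pochhammer ((\<alpha> - of_nat (rk j)) / 2) N) *
   (\<Prod>j\<in>(UNIV :: 'm set). rGamma ((\<alpha> - of_nat (rk j)) / 2 + of_nat N))"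
  by (simp add: prod.distrib[symmetric] pochhammer_rGamma[symmetric])

text \<open>This mass will be divided out, so it must have no zeros for exponents up to size R. If
  \<open>gram x\<close> is so near 1 that |z| |ln (gram x)| \<le> 1, the integrand has positive real
  part wherever the bump is positive. The admissible \<delta> therefore depends on R.\<close>

lemma bump_mass:
  fixes R :: real
  assumes mn: "CARD('m) \<le> CARD('n)" and R: "R > 0"
  obtains \<delta> where "0 < \<delta>" "\<delta> \<le> 1"
    "\<And>x :: real^'m^'n. norm (transpose x ** x - mat 1) < \<delta> \<Longrightarrow> gram x \<noteq> 0"
    "\<And>r z. norm z \<le> R \<Longrightarrow> integrable lborel (\<lambda>x :: real^'m^'n. bump r \<delta> x *\<^sub>R cpow (gram x) z)"
    "\<And>r. (\<lambda>z. \<integral>x. bump r \<delta> (x :: real^'m^'n) *\<^sub>R cpow (gram x) z \<partial>lborel) holomorphic_on ball 0 R"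
    "\<And>r z. norm z \<le> R \<Longrightarrow> (\<integral>x. bump r \<delta> (x :: real^'m^'n) *\<^sub>R cpow (gram x) z \<partial>lborel) \<noteq> 0"
proof -
  have "isCont ln (1 :: real)" by (rule isCont_ln) simp
  from this[unfolded continuous_at_eps_delta, rule_format, of "1 / R"] R
  obtain d where d: "d > 0" "\<And>t :: real. dist t 1 < d \<Longrightarrow> dist (ln t) (ln 1) < 1 / R" by auto
  \<comment> \<open>The bound 1/2 keeps \<open>gram x\<close> positive, and d keeps its logarithm
    below 1/R.\<close>
  define \<eta> where "\<eta> = min (1/2) d"
  have "\<eta> > 0" using d(1) by (simp add: \<eta>_def)
  then obtain \<delta> where \<delta>: "0 < \<delta>" "\<delta> \<le> 1" "\<And>x :: real^'m^'n. norm (transpose x ** x - mat 1) < \<delta> \<Longrightarrow> \<bar>gram x - 1\<bar> < \<eta>"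
    using gram_near_1 by metis
  have near: "gram x > 0 \<and> norm z * \<bar>ln (gram x)\<bar> \<le> 1" if "norm (transpose x ** x - mat 1) < \<delta>" "norm z \<le> R"
    for x :: "real^'m^'n" and z :: complex
  proof -
    have g: "\<bar>gram x - 1\<bar> < \<eta>" by (rule \<delta>(3)[OF that(1)])
    then have "\<bar>ln (gram x)\<bar> \<le> 1 / R" using d(2)[of "gram x"] by (simp add: \<eta>_def dist_real_def)
    then have "norm z * \<bar>ln (gram x)\<bar> \<le> R * (1 / R)" using that(2) R by (intro mult_mono) auto
    moreover have "gram x > 0" using g unfolding \<eta>_def by linarith
    ultimately show ?thesis using R by simp
  qed
  have bn: "norm (transpose x ** x - mat 1) < \<delta>" if "bump r \<delta> x \<noteq> 0" for r and x :: "real^'m^'n"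
    using bump_nz[OF that \<delta>(1)] \<delta>(1) by linarith
  have bc: "continuous_on UNIV (bump r \<delta> :: real^'m^'n \<Rightarrow> real)" for r
    by (rule higher_differentiable_on_imp_continuous_on[OF higher_differentiable_on_bump])
  have bm [measurable]: "(bump r \<delta> :: real^'m^'n \<Rightarrow> real) \<in> borel_measurable borel" for r
    by (rule borel_measurable_continuous_onI[OF bc])
  have bi: "integrable lborel (bump r \<delta> :: real^'m^'n \<Rightarrow> real)" for r
  proof -
    have "bounded ((bump r \<delta> :: real^'m^'n \<Rightarrow> real) ` cball 0 (2 * real CARD('m)))"
      by (intro compact_imp_bounded compact_continuous_image compact_cball continuous_on_subset[OF bc] subset_UNIV)
    then obtain M where M: "\<And>x :: real^'m^'n. x \<in> cball 0 (2 * real CARD('m)) \<Longrightarrow> norm (bump r \<delta> x) \<le> M"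
      unfolding bounded_iff by blast
    have i: "integrable lborel (\<lambda>x. \<bar>M\<bar> * indicator (cball 0 (2 * real CARD('m))) (x :: real^'m^'n))"
      using emeasure_bounded_finite[OF bounded_cball, of "0 :: real^'m^'n" "2 * real CARD('m)"]
      by (intro integrable_mult_right integrable_real_indicator) auto
    show ?thesis
    proof (rule Bochner_Integration.integrable_bound[OF i])
      show "AE x in lborel. norm (bump r \<delta> x) \<le> norm (\<bar>M\<bar> * indicator (cball 0 (2 * real CARD('m))) (x :: real^'m^'n))"
      proof (rule AE_I2)
        fix x :: "real^'m^'n"
        show "norm (bump r \<delta> x) \<le> norm (\<bar>M\<bar> * indicator (cball 0 (2 * real CARD('m))) x)"
        proof (cases "bump r \<delta> x = 0")
          case False
          then have x: "x \<in> cball 0 (2 * real CARD('m))" using bump_norm[OF False \<delta>(1,2)] by simp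
          then show ?thesis using M[OF x] by simp
        qed simp
      qed
    qed measurable
  qed
  have cm: "(\<lambda>x :: real^'m^'n. bump r \<delta> x *\<^sub>R cpow (gram x) z) \<in> borel_measurable borel" for r z by measurable
  have bound: "norm (bump r \<delta> x *\<^sub>R cpow (gram x) z) \<le> exp 1 * bump r \<delta> x" if "norm z \<le> R" for r z and x :: "real^'m^'n"
  proof (cases "bump r \<delta> x = 0")
    case False
    then show ?thesis
      using norm_cpow_near_1(1)[of "gram x" z] near[OF bn[OF False] that] bump_nonneg[of r \<delta> x]
      by (simp add: mult.commute mult_right_mono)
  qed simp
  have int: "integrable lborel (\<lambda>x :: real^'m^'n. bump r \<delta> x *\<^sub>R cpow (gram x) z)" if "norm z \<le> R" for r z
  proof (rule Bochner_Integration.integrable_bound)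
    show "integrable lborel (\<lambda>x :: real^'m^'n. exp 1 * bump r \<delta> x)" using bi by simp
    show "AE x in lborel. norm (bump r \<delta> x *\<^sub>R cpow (gram x) z) \<le> norm (exp 1 * bump r \<delta> (x :: real^'m^'n))"
    proof (rule AE_I2)
      fix x :: "real^'m^'n"
      have "norm (exp 1 * bump r \<delta> x) = exp 1 * bump r \<delta> x" using bump_nonneg[of r \<delta> x] by (simp add: abs_mult)
      then show "norm (bump r \<delta> x *\<^sub>R cpow (gram x) z) \<le> norm (exp 1 * bump r \<delta> x)"
        using bound[OF that, of r x] by (simp only:)
    qed
  qed (use cm in simp)
  have hol: "(\<lambda>z. \<integral>x. bump r \<delta> (x :: real^'m^'n) *\<^sub>R cpow (gram x) z \<partial>lborel) holomorphic_on ball 0 R" for r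
  proof (rule holomorphic_on_integral)
    show "(\<lambda>z. bump r \<delta> x *\<^sub>R cpow (gram x) z) holomorphic_on ball 0 R" for x :: "real^'m^'n"
      unfolding scaleR_conv_of_real by (intro holomorphic_intros)
    fix w :: complex assume "w \<in> ball 0 R"
    then obtain e where e: "e > 0" "cball w e \<subseteq> ball 0 R" using open_contains_cball open_ball by metis
    have "norm z \<le> R" if "z \<in> cball w e" for z using e(2) that by (meson in_mono less_imp_le mem_ball_0)
    then show "\<exists>r'>0. \<exists>G. cball w r' \<subseteq> ball 0 R \<and> integrable lborel G \<and>
        (\<forall>z\<in>cball w r'. \<forall>x\<in>space lborel. norm (bump r \<delta> (x :: real^'m^'n) *\<^sub>R cpow (gram x) z) \<le> G x)"
      using e bi[of r] bound by (intro exI[of _ e] conjI exI[of _ "\<lambda>x. exp 1 * bump r \<delta> x"]) auto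
  qed (use cm in auto)
  have nz: "(\<integral>x. bump r \<delta> (x :: real^'m^'n) *\<^sub>R cpow (gram x) z \<partial>lborel) \<noteq> 0" if z: "norm z \<le> R" for r z
  proof
    assume 0: "(\<integral>x. bump r \<delta> (x :: real^'m^'n) *\<^sub>R cpow (gram x) z \<partial>lborel) = 0"
    let ?q = "\<lambda>x :: real^'m^'n. bump r \<delta> x * Re (cpow (gram x) z)"
    have q: "?q x > 0" if "bump r \<delta> x \<noteq> 0" for x
      using norm_cpow_near_1(2)[of "gram x" z] near[OF bn[OF that] z] bump_nonneg[of r \<delta> x] that by simp
    have q0: "?q x \<ge> 0" for x using q[of x] by (cases "bump r \<delta> x = 0") auto
    have qi: "integrable lborel ?q" using integrable_Re[OF int[OF z, of r]] by simp
    have "(\<integral>x. ?q x \<partial>lborel) = 0" using integral_Re[OF int[OF z, of r]] 0 by simp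
    then have "AE x in lborel. ?q x = 0" using integral_nonneg_eq_0_iff_AE[OF qi] q0 by simp
    then have AE: "AE x in lborel. bump r \<delta> (x :: real^'m^'n) = 0"
      by eventually_elim (use q in force)
    obtain \<iota> :: "'m \<Rightarrow> 'n" where \<iota>: "inj \<iota>" using exists_inj_index[OF mn] by blast
    let ?U = "{x :: real^'m^'n. 0 < bump r \<delta> x}"
    have "open ?U" by (intro open_Collect_less continuous_intros bc)
    moreover have "frame \<iota> \<in> ?U" using frame_stiefel[OF \<iota>] by (simp add: bump_stiefel)
    ultimately obtain e where e: "e > 0" "ball (frame \<iota>) e \<subseteq> ?U" by (meson openE)
    have "AE x in lborel. x \<notin> ball (frame \<iota> :: real^'m^'n) e"
      using AE by eventually_elim (use e(2) in force)
    then have "emeasure lborel (ball (frame \<iota> :: real^'m^'n) e) = 0"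
      by (subst (asm) AE_iff_measurable[OF _ refl]) (auto simp: ball_def)
    then show False using e(1) unit_ball_vol_nonzero[of "CARD('n) * CARD('m)"] by (simp add: emeasure_ball)
  qed
  show ?thesis
  proof (rule that[OF \<delta>(1,2) _ int hol nz])
    show "gram x \<noteq> 0" if "norm (transpose x ** x - mat 1) < \<delta>" for x :: "real^'m^'n"
      using near[OF that, of 0] R by simp
  qed
qed

section \<open>The zeta integral\<close>

context
  fixes \<mu> :: "(real^'m^'n) measure"
    and \<nu> :: "(real^'k^'n) measure"
    and \<phi> :: "real^'k^'n \<Rightarrow> complex"
    and \<omega> :: "real^'m^'n \<Rightarrow> complex"
  assumes mn: "CARD('m) \<le> CARD('n)" and kn: "CARD('k) \<le> CARD('n)"
    and \<mu>: "stiefel_measure \<mu>" and \<nu>: "stiefel_measure \<nu>"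
    and \<phi>: "integrable \<nu> \<phi>" and \<omega>: "smooth_on_submanifold stiefel \<omega>"
begin

text \<open>The values of \<omega> off the manifold are arbitrary; cutting them off makes the
  function Borel measurable and bounded on the whole matrix space.\<close>

definition \<omega>' :: "real^'m^'n \<Rightarrow> complex" where
  "\<omega>' v = indicator stiefel v * cnj (\<omega> v)"

lemma \<omega>'_measurable [measurable]: "\<omega>' \<in> borel_measurable borel"
proof -
  have "(\<lambda>v. indicator stiefel v *\<^sub>R cnj (\<omega> v)) \<in> borel_measurable borel"
    by (intro borel_measurable_continuous_on_indicator stiefel_borel continuous_intros smooth_imp_continuous_on[OF \<omega>])
  moreover have "indicator stiefel v *\<^sub>R cnj (\<omega> v) = \<omega>' v" for v
    by (cases "v \<in> stiefel") (simp_all add: \<omega>'_def)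
  ultimately show ?thesis by simp
qed

lemma \<omega>'_bounded: "\<exists>M\<ge>0. \<forall>v. norm (\<omega>' v) \<le> M"
proof -
  have "bounded (\<omega> ` stiefel)"
    by (intro compact_imp_bounded compact_continuous_image compact_stiefel smooth_imp_continuous_on[OF \<omega>])
  then obtain M where M: "\<forall>y\<in>\<omega> ` stiefel. norm y \<le> M" unfolding bounded_iff by blast
  have "norm (\<omega>' v) \<le> max 0 M" for v
    using M by (cases "v \<in> stiefel") (auto simp: \<omega>'_def le_max_iff_disj)
  then show ?thesis by (intro exI[of _ "max 0 M"]) simp
qed

definition kern :: "complex \<Rightarrow> real^'k^'n \<Rightarrow> real^'m^'n \<Rightarrow> complex" where
  "kern \<alpha> u v = cpow (gram (transpose u ** v)) ((\<alpha> - of_nat CARD('k)) / 2)"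

lemma norm_kern: "norm (kern \<alpha> u v) = gram (transpose u ** v) powr ((Re \<alpha> - real CARD('k)) / 2)"
  by (simp add: kern_def norm_cpow gram_nonneg)

lemma kern_bound:
  assumes "Re \<alpha> > real CARD('m) - 1"
  obtains c :: real where "\<And>u. u \<in> stiefel \<Longrightarrow> (\<integral>\<^sup>+v. ennreal (norm (kern \<alpha> u v)) \<partial>\<mu>) \<le> ennreal c"
  using stiefel_gram_powr_bound[OF \<mu> mn kn assms] unfolding norm_kern by blast

lemma id_measurable [measurable]: "(\<lambda>v. v) \<in> borel_measurable \<mu>" "(\<lambda>u. u) \<in> borel_measurable \<nu>"
  by (rule stiefel_measure_borel[OF \<mu>] stiefel_measure_borel[OF \<nu>], simp)+

lemma kern_measurable: "kern \<alpha> u \<in> borel_measurable borel"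
  unfolding kern_def by measurable

lemma integrable_kern:
  assumes "Re \<alpha> > real CARD('m) - 1" "u \<in> stiefel"
  shows "integrable \<mu> (\<lambda>v. kern \<alpha> u v * \<omega>' v)"
proof -
  obtain c where "(\<integral>\<^sup>+v. ennreal (norm (kern \<alpha> u v)) \<partial>\<mu>) \<le> ennreal c"
    using kern_bound[OF assms(1)] assms(2) by blast
  then have k: "integrable \<mu> (kern \<alpha> u)"
    by (intro integrableI_bounded stiefel_measure_borel[OF \<mu>] kern_measurable) (simp add: le_less_trans)
  obtain M where M: "M \<ge> 0" "\<And>v. norm (\<omega>' v) \<le> M" using \<omega>'_bounded by blast
  show ?thesis
  proof (rule Bochner_Integration.integrable_bound)
    show "integrable \<mu> (\<lambda>v. M * norm (kern \<alpha> u v))" using k by simp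
    show "(\<lambda>v. kern \<alpha> u v * \<omega>' v) \<in> borel_measurable \<mu>"
      by (intro stiefel_measure_borel[OF \<mu>] borel_measurable_times kern_measurable \<omega>'_measurable)
    show "AE v in \<mu>. norm (kern \<alpha> u v * \<omega>' v) \<le> norm (M * norm (kern \<alpha> u v))"
      using M by (intro AE_I2) (simp add: norm_mult mult.commute mult_right_mono)
  qed
qed

lemma dual_cosine_integrand_eq: "dual_cosine_integrand \<phi> \<alpha> v u = \<phi> u * kern \<alpha> u v"
proof -
  have "transpose v ** u ** transpose u ** v = transpose (transpose u ** v) ** (transpose u ** v)"
    by (simp add: matrix_transpose_mul matrix_mul_assoc)
  then have "\<bar>det (transpose v ** u ** transpose u ** v)\<bar> = gram (transpose u ** v)"
    using gram_nonneg[of "transpose u ** v"] by (simp add: gram_def)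
  then show ?thesis by (simp add: dual_cosine_integrand_def kern_def)
qed

lemma \<phi>_measurable [measurable]: "\<phi> \<in> borel_measurable \<nu>"
  using \<phi> by (rule borel_measurable_integrable)

lemma integrable_pair:
  assumes \<alpha>: "Re \<alpha> > real CARD('m) - 1"
  shows "integrable (\<mu> \<Otimes>\<^sub>M \<nu>) (\<lambda>(v, u). \<phi> u * kern \<alpha> u v)"
proof (rule integrableI_bounded)
  interpret M: prob_space \<mu> by (rule stiefel_measureD[OF \<mu>])
  interpret N: prob_space \<nu> by (rule stiefel_measureD[OF \<nu>])
  interpret P: pair_sigma_finite \<mu> \<nu> ..
  have km [measurable]: "(\<lambda>z. kern \<alpha> (snd z) (fst z)) \<in> borel_measurable (\<mu> \<Otimes>\<^sub>M \<nu>)"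
    unfolding kern_def by measurable
  show meas: "(\<lambda>(v, u). \<phi> u * kern \<alpha> u v) \<in> borel_measurable (\<mu> \<Otimes>\<^sub>M \<nu>)"
    unfolding case_prod_unfold by measurable
  obtain c where c: "\<And>u. u \<in> stiefel \<Longrightarrow> (\<integral>\<^sup>+v. ennreal (norm (kern \<alpha> u v)) \<partial>\<mu>) \<le> ennreal c"
    using kern_bound[OF \<alpha>] by blast
  have "(\<integral>\<^sup>+z. ennreal (norm ((\<lambda>(v, u). \<phi> u * kern \<alpha> u v) z)) \<partial>(\<mu> \<Otimes>\<^sub>M \<nu>)) =
      (\<integral>\<^sup>+u. (\<integral>\<^sup>+v. ennreal (norm (\<phi> u * kern \<alpha> u v)) \<partial>\<mu>) \<partial>\<nu>)"
    by (subst P.nn_integral_snd[symmetric]) (use meas in simp_all)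
  also have "\<dots> \<le> (\<integral>\<^sup>+u. ennreal (norm (\<phi> u)) * ennreal c \<partial>\<nu>)"
  proof (rule nn_integral_mono)
    fix u assume "u \<in> space \<nu>"
    then have u: "u \<in> stiefel" by (simp add: stiefel_measureD[OF \<nu>])
    have [measurable]: "kern \<alpha> u \<in> borel_measurable \<mu>" by (rule stiefel_measure_borel[OF \<mu> kern_measurable])
    have "(\<integral>\<^sup>+v. ennreal (norm (\<phi> u * kern \<alpha> u v)) \<partial>\<mu>) = ennreal (norm (\<phi> u)) * (\<integral>\<^sup>+v. ennreal (norm (kern \<alpha> u v)) \<partial>\<mu>)"
      by (subst nn_integral_cmult[symmetric]) (simp_all add: norm_mult ennreal_mult)
    also have "\<dots> \<le> ennreal (norm (\<phi> u)) * ennreal c" by (intro mult_left_mono c u) simp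
    finally show "(\<integral>\<^sup>+v. ennreal (norm (\<phi> u * kern \<alpha> u v)) \<partial>\<mu>) \<le> ennreal (norm (\<phi> u)) * ennreal c" .
  qed
  also have "\<dots> = (\<integral>\<^sup>+u. ennreal (norm (\<phi> u)) \<partial>\<nu>) * ennreal c"
    by (rule nn_integral_multc) measurable
  also have "\<dots> < \<infinity>" using \<phi> by (simp add: integrable_iff_bounded ennreal_mult_less_top)
  finally show "(\<integral>\<^sup>+z. ennreal (norm ((\<lambda>(v, u). \<phi> u * kern \<alpha> u v) z)) \<partial>(\<mu> \<Otimes>\<^sub>M \<nu>)) < \<infinity>" .
qed

text \<open>Tonelli in the order that integrates over v first: the integral of the kernel is bounded
  uniformly in u, so integrability of \<phi> suffices. Fubini then moves \<omega> inside and leaves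
  the pairing as an integral over u.\<close>

lemma convergence:
  assumes \<alpha>: "Re \<alpha> > real CARD('m) - 1"
  shows "AE v in \<mu>. integrable \<nu> (dual_cosine_integrand \<phi> \<alpha> v)"
    and "integrable \<mu> (\<lambda>v. dual_cosine_transform \<nu> \<phi> \<alpha> v * cnj (\<omega> v))"
    and "zeta_dual \<mu> \<nu> \<phi> \<omega> \<alpha> = 1 / siegel_gamma CARD('m) (\<alpha> / 2) *
      (\<integral>u. \<phi> u * (\<integral>v. kern \<alpha> u v * \<omega>' v \<partial>\<mu>) \<partial>\<nu>)"
proof -
  interpret M: prob_space \<mu> by (rule stiefel_measureD[OF \<mu>])
  interpret N: prob_space \<nu> by (rule stiefel_measureD[OF \<nu>])
  interpret P: pair_sigma_finite \<mu> \<nu> ..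
  note int = integrable_pair[OF \<alpha>]
  have "AE v in \<mu>. integrable \<nu> (\<lambda>u. \<phi> u * kern \<alpha> u v)"
    using P.AE_integrable_fst[OF int] by simp
  then show "AE v in \<mu>. integrable \<nu> (dual_cosine_integrand \<phi> \<alpha> v)"
    by (simp add: dual_cosine_integrand_eq[abs_def])
  obtain B where B: "B \<ge> 0" "\<And>v. norm (\<omega>' v) \<le> B" using \<omega>'_bounded by blast
  have int': "integrable (\<mu> \<Otimes>\<^sub>M \<nu>) (\<lambda>(v, u). \<phi> u * kern \<alpha> u v * \<omega>' v)"
  proof (rule Bochner_Integration.integrable_bound)
    show "integrable (\<mu> \<Otimes>\<^sub>M \<nu>) (\<lambda>z. B * norm ((\<lambda>(v, u). \<phi> u * kern \<alpha> u v) z))"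
      using int by (intro integrable_mult_right integrable_norm)
    have [measurable]: "\<omega>' \<in> borel_measurable \<mu>" by (rule stiefel_measure_borel[OF \<mu> \<omega>'_measurable])
    have [measurable]: "(\<lambda>z. \<phi> (snd z) * kern \<alpha> (snd z) (fst z)) \<in> borel_measurable (\<mu> \<Otimes>\<^sub>M \<nu>)"
      using borel_measurable_integrable[OF int] by (simp add: case_prod_unfold)
    show "(\<lambda>(v, u). \<phi> u * kern \<alpha> u v * \<omega>' v) \<in> borel_measurable (\<mu> \<Otimes>\<^sub>M \<nu>)"
      unfolding case_prod_unfold by measurable
    show "AE z in \<mu> \<Otimes>\<^sub>M \<nu>. norm ((\<lambda>(v, u). \<phi> u * kern \<alpha> u v * \<omega>' v) z) \<le> norm (B * norm ((\<lambda>(v, u). \<phi> u * kern \<alpha> u v) z))"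
    proof (rule AE_I2)
      fix z
      have "norm (\<phi> (snd z) * kern \<alpha> (snd z) (fst z)) * norm (\<omega>' (fst z)) \<le> norm (\<phi> (snd z) * kern \<alpha> (snd z) (fst z)) * B"
        by (rule mult_left_mono[OF B(2)]) simp
      then show "norm ((\<lambda>(v, u). \<phi> u * kern \<alpha> u v * \<omega>' v) z) \<le> norm (B * norm ((\<lambda>(v, u). \<phi> u * kern \<alpha> u v) z))"
        using B(1) by (simp add: case_prod_unfold norm_mult mult_ac)
    qed
  qed
  have T: "(\<integral>u. \<phi> u * kern \<alpha> u v * \<omega>' v \<partial>\<nu>) = dual_cosine_transform \<nu> \<phi> \<alpha> v * cnj (\<omega> v)" if "v \<in> space \<mu>" for v
    using that by (simp add: dual_cosine_transform_def dual_cosine_integrand_eq \<omega>'_def stiefel_measureD[OF \<mu>])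
  have "integrable \<mu> (\<lambda>v. \<integral>u. \<phi> u * kern \<alpha> u v * \<omega>' v \<partial>\<nu>)"
    using P.integrable_fst[OF int'] by simp
  then show "integrable \<mu> (\<lambda>v. dual_cosine_transform \<nu> \<phi> \<alpha> v * cnj (\<omega> v))"
    by (subst Bochner_Integration.integrable_cong[OF refl T[symmetric]])
  have "(\<integral>v. dual_cosine_transform \<nu> \<phi> \<alpha> v * cnj (\<omega> v) \<partial>\<mu>) = (\<integral>v. (\<integral>u. \<phi> u * kern \<alpha> u v * \<omega>' v \<partial>\<nu>) \<partial>\<mu>)"
    by (rule Bochner_Integration.integral_cong[OF refl T[symmetric]])
  also have "\<dots> = (\<integral>u. (\<integral>v. \<phi> u * kern \<alpha> u v * \<omega>' v \<partial>\<mu>) \<partial>\<nu>)"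
    using P.integral_fst[OF int'] P.integral_snd[OF int'] by simp
  also have "\<dots> = (\<integral>u. \<phi> u * (\<integral>v. kern \<alpha> u v * \<omega>' v \<partial>\<mu>) \<partial>\<nu>)"
    by (simp add: mult.assoc)
  finally have I: "(\<integral>v. dual_cosine_transform \<nu> \<phi> \<alpha> v * cnj (\<omega> v) \<partial>\<mu>) = (\<integral>u. \<phi> u * (\<integral>v. kern \<alpha> u v * \<omega>' v \<partial>\<mu>) \<partial>\<nu>)" .
  show "zeta_dual \<mu> \<nu> \<phi> \<omega> \<alpha> = 1 / siegel_gamma CARD('m) (\<alpha> / 2) *
      (\<integral>u. \<phi> u * (\<integral>v. kern \<alpha> u v * \<omega>' v \<partial>\<mu>) \<partial>\<nu>)"
    unfolding zeta_dual_def stiefel_inner_def mult.assoc integral_mult_right_zero I ..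
qed

text \<open>On the half-plane the lifted integral equals bump mass times the pairing, and it also
  equals the regularised integral divided by Pochhammer factors and C. Solving for the pairing gives
  an expression that makes sense on the whole disc.\<close>

lemma local_extension:
  assumes R: "R > 0"
  shows "\<exists>Z. Z holomorphic_on ball 0 R \<and>
    (\<forall>\<alpha>\<in>ball 0 R. Re \<alpha> > real CARD('m) - 1 \<longrightarrow> Z \<alpha> = zeta_dual \<mu> \<nu> \<phi> \<omega> \<alpha>)"
proof -
  interpret N: prob_space \<nu> by (rule stiefel_measureD[OF \<nu>])
  let ?m = "real CARD('m)" and ?K = "complex_of_nat CARD('k)"
  \<comment> \<open>N \<ge> R + m places the disc of radius R inside the half-plane Re z > m - 1 - 2
    N.\<close>
  define N where "N = nat \<lceil>R + ?m\<rceil>"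
  have N: "real N \<ge> R + ?m" unfolding N_def by linarith
  let ?h = "?m - 1 - 2 * real N"
  \<comment> \<open>A bound for |\<alpha> - k| on the disc, hence also for the exponent (\<alpha> -
    k)/2 whose bump mass must not vanish.\<close>
  define Q where "Q = R + real CARD('k)"
  have Q: "Q > 0" using R by (simp add: Q_def)
  have half: "norm ((\<alpha> - ?K) / 2) < Q" if "\<alpha> \<in> ball 0 R" for \<alpha>
  proof -
    have "real CARD('k) \<ge> 0" by (rule of_nat_0_le_iff)
    then have "norm (\<alpha> - ?K) < 2 * Q"
      using that norm_triangle_ineq4[of \<alpha> ?K] R unfolding Q_def mem_ball_0 norm_of_nat distrib_left
      by linarith
    then show ?thesis by (simp add: norm_divide)
  qed
  have inh: "Re \<alpha> > ?h" if "\<alpha> \<in> ball 0 R" for \<alpha>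
    using that abs_Re_le_cmod[of \<alpha>] N R by simp
  obtain \<delta> where \<delta>: "0 < \<delta>" "\<delta> \<le> 1"
    "\<And>x :: real^'m^'n. norm (transpose x ** x - mat 1) < \<delta> \<Longrightarrow> gram x \<noteq> 0"
    and c_int: "\<And>r z. norm z \<le> Q \<Longrightarrow> integrable lborel (\<lambda>x :: real^'m^'n. bump r \<delta> x *\<^sub>R cpow (gram x) z)"
    and c_hol: "\<And>r. (\<lambda>z. \<integral>x. bump r \<delta> (x :: real^'m^'n) *\<^sub>R cpow (gram x) z \<partial>lborel) holomorphic_on ball 0 Q"
    and c_nz: "\<And>r z. norm z \<le> Q \<Longrightarrow> (\<integral>x. bump r \<delta> (x :: real^'m^'n) *\<^sub>R cpow (gram x) z \<partial>lborel) \<noteq> 0"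
  proof (rule bump_mass[OF mn Q], goal_cases)
    case prems: 1
    show ?case by (rule prems(1); fact prems)
  qed
  define r where "r = 2 * (CARD('m) * N)"
  define \<rho> where "\<rho> = (bump r \<delta> :: real^'m^'n \<Rightarrow> real)"
  define c where "c \<alpha> = (\<integral>x. \<rho> x *\<^sub>R cpow (gram x) ((\<alpha> - ?K) / 2) \<partial>lborel)" for \<alpha>
  define g where "g x = \<rho> x *\<^sub>R cnj (\<omega> (orth x))" for x
  have g: "higher_differentiable_on UNIV g (2 * (CARD('m) * N))"
    unfolding g_def \<rho>_def r_def by (rule higher_differentiable_on_bump_mult[OF \<omega> \<delta>(1,3)])
  have gs: "norm x \<le> 2 * real CARD('m)" if "g x \<noteq> 0" for x
    using bump_norm[of r \<delta> x] that \<delta> by (auto simp: g_def \<rho>_def)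
  have \<rho>gram: "gram x \<noteq> 0" if "\<rho> x \<noteq> 0" for x
    using bump_nz[of r \<delta> x] that \<delta>(1) \<delta>(3)[of x] by (simp add: \<rho>_def)
  obtain \<kappa> :: "complex \<Rightarrow> real^'k^'n \<Rightarrow> (real^'m^'m) \<times> (real^'m^'n) \<Rightarrow> complex" where
    hol: "\<And>u p. (\<lambda>\<alpha>. \<kappa> \<alpha> u p) holomorphic_on UNIV"
    and meas: "\<And>\<alpha>. (\<lambda>z. \<kappa> \<alpha> (fst z) (snd z)) \<in> borel_measurable borel"
    and dom: "\<And>\<alpha>. Re \<alpha> > ?h \<Longrightarrow> \<exists>r>0. \<exists>G. cball \<alpha> r \<subseteq> {z. Re z > ?h} \<and>
      integrable lborel G \<and> (\<forall>z\<in>cball \<alpha> r. \<forall>u\<in>stiefel. \<forall>p. norm (\<kappa> z u p) \<le> G p)"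
    and main: "\<And>\<alpha> u. Re \<alpha> > ?m - 1 \<Longrightarrow> u \<in> stiefel \<Longrightarrow>
      (\<Prod>j\<in>(UNIV :: 'm set). pochhammer ((\<alpha> - of_nat (rk j)) / 2) N) *
        (enn2real (slab_const TYPE('m) TYPE('k)) *\<^sub>R
          (\<integral>x. cpow (gram (transpose u ** x)) ((\<alpha> - of_nat CARD('k)) / 2) * g x \<partial>lborel)) =
      (\<integral>p. \<kappa> \<alpha> u p \<partial>lborel)"
  proof (rule regularised_kernel[where 'k='k and A="2 * ?m", OF kn g], goal_cases)
    case (1 x)
    show ?case by (rule gs[OF 1(2)])
  next
    case prems: 2
    show ?case by (rule prems(1); fact prems)
  qed
  define C where "C = enn2real (slab_const TYPE('m) TYPE('k))"
  have C: "C \<noteq> 0" using slab_const_pos[where 'm='m and 'k='k] slab_const_finite[where 'm='m and 'k='k]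
    by (auto simp: C_def enn2real_eq_0_iff)
  \<comment> \<open>\<open>gram (u' x)\<close> is the product of \<open>gram x\<close> and
    \<open>gram (u' orth x)\<close>; by independence the matrix integral splits into the bump mass
    and an integral over the manifold.\<close>
  have lift: "(\<integral>x. cpow (gram (transpose u ** x)) ((\<alpha> - ?K) / 2) * g x \<partial>lborel) = c \<alpha> * (\<integral>v. kern \<alpha> u v * \<omega>' v \<partial>\<mu>)"
    if \<alpha>: "\<alpha> \<in> ball 0 R" "Re \<alpha> > ?m - 1" and u: "u \<in> stiefel" for \<alpha> u
  proof -
    have "(\<integral>x. \<rho> x *\<^sub>R (cpow (gram x) ((\<alpha> - ?K) / 2) * (kern \<alpha> u (orth x) * \<omega>' (orth x))) \<partial>lborel) =
        (\<integral>x. \<rho> x *\<^sub>R cpow (gram x) ((\<alpha> - ?K) / 2) \<partial>lborel) * (\<integral>v. kern \<alpha> u v * \<omega>' v \<partial>\<mu>)"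
    proof (rule stiefel_measure_lift(2)[OF \<mu> mn])
      show "\<rho> \<in> borel_measurable borel" unfolding \<rho>_def
        by (rule borel_measurable_continuous_onI[OF higher_differentiable_on_imp_continuous_on[OF higher_differentiable_on_bump]])
      show "\<rho> x \<ge> 0" for x by (simp add: \<rho>_def bump_nonneg)
      have "integrable lborel (\<lambda>x. \<rho> x *\<^sub>R cpow (gram x) 0)" unfolding \<rho>_def using Q by (intro c_int) simp
      then have "integrable lborel (\<lambda>x. Re (\<rho> x *\<^sub>R cpow (gram x) 0))" by (rule integrable_Re)
      moreover have "Re (\<rho> x *\<^sub>R cpow (gram x) 0) = \<rho> x" for x using \<rho>gram[of x] by (cases "\<rho> x = 0") auto
      ultimately show "integrable lborel \<rho>" by (simp only:)
      show "\<rho> (q ** x) = \<rho> x" if "orthogonal_matrix q" for q x using that by (simp add: \<rho>_def bump_invariant)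
      show "\<rho> x = 0" if "gram x = 0" for x using \<rho>gram that by blast
      show "(\<lambda>v. kern \<alpha> u v * \<omega>' v) \<in> borel_measurable borel"
        by (intro borel_measurable_times kern_measurable \<omega>'_measurable)
      show "integrable \<mu> (\<lambda>v. kern \<alpha> u v * \<omega>' v)" by (rule integrable_kern[OF \<alpha>(2) u])
      show "integrable lborel (\<lambda>x. \<rho> x *\<^sub>R cpow (gram x) ((\<alpha> - ?K) / 2))"
        unfolding \<rho>_def using half[OF \<alpha>(1)] by (intro c_int) simp
    qed measurable
    moreover have "\<rho> x *\<^sub>R (cpow (gram x) ((\<alpha> - ?K) / 2) * (kern \<alpha> u (orth x) * \<omega>' (orth x))) =
        cpow (gram (transpose u ** x)) ((\<alpha> - ?K) / 2) * g x" for x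
    proof (cases "\<rho> x = 0")
      case False
      then have "orth x \<in> stiefel" by (intro orth_stiefel \<rho>gram)
      moreover have "cpow (gram (transpose u ** x)) ((\<alpha> - ?K) / 2) = cpow (gram x) ((\<alpha> - ?K) / 2) * kern \<alpha> u (orth x)"
        unfolding gram_transpose_orth[of u x] kern_def by (rule cpow_mult) (simp_all add: gram_nonneg)
      ultimately show ?thesis by (simp add: g_def \<omega>'_def scaleR_conv_of_real mult_ac)
    qed (simp add: g_def)
    ultimately show ?thesis by (simp add: c_def)
  qed
  have \<kappa>u: "\<kappa> \<alpha> u \<in> borel_measurable lborel" for \<alpha> u
  proof -
    have "(\<lambda>p. (u, p)) \<in> borel_measurable borel" by (intro borel_measurable_continuous_onI continuous_intros)
    from measurable_compose[OF this meas[of \<alpha>]] show ?thesis by simp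
  qed
  let ?H = "{z. Re z > ?h}"
  have oH: "open ?H" by (rule open_halfspace_Re_gt)
  have inner: "(\<lambda>\<alpha>. \<integral>p. \<kappa> \<alpha> u p \<partial>lborel) holomorphic_on ?H" if u: "u \<in> stiefel" for u
  proof (rule holomorphic_on_integral[OF oH \<kappa>u])
    show "(\<lambda>\<alpha>. \<kappa> \<alpha> u p) holomorphic_on ?H" for p by (rule holomorphic_on_subset[OF hol]) simp
    fix w assume "w \<in> ?H"
    then have "Re w > ?h" by simp
    from dom[OF this] obtain r G where "r > 0" "cball w r \<subseteq> ?H" "integrable lborel G"
      "\<forall>z\<in>cball w r. \<forall>u\<in>stiefel. \<forall>p. norm (\<kappa> z u p) \<le> G p" by blast
    then show "\<exists>r>0. \<exists>G. cball w r \<subseteq> ?H \<and> integrable lborel G \<and>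
        (\<forall>z\<in>cball w r. \<forall>x\<in>space lborel. norm (\<kappa> z u x) \<le> G x)"
      using u by (intro exI[of _ r] conjI exI[of _ G]) auto
  qed
  define \<Phi> where "\<Phi> \<alpha> = (\<integral>u. \<phi> u * (\<integral>p. \<kappa> \<alpha> u p \<partial>lborel) \<partial>\<nu>)" for \<alpha>
  \<comment> \<open>The dominating function G does not depend on u, so |\<phi>| times its integral
    dominates the outer integrand; this is the point of the uniform bounds.\<close>
  have outer: "\<Phi> holomorphic_on ?H"
    unfolding \<Phi>_def
  proof (rule holomorphic_on_integral[OF oH])
    fix \<alpha>
    have "(\<lambda>(u, p). \<kappa> \<alpha> u p) \<in> borel_measurable (\<nu> \<Otimes>\<^sub>M lborel)"
    proof -
      have "(\<lambda>z. (fst z, snd z)) \<in> measurable (\<nu> \<Otimes>\<^sub>M lborel) (borel :: ((real^'k^'n) \<times> (real^'m^'m) \<times> (real^'m^'n)) measure)"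
      proof (rule borel_measurable_Pair)
        show "fst \<in> borel_measurable (\<nu> \<Otimes>\<^sub>M lborel)"
          using measurable_compose[OF measurable_fst id_measurable(2)] by simp
        show "snd \<in> borel_measurable (\<nu> \<Otimes>\<^sub>M (lborel :: ((real^'m^'m) \<times> (real^'m^'n)) measure))"
          using measurable_snd[of \<nu> lborel] by simp
      qed
      from measurable_compose[OF this meas[of \<alpha>]] show ?thesis by (simp add: case_prod_unfold)
    qed
    then have "(\<lambda>u. \<integral>p. \<kappa> \<alpha> u p \<partial>lborel) \<in> borel_measurable \<nu>"
      by (rule lborel.borel_measurable_lebesgue_integral)
    then show "(\<lambda>u. \<phi> u * (\<integral>p. \<kappa> \<alpha> u p \<partial>lborel)) \<in> borel_measurable \<nu>" by measurable
  next
    show "(\<lambda>\<alpha>. \<phi> u * (\<integral>p. \<kappa> \<alpha> u p \<partial>lborel)) holomorphic_on ?H" if "u \<in> space \<nu>" for u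
      using that by (intro holomorphic_intros inner) (simp add: stiefel_measureD[OF \<nu>])
  next
    fix w assume "w \<in> ?H"
    then have "Re w > ?h" by simp
    from dom[OF this] obtain r G where rG: "r > 0" "cball w r \<subseteq> ?H" "integrable lborel G"
      "\<forall>z\<in>cball w r. \<forall>u\<in>stiefel. \<forall>p. norm (\<kappa> z u p) \<le> G p" by blast
    have bd: "norm (\<phi> u * (\<integral>p. \<kappa> z u p \<partial>lborel)) \<le> norm (\<phi> u) * (\<integral>p. G p \<partial>lborel)"
      if "z \<in> cball w r" "u \<in> space \<nu>" for z u
    proof -
      have u: "u \<in> stiefel" using that by (simp add: stiefel_measureD[OF \<nu>])
      have "norm (\<integral>p. \<kappa> z u p \<partial>lborel) \<le> (\<integral>p. G p \<partial>lborel)"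
      proof (rule Bochner_Integration.integral_norm_bound_integral[OF _ rG(3)])
        show le: "norm (\<kappa> z u p) \<le> G p" for p using rG(4) that u by blast
        have "norm (\<kappa> z u p) \<le> norm (G p)" for p
          using le[of p] by (rule order.trans) simp
        then show "integrable lborel (\<kappa> z u)"
          by (intro Bochner_Integration.integrable_bound[OF rG(3) \<kappa>u AE_I2])
      qed
      then show ?thesis by (simp add: norm_mult mult_left_mono)
    qed
    have "integrable \<nu> (\<lambda>u. norm (\<phi> u) * (\<integral>p. G p \<partial>lborel))" using \<phi> by simp
    then show "\<exists>r>0. \<exists>G. cball w r \<subseteq> ?H \<and> integrable \<nu> G \<and>
        (\<forall>z\<in>cball w r. \<forall>u\<in>space \<nu>. norm (\<phi> u * (\<integral>p. \<kappa> z u p \<partial>lborel)) \<le> G u)"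
      using rG(1,2) bd by (intro exI[of _ r] conjI exI[of _ "\<lambda>u. norm (\<phi> u) * (\<integral>p. G p \<partial>lborel)"]) auto
  qed
  define k0 where "k0 = inverse (complex_of_real (pi powr (real (CARD('m) * (CARD('m) - 1)) / 4)))"
  \<comment> \<open>Only the shifted reciprocal Gamma factors are written here: the Pochhammer
    factors completing them to the full product are contained in \<Phi>. The denominator has no
    zeros on the disc.\<close>
  define Z where "Z \<alpha> = k0 * (\<Prod>j\<in>(UNIV :: 'm set). rGamma ((\<alpha> - of_nat (rk j)) / 2 + of_nat N)) *
    (\<Phi> \<alpha> / (complex_of_real C * c \<alpha>))" for \<alpha>
  have c0: "c \<alpha> \<noteq> 0" if "\<alpha> \<in> ball 0 R" for \<alpha>
    unfolding c_def \<rho>_def using half[OF that] by (intro c_nz) simp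
  have "c holomorphic_on ball 0 R"
  proof -
    have "((\<lambda>z. \<integral>x. \<rho> x *\<^sub>R cpow (gram x) z \<partial>lborel) \<circ> (\<lambda>\<alpha>. (\<alpha> - ?K) / 2)) holomorphic_on ball 0 R"
    proof (rule holomorphic_on_compose_gen)
      show "(\<lambda>z. \<integral>x. \<rho> x *\<^sub>R cpow (gram x) z \<partial>lborel) holomorphic_on ball 0 Q" unfolding \<rho>_def by (rule c_hol)
      show "(\<lambda>\<alpha>. (\<alpha> - ?K) / 2) ` ball 0 R \<subseteq> ball 0 Q" using half by (auto simp: dist_norm)
    qed (intro holomorphic_intros; simp)
    then show ?thesis by (simp add: c_def[abs_def] o_def)
  qed
  moreover have "\<Phi> holomorphic_on ball 0 R"
    by (rule holomorphic_on_subset[OF outer]) (use inh in blast)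
  ultimately have "Z holomorphic_on ball 0 R"
    unfolding Z_def using C c0 by (intro holomorphic_intros) auto
  moreover have "Z \<alpha> = zeta_dual \<mu> \<nu> \<phi> \<omega> \<alpha>" if \<alpha>: "\<alpha> \<in> ball 0 R" "Re \<alpha> > ?m - 1" for \<alpha>
  proof -
    let ?P = "\<Prod>j\<in>(UNIV :: 'm set). pochhammer ((\<alpha> - of_nat (rk j)) / 2) N"
    let ?J = "\<lambda>u. \<integral>v. kern \<alpha> u v * \<omega>' v \<partial>\<mu>"
    have "\<Phi> \<alpha> = (\<integral>u. (?P * complex_of_real C * c \<alpha>) * (\<phi> u * ?J u) \<partial>\<nu>)"
      unfolding \<Phi>_def
    proof (rule Bochner_Integration.integral_cong[OF refl])
      fix u assume "u \<in> space \<nu>"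
      then have u: "u \<in> stiefel" by (simp add: stiefel_measureD[OF \<nu>])
      show "\<phi> u * (\<integral>p. \<kappa> \<alpha> u p \<partial>lborel) = (?P * complex_of_real C * c \<alpha>) * (\<phi> u * ?J u)"
        unfolding main[OF \<alpha>(2) u, symmetric] lift[OF \<alpha> u] C_def by (simp add: scaleR_conv_of_real mult_ac)
    qed
    then have "\<Phi> \<alpha> = (?P * complex_of_real C * c \<alpha>) * (\<integral>u. \<phi> u * ?J u \<partial>\<nu>)" by (simp only: integral_mult_right_zero)
    then have "\<Phi> \<alpha> / (complex_of_real C * c \<alpha>) = ?P * (\<integral>u. \<phi> u * ?J u \<partial>\<nu>)"
      using C c0[OF \<alpha>(1)] by (simp add: field_simps)
    then have "Z \<alpha> = k0 * (?P * (\<Prod>j\<in>(UNIV :: 'm set). rGamma ((\<alpha> - of_nat (rk j)) / 2 + of_nat N))) * (\<integral>u. \<phi> u * ?J u \<partial>\<nu>)"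
      unfolding Z_def by (simp only: mult_ac)
    then show ?thesis
      unfolding convergence(3)[OF \<alpha>(2)] inverse_siegel_gamma[where 'm='m] rGamma_prod_shift[of \<alpha> N] k0_def .
  qed
  ultimately show ?thesis by blast
qed

end

theorem corollary5p8:
  fixes \<mu> :: "(real^'m^'n) measure"
    and \<nu> :: "(real^'k^'n) measure"
    and \<phi> :: "real^'k^'n \<Rightarrow> complex"
    and \<omega> :: "real^'m^'n \<Rightarrow> complex"
  assumes "1 \<le> CARD('m)" and "CARD('m) \<le> CARD('k)" and "CARD('k) \<le> CARD('n) - 1"
    and "stiefel_measure \<mu>" and "stiefel_measure \<nu>"
    and "integrable \<nu> \<phi>" and "right_invariant \<phi>"
    and "smooth_on_submanifold stiefel \<omega>"
  shows "(\<forall>\<alpha>. Re \<alpha> > real CARD('m) - 1 \<longrightarrow>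
            (AE v in \<mu>. integrable \<nu> (dual_cosine_integrand \<phi> \<alpha> v)) \<and>
            integrable \<mu> (\<lambda>v. dual_cosine_transform \<nu> \<phi> \<alpha> v * cnj (\<omega> v))) \<and>
         (\<exists>Z. Z holomorphic_on UNIV \<and>
            (\<forall>\<alpha>. Re \<alpha> > real CARD('m) - 1 \<longrightarrow> Z \<alpha> = zeta_dual \<mu> \<nu> \<phi> \<omega> \<alpha>))"
proof -
  have kn: "CARD('k) \<le> CARD('n)" and mn: "CARD('m) \<le> CARD('n)" using assms(2,3) by linarith+
  note hyps = mn kn assms(4,5,6,8)
  show ?thesis
    using convergence(1,2)[OF hyps] entire_gluing[OF local_extension[OF hyps]] by blast
qed

end
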